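(* Let $n=2$ and let $\hat W^k_\ell$ ($k=0,1,2$; $\ell=0,\dots,N$) be the hierarchical B-spline spaces (with homogeneous boundary conditions) on $\hat\Omega=(0,1)^2$ associated with a nested sequence of tensor-product spline spaces and a nested sequence of subdomains $\Omega_\ell$, as defined in the context. Assume: (1) for each $\ell=0,\dots,N-1$, $\Omega_{\ell+1}$ is the union of supports of basis functions of the previous level, that is $\Omega_{\ell+1}=\bigcup_{\beta\in S}\mathrm{supp}(\beta)$ for some $S\subset\mathcal B^2_\ell$; (2) for each $\ell=0,\dots,N-1$, each $k=0,1,2$ and each basis function $\beta^k\in\mathcal B^k_\ell$, the overlap $\mathrm{supp}(\beta^k)\cap\Omega^c_{\ell+1}$ is connected and simply connected, where $\Omega^c_{\ell+1}=\Omega_0\setminus\overline{\Omega}_{\ell+1}$. Then the complex $$0\to\hat W^0_\ell\xrightarrow{\ \mathbf{grad}\ }\hat W^1_\ell\xrightarrow{\ \mathrm{curl}\ }\hat W^2_\ell\xrightarrow{\ \int\ }\mathbb R\to0$$ is exact for $\ell=0,\dots,N$.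
   Context: **Univariate splines.** Let $p\ge1$ and let $\Xi=\{\xi_1,\dots,\xi_{m+p+1}\}$ be an open knot vector: $0=\xi_1=\dots=\xi_{p+1}<\xi_{p+2}\le\dots\le\xi_m<\xi_{m+1}=\dots=\xi_{m+p+1}=1$, with every internal knot of multiplicity at most $p$. Let $B_{i,p}$, $i=1,\dots,m$, be the B-splines given by the Cox-de Boor formula, and let $S_p(\Xi)$ be their span. For $i=2,\dots,m$ let $D_{i,p-1}=\frac{p}{\xi_{i+p}-\xi_i}B_{i,p-1}$, where $B_{i,p-1}$ is the B-spline of degree $p-1$ with local knot vector $\{\xi_i,\dots,\xi_{i+p}\}$. Supports are taken as open sets: $\mathrm{supp}(B_{i,p})=(\xi_i,\xi_{i+p+1})$ and $\mathrm{supp}(D_{i,p-1})=(\xi_i,\xi_{i+p})$. **Levels.** For $\ell=0,\dots,N$ let degrees $p_{1,\ell},p_{2,\ell}\ge1$ and open knot vectors $\Xi_{1,\ell},\Xi_{2,\ell}$ be given, where for $q=1,2$, with $p=p_{q,\ell}$ and some $m=m_{q,\ell}$, $\Xi_{q,\ell}=\{\xi_1,\dots,\xi_{m+p+1}\}$ (the knots depending on $q$ and $\ell$) satisfies $0=\xi_1=\dots=\xi_{p+1}<\xi_{p+2}\le\dots\le\xi_m<\xi_{m+1}=\dots=\xi_{m+p+1}=1$ with every internal knot of multiplicity at most $p$, and with nested spaces $S_{p_{1,\ell}}(\Xi_{1,\ell})\otimes S_{p_{2,\ell}}(\Xi_{2,\ell})\subset S_{p_{1,\ell+1}}(\Xi_{1,\ell+1})\otimes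 S_{p_{2,\ell+1}}(\Xi_{2,\ell+1})$. Let $\mathcal M_\ell$ be the Bézier mesh of level $\ell$, i.e. the Cartesian grid of $\hat\Omega$ generated by the knots without repetitions. **Spline forms with homogeneous boundary conditions (scalar/vector proxies).** For level $\ell$ and direction $q\in\{1,2\}$, let $\mathring B_q$ denote the set of the functions $B_{i,p_{q,\ell}}$ of $\Xi_{q,\ell}$ vanishing at $0$ and $1$ (all except the first and last), and $D_q$ the set of all functions $D_{i,p_{q,\ell}-1}$ of $\Xi_{q,\ell}$. Then $\mathcal B^0_\ell=\{b_1(x_1)b_2(x_2): b_q\in\mathring B_q\}$; $\mathcal B^1_\ell$ consists of the vector fields $(d_1(x_1)b_2(x_2),0)$ and $(0,b_1(x_1)d_2(x_2))$; $\mathcal B^2_\ell=\{d_1(x_1)d_2(x_2)\}$, with $b_q\in\mathring B_q$, $d_q\in D_q$. The support of a basis function is the product of the two open univariate supports. Here $\mathrm{curl}(v_1,v_2)=\partial_1v_2-\partial_2v_1$. **Subdomains.** $\hat\Omega=\Omega_0\supset\Omega_1\supset\dots\supset\Omega_N\supset\Omega_{N+1}=\emptyset$ are open sets, each the interior of its closure, such that the closure of $\Omega_\ell$ is the union of closures of elements of $\mathcal M_{\ell-1}$, $\ell=1,\dots,N$. Equality of $\Omega_{\ell+1}$ with a union of open supports is understood up to taking closures. The empty set counts as connected and simply connected. **Hierarchical spaces.** For $k=0,1,2$: $\mathcal H^k_0=\mathcal B^k_0$ and, for $\ell=0,\dots,N-1$, $\mathcal H^k_{\ell+1}=\{\beta\in\mathcal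 H^k_\ell:\mathrm{supp}(\beta)\not\subset\Omega_{\ell+1}\}\cup\{\beta\in\mathcal B^k_{\ell+1}:\mathrm{supp}(\beta)\subset\Omega_{\ell+1}\}$; $\hat W^k_\ell=\mathrm{span}\,\mathcal H^k_\ell$. *)

theory Defs
  imports "HOL-Analysis.Analysis" "HOL-Library.Function_Algebras"
begin

section \<open>Functions as a real vector space\<close>

text \<open>The pointwise structure, so that the library's \<^const>\<open>span\<close> applies to sets of functions.\<close>

instantiation "fun" :: (type, real_vector) real_vector
begin

definition scaleR_fun :: "real \<Rightarrow> ('a \<Rightarrow> 'b) \<Rightarrow> 'a \<Rightarrow> 'b"
  where "scaleR_fun c f = (\<lambda>x. c *\<^sub>R f x)"

instance
  by standard (simp_all add: scaleR_fun_def fun_eq_iff scaleR_add_right scaleR_add_left)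

end


section \<open>Univariate B-splines\<close>

text \<open>Knots are numbered from 1; only the values of \<open>knot\<close> at
  \<open>1, \<dots>, nspl + deg + 1\<close> are meaningful.\<close>

record knot_vector =
  deg :: nat
  nspl :: nat
  knot :: "nat \<Rightarrow> real"

definition open_knot_vector :: "knot_vector \<Rightarrow> bool" where
  "open_knot_vector K \<longleftrightarrow>
     (let p = deg K; m = nspl K; \<xi> = knot K in
       1 \<le> p \<and> p + 1 \<le> m \<and>
       (\<forall>i\<in>{1..p + 1}. \<xi> i = 0) \<and>
       (\<forall>i\<in>{p + 2..m}. 0 < \<xi> i \<and> \<xi> i < 1) \<and>
       (\<forall>i\<in>{m + 1..m + p + 1}. \<xi> i = 1) \<and>
       mono_on {1..m + p + 1} \<xi> \<and>
       (\<forall>i\<in>{p + 2..m}. card {j \<in> {1..m + p + 1}. \<xi> j = \<xi> i} \<le> p))"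

text \<open>The Cox-de Boor recursion; the usual convention \<open>0/0 = 0\<close> is the behaviour of division
  in HOL. Knot spans are half-open, so all B-splines are right-continuous and vanish outside
  \<open>[0,1)\<close>. In particular the value at the right end point 1 is always 0 here; this is immaterial,
  since functions are only ever compared almost everywhere on the open unit square, and the
  B-splines that do not vanish at 0 and 1 in the sense of traces are picked out by their index.\<close>

fun bspline :: "(nat \<Rightarrow> real) \<Rightarrow> nat \<Rightarrow> nat \<Rightarrow> real \<Rightarrow> real" where
  "bspline \<xi> 0 i x = (if \<xi> i \<le> x \<and> x < \<xi> (i + 1) then 1 else 0)"
| "bspline \<xi> (Suc p) i x =
     (x - \<xi> i) / (\<xi> (i + p + 1) - \<xi> i) * bspline \<xi> p i x +
     (\<xi> (i + p + 2) - x) / (\<xi> (i + p + 2) - \<xi> (i + 1)) * bspline \<xi> p (i + 1) x"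

definition spline_space :: "knot_vector \<Rightarrow> (real \<Rightarrow> real) set" where
  "spline_space K = span ((\<lambda>i. bspline (knot K) (deg K) i) ` {1..nspl K})"

text \<open>A basis function is represented by the pair of the function and its open support.\<close>

type_synonym ('a, 'v) basis_fun = "('a \<Rightarrow> 'v) \<times> 'a set"

abbreviation supp :: "('a, 'v) basis_fun \<Rightarrow> 'a set" where
  "supp \<beta> \<equiv> snd \<beta>"

text \<open>All B-splines of degree \<open>p\<close> except the first and the last one.\<close>

definition B_ring :: "knot_vector \<Rightarrow> (real, real) basis_fun set" where
  "B_ring K = (let p = deg K; \<xi> = knot K in
     (\<lambda>i. (bspline \<xi> p i, {\<xi> i <..< \<xi> (i + p + 1)})) ` {2..nspl K - 1})"

definition D_all :: "knot_vector \<Rightarrow> (real, real) basis_fun set" where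
  "D_all K = (let p = deg K; \<xi> = knot K in
     (\<lambda>i. (\<lambda>x. real p / (\<xi> (i + p) - \<xi> i) * bspline \<xi> (p - 1) i x,
           {\<xi> i <..< \<xi> (i + p)})) ` {2..nspl K})"


section \<open>Tensor products, Bezier mesh and spline forms\<close>

definition Omega_hat :: "(real \<times> real) set" where
  "Omega_hat = {0<..<1} \<times> {0<..<1}"

definition tensor_space ::
    "(real \<Rightarrow> real) set \<Rightarrow> (real \<Rightarrow> real) set \<Rightarrow> (real \<times> real \<Rightarrow> real) set" where
  "tensor_space V1 V2 = span {\<lambda>(x1, x2). f x1 * g x2 | f g. f \<in> V1 \<and> g \<in> V2}"

definition knot_spans :: "knot_vector \<Rightarrow> real set set" where
  "knot_spans K = (let Z = knot K ` {1..nspl K + deg K + 1} in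
     {{a<..<b} | a b. a \<in> Z \<and> b \<in> Z \<and> a < b \<and> {a<..<b} \<inter> Z = {}})"

definition bezier_mesh :: "knot_vector \<Rightarrow> knot_vector \<Rightarrow> (real \<times> real) set set" where
  "bezier_mesh K1 K2 = {I \<times> J | I J. I \<in> knot_spans K1 \<and> J \<in> knot_spans K2}"

definition basis0 :: "knot_vector \<Rightarrow> knot_vector \<Rightarrow> (real \<times> real, real) basis_fun set" where
  "basis0 K1 K2 =
     {(\<lambda>(x1, x2). b1 x1 * b2 x2, I \<times> J) | b1 b2 I J.
        (b1, I) \<in> B_ring K1 \<and> (b2, J) \<in> B_ring K2}"

definition basis1 :: "knot_vector \<Rightarrow> knot_vector \<Rightarrow> (real \<times> real, real \<times> real) basis_fun set" where
  "basis1 K1 K2 =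
     {(\<lambda>(x1, x2). (d1 x1 * b2 x2, 0), I \<times> J) | d1 b2 I J.
        (d1, I) \<in> D_all K1 \<and> (b2, J) \<in> B_ring K2} \<union>
     {(\<lambda>(x1, x2). (0, b1 x1 * d2 x2), I \<times> J) | b1 d2 I J.
        (b1, I) \<in> B_ring K1 \<and> (d2, J) \<in> D_all K2}"

definition basis2 :: "knot_vector \<Rightarrow> knot_vector \<Rightarrow> (real \<times> real, real) basis_fun set" where
  "basis2 K1 K2 =
     {(\<lambda>(x1, x2). d1 x1 * d2 x2, I \<times> J) | d1 d2 I J.
        (d1, I) \<in> D_all K1 \<and> (d2, J) \<in> D_all K2}"


section \<open>Hierarchical spaces\<close>

primrec hier_basis ::
    "(nat \<Rightarrow> ('a, 'v) basis_fun set) \<Rightarrow> (nat \<Rightarrow> 'a set) \<Rightarrow> nat \<Rightarrow> ('a, 'v) basis_fun set" where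
  "hier_basis \<B> \<Omega> 0 = \<B> 0"
| "hier_basis \<B> \<Omega> (Suc l) =
     {\<beta> \<in> hier_basis \<B> \<Omega> l. \<not> supp \<beta> \<subseteq> \<Omega> (Suc l)} \<union>
     {\<beta> \<in> \<B> (Suc l). supp \<beta> \<subseteq> \<Omega> (Suc l)}"

definition hier_space ::
    "(nat \<Rightarrow> ('a, 'v :: real_vector) basis_fun set) \<Rightarrow> (nat \<Rightarrow> 'a set) \<Rightarrow> nat \<Rightarrow> ('a \<Rightarrow> 'v) set" where
  "hier_space \<B> \<Omega> l = span (fst ` hier_basis \<B> \<Omega> l)"

definition nested_spline_levels ::
    "nat \<Rightarrow> (nat \<Rightarrow> knot_vector) \<Rightarrow> (nat \<Rightarrow> knot_vector) \<Rightarrow> bool" where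
  "nested_spline_levels N K1 K2 \<longleftrightarrow>
     (\<forall>l\<le>N. open_knot_vector (K1 l) \<and> open_knot_vector (K2 l)) \<and>
     (\<forall>l<N. tensor_space (spline_space (K1 l)) (spline_space (K2 l)) \<subseteq>
            tensor_space (spline_space (K1 (Suc l))) (spline_space (K2 (Suc l))))"

definition nested_subdomains ::
    "nat \<Rightarrow> (nat \<Rightarrow> knot_vector) \<Rightarrow> (nat \<Rightarrow> knot_vector) \<Rightarrow> (nat \<Rightarrow> (real \<times> real) set) \<Rightarrow> bool" where
  "nested_subdomains N K1 K2 \<Omega> \<longleftrightarrow>
     \<Omega> 0 = Omega_hat \<and> \<Omega> (Suc N) = {} \<and>
     (\<forall>l\<le>N. \<Omega> (Suc l) \<subseteq> \<Omega> l) \<and>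
     (\<forall>l\<le>N. open (\<Omega> l) \<and> interior (closure (\<Omega> l)) = \<Omega> l) \<and>
     (\<forall>l\<in>{1..N}. \<exists>E \<subseteq> bezier_mesh (K1 (l - 1)) (K2 (l - 1)). closure (\<Omega> l) = (\<Union>Q\<in>E. closure Q))"


section \<open>The complex\<close>

text \<open>Functions represent their classes modulo null sets of the open unit square. Spline forms
  are piecewise polynomial on a Cartesian grid, scalar fields in the complex are continuous and
  vector fields are tangentially continuous across grid lines. Hence gradient and curl are given by the
  classical partial derivatives, which exist off the (null) grid lines; the following relations
  demand this existence almost everywhere.\<close>

definition is_grad :: "(real \<times> real \<Rightarrow> real) \<Rightarrow> (real \<times> real \<Rightarrow> real \<times> real) \<Rightarrow> bool" where
  "is_grad u v \<longleftrightarrow>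
     (AE x in lborel. x \<in> Omega_hat \<longrightarrow>
        ((\<lambda>t. u (t, snd x)) has_real_derivative fst (v x)) (at (fst x)) \<and>
        ((\<lambda>t. u (fst x, t)) has_real_derivative snd (v x)) (at (snd x)))"

definition is_curl :: "(real \<times> real \<Rightarrow> real \<times> real) \<Rightarrow> (real \<times> real \<Rightarrow> real) \<Rightarrow> bool" where
  "is_curl v w \<longleftrightarrow>
     (AE x in lborel. x \<in> Omega_hat \<longrightarrow>
        (\<exists>a b. ((\<lambda>t. snd (v (t, snd x))) has_real_derivative a) (at (fst x)) \<and>
               ((\<lambda>t. fst (v (fst x, t))) has_real_derivative b) (at (snd x)) \<and>
               w x = a - b))"

definition ae_zero :: "(real \<times> real \<Rightarrow> real) \<Rightarrow> bool" where
  "ae_zero u \<longleftrightarrow> (AE x in lborel. x \<in> Omega_hat \<longrightarrow> u x = 0)"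

text \<open>Exactness of \<open>0 \<rightarrow> W0 \<rightarrow> W1 \<rightarrow> W2 \<rightarrow> \<real> \<rightarrow> 0\<close> with the maps grad, curl and integration. The first
  two conjuncts say that grad and curl map into the next space; the others are exactness at
  \<open>W0\<close>, \<open>W1\<close>, \<open>W2\<close> and \<open>\<real>\<close>.\<close>

definition exact_complex ::
    "(real \<times> real \<Rightarrow> real) set \<Rightarrow> (real \<times> real \<Rightarrow> real \<times> real) set \<Rightarrow> (real \<times> real \<Rightarrow> real) set \<Rightarrow> bool" where
  "exact_complex W0 W1 W2 \<longleftrightarrow>
     (\<forall>u\<in>W0. \<exists>v\<in>W1. is_grad u v) \<and>
     (\<forall>v\<in>W1. \<exists>w\<in>W2. is_curl v w) \<and>
     (\<forall>u\<in>W0. is_grad u (\<lambda>_. 0) \<longrightarrow> ae_zero u) \<and>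
     (\<forall>v\<in>W1. is_curl v (\<lambda>_. 0) \<longleftrightarrow> (\<exists>u\<in>W0. is_grad u v)) \<and>
     (\<forall>w\<in>W2. (LINT x:Omega_hat|lborel. w x) = 0 \<longleftrightarrow> (\<exists>v\<in>W1. is_curl v w)) \<and>
     (\<forall>c. \<exists>w\<in>W2. (LINT x:Omega_hat|lborel. w x) = c)"

end

theory Submission
  imports Defs
begin

text \<open>Let \<open>A\<close> and \<open>F\<close> be the complexes spanned by the basis functions of level \<open>l\<close> and of level \<open>l + 1\<close>
  with support in \<open>U = \<Omega> (l + 1)\<close>. Then the hierarchical spaces satisfy \<open>W (l + 1) = W l + F\<close>, and the
  elements of \<open>W l\<close> that vanish off \<open>U\<close> lie in \<open>A\<close> (needed in degree 2 only). A diagram chase passes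
  exactness from \<open>W l\<close> to \<open>W (l + 1)\<close>, provided that the inclusion of \<open>A\<close> into \<open>F\<close> is bijective on the
  cohomology in degree 2 and surjective on that in degree 1.

  Degree 2: \<open>U\<close> is a union of cells, the supports of densities in \<open>A\<close>. Densities of neighbouring cells,
  coarse or fine, differ by a curl. Connected overlaps allow cells to meet only along chains of
  neighbours, so the classes in degree 2 are counted by the components of the adjacency graph of the
  cells, for \<open>A\<close> as for \<open>F\<close>, and are detected by the integrals over the components.

  Degree 1: a closed field in \<open>F\<close> has a potential on the unit square that is locally constant off \<open>U\<close>.
  Overlaps of supports of scalar basis functions with the complement of \<open>U\<close> are connected, so the
  potential has a single value on each of them. With these values as coefficients, a coarse spline
  agrees with the potential off \<open>U\<close>; the difference is a scalar form in \<open>F\<close>.\<close>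

section \<open>Univariate B-splines\<close>

text \<open>If \<open>c + f\<close> is closed, with \<open>c\<close> in \<open>W l\<close> and
  \<open>f\<close> in \<open>F\<close>, then the curl of \<open>c\<close> is minus the curl of
  \<open>f\<close> and vanishes off \<open>U\<close>, so it is an element of \<open>A\<close> that
  is a curl in \<open>F\<close>. Injectivity in degree 2 gives a field \<open>g\<close> in
  \<open>A\<close> with the same curl as \<open>c\<close>. Now \<open>c - g\<close> is closed in
  \<open>W l\<close>, and \<open>f + g\<close> is closed in \<open>F\<close>, where surjectivity in
  degree 1 applies. Surjectivity in degree 2 serves exactness at the densities: modulo a curl it
  moves \<open>f\<close> into \<open>A\<close>. Cells and overlaps are tied together by one fact: up
  to closure, the support of the B-spline of index \<open>i\<close> is the union of those of the
  normalised B-splines of index \<open>i\<close> and \<open>i + 1\<close>. A basis field thus lives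
  on two neighbouring cells, a scalar basis function on a block of four, and the hypothesis on
  overlaps becomes a statement about blocks. The obstacle is that cells may overlap or touch
  although their indices are far apart; a fine field crossing such an overlap could identify classes
  that coarse fields keep apart.\<close>

lemma bspline_cong:
  assumes "\<And>j. i \<le> j \<Longrightarrow> j \<le> i + p + 1 \<Longrightarrow> \<xi> j = \<xi>' j"
  shows "bspline \<xi> p i x = bspline \<xi>' p i x"
  using assms
proof (induction p arbitrary: i)
  case (Suc p)
  have "bspline \<xi> p i x = bspline \<xi>' p i x" "bspline \<xi> p (i + 1) x = bspline \<xi>' p (i + 1) x"
    by (rule Suc.IH; rule Suc.prems; simp)+
  moreover have "\<xi> i = \<xi>' i" "\<xi> (i + p + 1) = \<xi>' (i + p + 1)" "\<xi> (i + p + 2) = \<xi>' (i + p + 2)"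
    "\<xi> (i + 1) = \<xi>' (i + 1)"
    by (rule Suc.prems; simp)+
  ultimately show ?case
    by (simp only: bspline.simps)
qed simp

lemma bspline_eq_0:
  assumes "mono \<xi>" "x < \<xi> i \<or> \<xi> (i + p + 1) \<le> x"
  shows "bspline \<xi> p i x = 0"
  using assms(2)
proof (induction p arbitrary: i)
  case 0
  then show ?case by auto
next
  case (Suc p)
  have "\<xi> i \<le> \<xi> (i + 1)" "\<xi> (i + p + 1) \<le> \<xi> (i + p + 2)"
    using monoD[OF \<open>mono \<xi>\<close>] by auto
  then have "x < \<xi> i \<or> \<xi> (i + p + 1) \<le> x" "x < \<xi> (i + 1) \<or> \<xi> (i + 1 + p + 1) \<le> x"
    using Suc.prems by auto
  from this[THEN Suc.IH] show ?case
    by simp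
qed

lemma bspline_nonneg:
  assumes "mono \<xi>"
  shows "0 \<le> bspline \<xi> p i x"
proof (induction p arbitrary: i)
  case (Suc p)
  have "0 \<le> (x - \<xi> i) / (\<xi> (i + p + 1) - \<xi> i) * bspline \<xi> p i x"
    using Suc[of i] bspline_eq_0[OF assms, of x i p] monoD[OF assms, of i "i + p + 1"]
    by (cases "x < \<xi> i") auto
  moreover have "0 \<le> (\<xi> (i + p + 2) - x) / (\<xi> (i + p + 2) - \<xi> (i + 1)) * bspline \<xi> p (i + 1) x"
    using Suc[of "i + 1"] bspline_eq_0[OF assms, of x "i + 1" p] monoD[OF assms, of "i + 1" "i + p + 2"]
    by (cases "x < \<xi> (i + p + 2)") auto
  ultimately show ?case by simp
qed simp

lemma bspline_measurable [measurable]: "bspline \<xi> p i \<in> borel_measurable borel"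
proof (induction p arbitrary: i)
  case 0
  have eq: "bspline \<xi> 0 i = indicator {\<xi> i..<\<xi> (i + 1)}"
    by (auto simp: fun_eq_iff indicator_def)
  show ?case
    unfolding eq by (intro borel_measurable_indicator) auto
next
  case (Suc p)
  have eq: "bspline \<xi> (Suc p) i = (\<lambda>x. (x - \<xi> i) / (\<xi> (i + p + 1) - \<xi> i) * bspline \<xi> p i x +
     (\<xi> (i + p + 2) - x) / (\<xi> (i + p + 2) - \<xi> (i + 1)) * bspline \<xi> p (i + 1) x)"
    by (auto simp: fun_eq_iff)
  show ?case
    unfolding eq using Suc by measurable
qed

text \<open>Summation by parts. The last term is kept; it disappears at the point of use because the
  B-spline \<open>n + 1\<close> starts to the right of the span considered.\<close>

lemma sum_shift_telescope:
  fixes c :: "nat \<Rightarrow> real"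
  shows "(\<Sum>i\<le>n. c i * (g i - g (i + 1)))
    = (\<Sum>i\<le>n. (c i - (if i = 0 then 0 else c (i - 1))) * g i) - c n * g (n + 1)"
  by (induction n) (auto simp: algebra_simps)

text \<open>The two linear weights add up to 1 unless the end knots coincide; then both quotients
  are 0 by the convention for division, and so is the B-spline.\<close>

lemma bspline_weights_sum:
  assumes "mono \<xi>"
  shows "(x - \<xi> i) / (\<xi> (i + p + 1) - \<xi> i) * bspline \<xi> p i x
    + (\<xi> (i + p + 1) - x) / (\<xi> (i + p + 1) - \<xi> i) * bspline \<xi> p i x = bspline \<xi> p i x"
proof (cases "\<xi> i < \<xi> (i + p + 1)")
  case True
  then show ?thesis
    by (simp add: divide_simps) (simp add: algebra_simps)
next
  case False
  then have "x < \<xi> i \<or> \<xi> (i + p + 1) \<le> x"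
    by linarith
  then show ?thesis
    using bspline_eq_0[OF assms] by auto
qed

text \<open>Raising the degree by one passes the share \<open>g i\<close> of the B-spline
  \<open>i\<close> on to its left neighbour, so the sum telescopes. The bounds
  \<open>p \<le> k\<close> and \<open>k \<le> n\<close> keep the span clear of the supports of the
  B-splines 0 and \<open>n + 1\<close> of lower degree, which removes the two boundary
  terms.\<close>

lemma bspline_partition_of_unity:
  assumes "mono \<xi>" "\<xi> k \<le> x" "x < \<xi> (k + 1)" "p \<le> k" "k \<le> n"
  shows "(\<Sum>i\<le>n. bspline \<xi> p i x) = 1"
  using assms(4,5)
proof (induction p)
  case 0
  have "bspline \<xi> 0 i x = (if i = k then 1 else 0)" for i
  proof (cases i k rule: linorder_cases)
    case less
    then have "\<xi> (i + 1) \<le> x"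
      using monoD[OF assms(1), of "i + 1" k] assms(2) by auto
    then show ?thesis using less by auto
  next
    case greater
    then have "x < \<xi> i"
      using monoD[OF assms(1), of "k + 1" i] assms(3) by auto
    then show ?thesis using greater by auto
  qed (use assms in auto)
  then show ?case using 0 by simp
next
  case (Suc p)
  define g where "g i = (\<xi> (i + p + 1) - x) / (\<xi> (i + p + 1) - \<xi> i) * bspline \<xi> p i x" for i
  have eq: "bspline \<xi> (Suc p) i x = bspline \<xi> p i x + (g (i + 1) - g i)" for i
    using bspline_weights_sum[OF assms(1), of x i p] by (simp add: g_def)
  have "(\<Sum>i\<le>n. g (i + 1) - g i) = g (n + 1) - g 0"
    by (induction n) auto
  moreover have "\<xi> (p + 1) \<le> \<xi> k" "\<xi> (k + 1) \<le> \<xi> (n + 1)"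
    using Suc.prems monoD[OF assms(1)] by auto
  then have "g 0 = 0" "g (n + 1) = 0"
    using assms(2,3) bspline_eq_0[OF assms(1), of x 0 p] bspline_eq_0[OF assms(1), of x "n + 1" p]
    unfolding g_def by auto
  ultimately show ?case
    using Suc by (simp add: eq sum.distrib del: bspline.simps)
qed

text \<open>The case of degree 0 is an assumption and the set \<open>S\<close> a parameter: one
  induction yields both the right derivative at every point and the two-sided derivative off the
  knots. For \<open>p = 0\<close> the value of \<open>p - 1\<close> does not matter, as the factor
  \<open>real p\<close> is 0.\<close>

lemma bspline_has_derivative:
  assumes mono: "mono \<xi>"
    and base: "\<And>k. k \<in> {i..i + p} \<Longrightarrow> (bspline \<xi> 0 k has_real_derivative 0) (at x within S)"
  shows "(bspline \<xi> p i has_real_derivative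
     real p / (\<xi> (i + p) - \<xi> i) * bspline \<xi> (p - 1) i x
     - real p / (\<xi> (i + p + 1) - \<xi> (i + 1)) * bspline \<xi> (p - 1) (i + 1) x) (at x within S)"
  using base
proof (induction p arbitrary: i)
  case 0
  then show ?case by (simp del: bspline.simps)
next
  case (Suc p)
  let ?D = "\<lambda>i. real p / (\<xi> (i + p) - \<xi> i) * bspline \<xi> (p - 1) i x
     - real p / (\<xi> (i + p + 1) - \<xi> (i + 1)) * bspline \<xi> (p - 1) (i + 1) x"
  let ?\<gamma> = "\<lambda>i. 1 / (\<xi> (i + p + 1) - \<xi> i)"
  have ih: "(bspline \<xi> p i has_real_derivative ?D i) (at x within S)"
    "(bspline \<xi> p (i + 1) has_real_derivative ?D (i + 1)) (at x within S)"
    by (rule Suc.IH; rule Suc.prems; simp)+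
  have eq: "bspline \<xi> (Suc p) i = (\<lambda>x. ?\<gamma> i * ((x - \<xi> i) * bspline \<xi> p i x)
     + ?\<gamma> (i + 1) * ((\<xi> (i + p + 2) - x) * bspline \<xi> p (i + 1) x))"
    by (auto simp: fun_eq_iff)
  have "(bspline \<xi> (Suc p) i has_real_derivative
     ?\<gamma> i * (bspline \<xi> p i x + (x - \<xi> i) * ?D i)
     + ?\<gamma> (i + 1) * (- bspline \<xi> p (i + 1) x + (\<xi> (i + p + 2) - x) * ?D (i + 1))) (at x within S)"
    unfolding eq by (rule derivative_eq_intros ih refl | simp add: mult.commute del: bspline.simps)+
  \<comment> \<open>The derivatives of the linear factors give one copy of the claimed formula; the
    terms with \<open>?D\<close> have to give \<open>p\<close> further copies. Expanding the
    B-splines of degree \<open>p\<close> by the recursion shows this up to terms in the middle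
    B-spline, which cancel.\<close>
  moreover have "?\<gamma> i * ((x - \<xi> i) * ?D i) + ?\<gamma> (i + 1) * ((\<xi> (i + p + 2) - x) * ?D (i + 1))
     = p * ?\<gamma> i * bspline \<xi> p i x - p * ?\<gamma> (i + 1) * bspline \<xi> p (i + 1) x"
  proof (cases p)
    case (Suc q)
    let ?\<alpha> = "\<lambda>i. 1 / (\<xi> (i + p) - \<xi> i)"
    let ?b = "\<lambda>i. bspline \<xi> q i x"
    have rec: "bspline \<xi> p i x = ?\<alpha> i * (x - \<xi> i) * ?b i + ?\<alpha> (i + 1) * (\<xi> (i + p + 1) - x) * ?b (i + 1)" for i
      by (simp add: Suc)
    have D: "?D i = p * ?\<alpha> i * ?b i - p * ?\<alpha> (i + 1) * ?b (i + 1)" for i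
      by (simp add: Suc)
    \<comment> \<open>Clears the length of the larger knot interval. If that length is 0, the inner
      interval is a point as well, and both sides are 0 by the convention for division.\<close>
    have cancel: "?\<alpha> (i + 1) * (?\<gamma> i * (\<xi> (i + p + 1) - \<xi> i)) = ?\<alpha> (i + 1)"
    proof (cases "\<xi> (i + p + 1) = \<xi> i")
      case True
      then have "\<xi> (i + 1) = \<xi> (i + p + 1)"
        using monoD[OF mono, of i "i + 1"] monoD[OF mono, of "i + 1" "i + p + 1"] by auto
      then show ?thesis by simp
    qed simp
    have cancel': "?\<alpha> (i + 1) * (?\<gamma> (i + 1) * (\<xi> (i + p + 2) - \<xi> (i + 1))) = ?\<alpha> (i + 1)"
    proof (cases "\<xi> (i + p + 2) = \<xi> (i + 1)")
      case True
      then have "\<xi> (i + 1) = \<xi> (i + p + 1)"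
        using monoD[OF mono, of "i + p + 1" "i + p + 2"] monoD[OF mono, of "i + 1" "i + p + 1"] by auto
      then show ?thesis by simp
    qed simp
    define a0 where "a0 = ?\<alpha> i"
    define a1 where "a1 = ?\<alpha> (i + 1)"
    define a2 where "a2 = ?\<alpha> (i + 2)"
    define c0 where "c0 = ?\<gamma> i"
    define c1 where "c1 = ?\<gamma> (i + 1)"
    define P :: real where "P = real p"
    have c: "a1 * (c0 * (\<xi> (i + p + 1) - \<xi> i)) = a1" "a1 * (c1 * (\<xi> (i + p + 2) - \<xi> (i + 1))) = a1"
      using cancel cancel' unfolding a1_def c0_def c1_def .
    have "c0 * ((x - \<xi> i) * (P * a0 * ?b i - P * a1 * ?b (i + 1)))
      + c1 * ((\<xi> (i + p + 2) - x) * (P * a1 * ?b (i + 1) - P * a2 * ?b (i + 2)))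
      = P * c0 * (a0 * (x - \<xi> i) * ?b i + a1 * (\<xi> (i + p + 1) - x) * ?b (i + 1))
      - P * c1 * (a1 * (x - \<xi> (i + 1)) * ?b (i + 1) + a2 * (\<xi> (i + p + 2) - x) * ?b (i + 2))
      + P * ?b (i + 1) * (a1 * (c1 * (\<xi> (i + p + 2) - \<xi> (i + 1))) - a1 * (c0 * (\<xi> (i + p + 1) - \<xi> i)))"
      by (simp add: algebra_simps)
    then show ?thesis
      unfolding D rec unfolding c
      by (simp add: a0_def a1_def a2_def c0_def c1_def P_def add.commute add.left_commute)
  qed simp
  ultimately show ?case
  proof (elim DERIV_cong)
    assume *: "?\<gamma> i * ((x - \<xi> i) * ?D i) + ?\<gamma> (i + 1) * ((\<xi> (i + p + 2) - x) * ?D (i + 1))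
     = p * ?\<gamma> i * bspline \<xi> p i x - p * ?\<gamma> (i + 1) * bspline \<xi> p (i + 1) x"
    have "g * (b + E) + g' * (- b' + E') = (1 + p) * g * b - (1 + p) * g' * b'"
      if "g * E + g' * E' = p * g * b - p * g' * b'" for g g' E E' b b' :: real
      using that by (simp add: algebra_simps)
    from this[OF *] show "?\<gamma> i * (bspline \<xi> p i x + (x - \<xi> i) * ?D i)
     + ?\<gamma> (i + 1) * (- bspline \<xi> p (i + 1) x + (\<xi> (i + p + 2) - x) * ?D (i + 1))
     = real (Suc p) / (\<xi> (i + Suc p) - \<xi> i) * bspline \<xi> (Suc p - 1) i x
     - real (Suc p) / (\<xi> (i + Suc p + 1) - \<xi> (i + 1)) * bspline \<xi> (Suc p - 1) (i + 1) x"
      by simp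
  qed
qed

lemma bspline_0_right_derivative: "(bspline \<xi> 0 k has_real_derivative 0) (at_right x)"
proof -
  have "eventually (\<lambda>y. bspline \<xi> 0 k y = bspline \<xi> 0 k x) (at_right x)"
  proof -
    have "eventually (\<lambda>y. (\<xi> k \<le> y) = (\<xi> k \<le> x)) (at_right x)" for k
    proof (cases "\<xi> k \<le> x")
      case True
      have "eventually (\<lambda>y. x < y) (at_right x)"
        by (simp add: eventually_at_right_less)
      then show ?thesis
        by eventually_elim (use True in auto)
    next
      case False
      then have "eventually (\<lambda>y. y < \<xi> k) (at_right x)"
        by (intro eventually_at_right_field[THEN iffD2] exI[of _ "\<xi> k"]) auto
      then show ?thesis
        by eventually_elim (use False in auto)
    qed
    note * = this
    from *[of k] *[of "k + 1"] show ?thesis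
      by eventually_elim auto
  qed
  then have "(bspline \<xi> 0 k has_real_derivative 0) (at_right x)
      = ((\<lambda>y. bspline \<xi> 0 k x) has_real_derivative 0) (at_right x)"
    by (rule has_field_derivative_cong_eventually) simp
  then show ?thesis by (simp del: bspline.simps)
qed

lemma bspline_has_right_derivative:
  assumes "mono \<xi>"
  shows "(bspline \<xi> p i has_real_derivative
     real p / (\<xi> (i + p) - \<xi> i) * bspline \<xi> (p - 1) i x
     - real p / (\<xi> (i + p + 1) - \<xi> (i + 1)) * bspline \<xi> (p - 1) (i + 1) x) (at_right x)"
  by (rule bspline_has_derivative[OF assms bspline_0_right_derivative])

lemma bspline_0_has_derivative:
  assumes "x \<noteq> \<xi> k" "x \<noteq> \<xi> (k + 1)"
  shows "(bspline \<xi> 0 k has_real_derivative 0) (at x)"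
proof -
  have "\<forall>\<^sub>F y in at x. (\<xi> k \<le> y) = (\<xi> k \<le> x)" if "x \<noteq> \<xi> k" for k
  proof (cases "\<xi> k \<le> x")
    case True
    then have "\<xi> k < x" using that by simp
    from order_tendstoD(1)[OF tendsto_ident_at this] show ?thesis
      by eventually_elim (use True in auto)
  next
    case False
    then have "x < \<xi> k" by simp
    from order_tendstoD(2)[OF tendsto_ident_at this] show ?thesis
      by eventually_elim (use False in auto)
  qed
  from this[OF assms(1)] this[OF assms(2)]
  have "\<forall>\<^sub>F y in at x. bspline \<xi> 0 k y = bspline \<xi> 0 k x"
    by eventually_elim auto
  then have "(bspline \<xi> 0 k has_real_derivative 0) (at x)
      = ((\<lambda>y. bspline \<xi> 0 k x) has_real_derivative 0) (at x)"
    by (rule has_field_derivative_cong_eventually) simp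
  then show ?thesis by (simp del: bspline.simps)
qed

lemma bspline_has_derivative_off_knots:
  assumes "mono \<xi>" "x \<notin> \<xi> ` {i..i + p + 1}"
  shows "(bspline \<xi> p i has_real_derivative
     real p / (\<xi> (i + p) - \<xi> i) * bspline \<xi> (p - 1) i x
     - real p / (\<xi> (i + p + 1) - \<xi> (i + 1)) * bspline \<xi> (p - 1) (i + 1) x) (at x)"
  by (rule bspline_has_derivative[OF assms(1) bspline_0_has_derivative]) (use assms(2) in auto)

text \<open>The left-continuous variant of the recursion computes the left limits. It agrees with the
  right-continuous one unless a full knot of multiplicity \<open>p + 1\<close> sits at the point, which gives
  continuity without any smoothness theory.\<close>

fun bspline_left :: "(nat \<Rightarrow> real) \<Rightarrow> nat \<Rightarrow> nat \<Rightarrow> real \<Rightarrow> real" where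
  "bspline_left \<xi> 0 i x = (if \<xi> i < x \<and> x \<le> \<xi> (i + 1) then 1 else 0)"
| "bspline_left \<xi> (Suc p) i x =
     (x - \<xi> i) / (\<xi> (i + p + 1) - \<xi> i) * bspline_left \<xi> p i x +
     (\<xi> (i + p + 2) - x) / (\<xi> (i + p + 2) - \<xi> (i + 1)) * bspline_left \<xi> p (i + 1) x"

lemma bspline_left_eq_0:
  assumes "mono \<xi>" "x \<le> \<xi> i \<or> \<xi> (i + p + 1) < x"
  shows "bspline_left \<xi> p i x = 0"
  using assms(2)
proof (induction p arbitrary: i)
  case 0
  then show ?case by auto
next
  case (Suc p)
  have "\<xi> i \<le> \<xi> (i + 1)" "\<xi> (i + p + 1) \<le> \<xi> (i + p + 2)"
    using monoD[OF \<open>mono \<xi>\<close>] by auto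
  then have "x \<le> \<xi> i \<or> \<xi> (i + p + 1) < x" "x \<le> \<xi> (i + 1) \<or> \<xi> (i + 1 + p + 1) < x"
    using Suc.prems by auto
  from this[THEN Suc.IH] show ?case
    by simp
qed

lemma bspline_tendsto_left: "(bspline \<xi> p i \<longlongrightarrow> bspline_left \<xi> p i x) (at_left x)"
proof (induction p arbitrary: i)
  case 0
  have le: "\<forall>\<^sub>F y in at_left x. (\<xi> k \<le> y) = (\<xi> k < x)" for k
  proof (cases "\<xi> k < x")
    case True
    from order_tendstoD(1)[OF tendsto_ident_at this] show ?thesis
      by eventually_elim (use True in auto)
  next
    case False
    have "\<forall>\<^sub>F y in at_left x. y < x"
      by (simp add: eventually_at_filter)
    then show ?thesis
      by eventually_elim (use False in auto)
  qed
  from le[of i] le[of "i + 1"]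
  have "\<forall>\<^sub>F y in at_left x. bspline_left \<xi> 0 i x = bspline \<xi> 0 i y"
    by eventually_elim auto
  then show ?case
    by (rule Lim_transform_eventually[OF tendsto_const])
next
  case (Suc p)
  show ?case
    unfolding bspline.simps bspline_left.simps divide_inverse
    by (intro tendsto_add tendsto_mult tendsto_diff tendsto_const tendsto_ident_at Suc.IH)
qed

lemma bspline_full_knot:
  assumes "mono \<xi>" "\<xi> i = x" "\<xi> (i + p) = x" "x < \<xi> (i + p + 1)"
  shows "bspline \<xi> p i x = 1"
  using assms(2-)
proof (induction p arbitrary: i)
  case (Suc p)
  have "\<xi> (i + 1) = x"
    using Suc.prems monoD[OF assms(1), of i "i + 1"] monoD[OF assms(1), of "i + 1" "i + Suc p"] by auto
  with Suc.IH[of "i + 1"] Suc.prems show ?case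
    by simp
qed auto

lemma bspline_left_full_knot:
  assumes "mono \<xi>" "\<xi> i < x" "\<xi> (i + 1) = x" "\<xi> (i + p + 1) = x"
  shows "bspline_left \<xi> p i x = 1"
  using assms(2-)
proof (induction p arbitrary: i)
  case (Suc p)
  have "\<xi> (i + p + 1) = x"
    using Suc.prems monoD[OF assms(1), of "i + p + 1" "i + Suc p + 1"] monoD[OF assms(1), of "i + 1" "i + p + 1"]
    by auto
  with Suc.IH[of i] Suc.prems show ?case
    by simp
qed auto

text \<open>If a B-spline of lower degree jumps at an outer full knot, its linear factor vanishes
  there. If the \<open>p + 1\<close> inner knots all sit at \<open>x\<close>, both B-splines of
  lower degree jump, one from 1 to 0 and the other from 0 to 1; their weights are 1 at
  \<open>x\<close>, so the jumps cancel.\<close>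

lemma bspline_left_eq:
  assumes "mono \<xi>" "\<not> (\<xi> i = x \<and> \<xi> (i + p) = x)" "\<not> (\<xi> (i + 1) = x \<and> \<xi> (i + p + 1) = x)"
  shows "bspline_left \<xi> p i x = bspline \<xi> p i x"
  using assms(2-)
proof (induction p arbitrary: i)
  case 0
  then show ?case by auto
next
  case (Suc p)
  show ?case
  proof (cases "\<xi> (i + 1) = x \<and> \<xi> (i + p + 1) = x")
    case True
    have "\<xi> i \<le> \<xi> (i + 1)" "\<xi> (i + p + 1) \<le> \<xi> (i + p + 2)"
      using monoD[OF assms(1)] by auto
    with Suc.prems True have lt: "\<xi> i < x" "x < \<xi> (i + p + 2)"
      by (auto simp: less_le)
    have "bspline \<xi> p i x = 0" "bspline_left \<xi> p (i + 1) x = 0"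
      using True bspline_eq_0[OF assms(1), of x i p] bspline_left_eq_0[OF assms(1), of x "i + 1" p] by auto
    moreover have "bspline_left \<xi> p i x = 1" "bspline \<xi> p (i + 1) x = 1"
      using True lt bspline_left_full_knot[OF assms(1), of i x p] bspline_full_knot[OF assms(1), of "i + 1" x p]
      by auto
    ultimately show ?thesis
      using True lt by simp
  next
    case False
    have "(x - \<xi> i) * bspline_left \<xi> p i x = (x - \<xi> i) * bspline \<xi> p i x"
      using Suc.IH[of i] False by (cases "\<xi> i = x") auto
    moreover have "(\<xi> (i + p + 2) - x) * bspline_left \<xi> p (i + 1) x = (\<xi> (i + p + 2) - x) * bspline \<xi> p (i + 1) x"
      using Suc.IH[of "i + 1"] False by (cases "\<xi> (i + p + 2) = x") auto
    ultimately show ?thesis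
      by (simp only: bspline.simps bspline_left.simps times_divide_eq_left)
  qed
qed

lemma bspline_isCont:
  assumes "mono \<xi>" "\<not> (\<xi> i = x \<and> \<xi> (i + p) = x)" "\<not> (\<xi> (i + 1) = x \<and> \<xi> (i + p + 1) = x)"
  shows "isCont (bspline \<xi> p i) x"
proof -
  have "(bspline \<xi> p i \<longlongrightarrow> bspline \<xi> p i x) (at_right x)"
    using DERIV_continuous[OF bspline_has_right_derivative[OF assms(1)]]
    by (simp add: continuous_within)
  moreover have "(bspline \<xi> p i \<longlongrightarrow> bspline \<xi> p i x) (at_left x)"
    using bspline_tendsto_left bspline_left_eq[OF assms] by metis
  ultimately show ?thesis
    by (simp add: isCont_def filterlim_split_at)
qed

text \<open>The left end point is covered as well: without a full knot there, the value equals the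
  left limit, which is 0.\<close>

lemma bspline_eq_0':
  assumes "mono \<xi>" "\<not> (\<xi> i = x \<and> \<xi> (i + p) = x)" "\<not> (\<xi> i < x \<and> x < \<xi> (i + p + 1))"
  shows "bspline \<xi> p i x = 0"
proof (cases "x = \<xi> i \<and> x < \<xi> (i + p + 1)")
  case True
  then have "\<not> (\<xi> (i + 1) = x \<and> \<xi> (i + p + 1) = x)" by auto
  then show ?thesis
    using bspline_left_eq[OF assms(1,2)] bspline_left_eq_0[OF assms(1)] True by auto
next
  case False
  then have "x < \<xi> i \<or> \<xi> (i + p + 1) \<le> x"
    using assms(3) by linarith
  then show ?thesis
    by (rule bspline_eq_0[OF assms(1)])
qed

text \<open>A combination vanishing on \<open>V\<close> has vanishing derivative there, and one
  degree lower its coefficients are scaled differences of the \<open>c i\<close>. By induction all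
  coefficients that meet the span are equal, and the partition of unity makes their common value
  0.\<close>

lemma bspline_independent_on_span:
  fixes c :: "nat \<Rightarrow> real"
  assumes mono: "mono \<xi>" and V: "open V" "V \<noteq> {}" "V \<subseteq> {\<xi> k<..<\<xi> (k + 1)}"
  shows "\<lbrakk>p \<le> k; k \<le> n; \<forall>x\<in>V. (\<Sum>i\<le>n. c i * bspline \<xi> p i x) = 0; i \<in> {k - p..k}\<rbrakk> \<Longrightarrow> c i = 0"
proof (induction p arbitrary: c i)
  case 0
  obtain x where x: "x \<in> V" using V by auto
  have "bspline \<xi> 0 i x = (if i = k then 1 else 0)" for i
  proof (cases i k rule: linorder_cases)
    case less
    then show ?thesis
      using bspline_eq_0[OF mono, of x i 0] monoD[OF mono, of "i + 1" k] x V(3) by fastforce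
  next
    case greater
    then show ?thesis
      using bspline_eq_0[OF mono, of x i 0] monoD[OF mono, of "k + 1" i] x V(3) by fastforce
  qed (use x V(3) in auto)
  then have "(\<Sum>i\<le>n. c i * bspline \<xi> 0 i x) = (\<Sum>i\<le>n. if i = k then c k else 0)"
    by (intro sum.cong) auto
  with 0 x show ?case by (auto simp: sum.delta)
next
  case (Suc p)
  define c' where "c' i = c i - (if i = 0 then 0 else c (i - 1))" for i
  define d where "d i = real (Suc p) / (\<xi> (i + Suc p) - \<xi> i)" for i
  have nonknot: "x \<notin> range \<xi>" if "x \<in> V" for x
  proof
    assume "x \<in> range \<xi>"
    then obtain j where "x = \<xi> j" by auto
    with that V(3) monoD[OF mono, of j k] monoD[OF mono, of "k + 1" j] show False
      by (cases "j \<le> k") fastforce+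
  qed
  have "(\<Sum>i\<le>n. (c' i * d i) * bspline \<xi> p i x) = 0" if x: "x \<in> V" for x
  proof -
    define g where "g i = d i * bspline \<xi> p i x" for i
    have "(bspline \<xi> (Suc p) i has_real_derivative g i - g (i + 1)) (at x)" for i
      using bspline_has_derivative_off_knots[OF mono, of x i "Suc p"] nonknot[OF x]
      by (auto simp: g_def d_def simp del: bspline.simps)
    then have "((\<lambda>x. \<Sum>i\<le>n. c i * bspline \<xi> (Suc p) i x) has_real_derivative
        (\<Sum>i\<le>n. c i * (g i - g (i + 1)))) (at x)"
      by (intro DERIV_sum DERIV_cmult)
    moreover have "((\<lambda>x. \<Sum>i\<le>n. c i * bspline \<xi> (Suc p) i x) has_real_derivative 0) (at x)"
      by (rule has_field_derivative_transform_within_open[OF DERIV_const V(1) x, of 0])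
        (use Suc.prems(3) in auto)
    ultimately have "0 = (\<Sum>i\<le>n. c i * (g i - g (i + 1)))"
      using DERIV_unique by blast
    also have "\<dots> = (\<Sum>i\<le>n. c' i * g i) - c n * g (n + 1)"
      unfolding c'_def by (rule sum_shift_telescope)
    also have "g (n + 1) = 0"
      using bspline_eq_0[OF mono, of x "n + 1" p] monoD[OF mono, of "k + 1" "n + 1"] x V(3) Suc.prems(2)
      by (fastforce simp: g_def)
    finally show ?thesis
      by (simp add: g_def mult.assoc)
  qed
  then have c'd: "c' i * d i = 0" if "i \<in> {k - p..k}" for i
    using Suc.IH[of "\<lambda>i. c' i * d i" i] Suc.prems(1,2) that by simp
  have step: "c i = c (i - 1)" if i: "i \<in> {k - p..k}" for i
  proof -
    have "\<xi> i \<le> \<xi> k" "\<xi> (k + 1) \<le> \<xi> (i + Suc p)" "\<xi> k < \<xi> (k + 1)"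
      using monoD[OF mono] i V(2,3) by auto
    then have "d i \<noteq> 0" by (auto simp: d_def)
    with c'd[OF i] i Suc.prems(1) show ?thesis by (auto simp: c'_def)
  qed
  have const: "c i = c (k - Suc p)" if "k - Suc p \<le> i" "i \<le> k" for i
    using that
  proof (induction i rule: dec_induct)
    case (step i)
    then show ?case using \<open>\<And>i. i \<in> {k - p..k} \<Longrightarrow> c i = c (i - 1)\<close>[of "Suc i"] Suc.prems(1) by auto
  qed simp
  obtain x where x: "x \<in> V" using V by auto
  have cx: "c i * bspline \<xi> (Suc p) i x = c (k - Suc p) * bspline \<xi> (Suc p) i x" for i
  proof (cases "i \<in> {k - Suc p..k}")
    case True
    then show ?thesis using const[of i] by (simp del: bspline.simps)
  next
    case False
    then have "x < \<xi> i \<or> \<xi> (i + Suc p + 1) \<le> x"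
      using x V(3) monoD[OF mono, of "k + 1" i] monoD[OF mono, of "i + Suc p + 1" k] by fastforce
    then have "bspline \<xi> (Suc p) i x = 0" by (rule bspline_eq_0[OF mono])
    then show ?thesis by (simp only: mult_zero_right)
  qed
  have "(\<Sum>i\<le>n. c i * bspline \<xi> (Suc p) i x) = c (k - Suc p) * (\<Sum>i\<le>n. bspline \<xi> (Suc p) i x)"
    by (simp only: cx sum_distrib_left)
  also have "(\<Sum>i\<le>n. bspline \<xi> (Suc p) i x) = 1"
    using bspline_partition_of_unity[OF mono, of k x "Suc p" n] x V(3) Suc.prems by fastforce
  finally show ?case
    using const[of i] Suc.prems(3,4) x by auto
qed

text \<open>The point \<open>x\<close> may be a knot, so it is replaced by a nearby point
  \<open>y\<close> off the knots, whose span carries the independence. Coinciding knots at both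
  ends, as in an open knot vector, place the index of that span between \<open>p\<close> and
  \<open>n\<close>.\<close>

lemma bspline_locally_independent:
  fixes c :: "nat \<Rightarrow> real"
  assumes mono: "mono \<xi>" and "\<And>j. \<xi> p \<le> \<xi> j"
    and "open U" "x \<in> U" "\<xi> i < x" "x < \<xi> (i + p + 1)"
    and "i \<le> n" "\<xi> (n + 1) = \<xi> (n + p + 1)"
    and zero: "\<And>x. x \<in> U \<Longrightarrow> (\<Sum>i\<le>n. c i * bspline \<xi> p i x) = 0"
  shows "c i = 0"
proof -
  have "open (U \<inter> {\<xi> i<..<\<xi> (i + p + 1)})"
    using assms(3) by auto
  then obtain e where e: "e > 0" "ball x e \<subseteq> U \<inter> {\<xi> i<..<\<xi> (i + p + 1)}"
    using assms(4-6) openE by (metis IntI greaterThanLessThan_iff)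
  have "infinite {x..<x + e}"
    using e(1) by simp
  then have "\<not> {x..<x + e} \<subseteq> \<xi> ` {..i + p + 1}"
    using finite_subset by blast
  then obtain y where "y \<in> {x..<x + e}" and y: "y \<notin> \<xi> ` {..i + p + 1}"
    by blast
  then have y: "x \<le> y" "y < x + e" "y \<notin> \<xi> ` {..i + p + 1}"
    by auto
  then have "y \<in> ball x e"
    by (auto simp: dist_real_def)
  with e have yU: "y \<in> U" "\<xi> i < y" "y < \<xi> (i + p + 1)"
    by auto
  define k where "k = Max {j. j \<le> i + p \<and> \<xi> j \<le> y}"
  have "k \<in> {j. j \<le> i + p \<and> \<xi> j \<le> y}"
    unfolding k_def by (rule Max_in) (use yU in \<open>auto intro!: exI[of _ i]\<close>)
  then have k: "k \<le> i + p" "\<xi> k < y"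
    using y(3) by (auto simp: less_le)
  have kmax: "j \<le> k" if "j \<le> i + p" "\<xi> j \<le> y" for j
    unfolding k_def by (rule Max_ge) (use that in auto)
  have "y < \<xi> (k + 1)"
    using kmax[of "k + 1"] k(1) yU(3) by (cases "k = i + p") (auto simp: not_le[symmetric])
  note k = k this
  have "i \<le> k" using kmax[of i] yU by auto
  have "p \<le> k"
    using kmax[of p] k assms(2)[of k] by auto
  have "k \<le> n"
  proof (rule ccontr)
    assume "\<not> k \<le> n"
    then have "\<xi> (n + 1) \<le> \<xi> k" "\<xi> (k + 1) \<le> \<xi> (n + p + 1)"
      using monoD[OF mono] k(1) assms(7) by (auto intro: monoD[OF mono])
    then show False using k assms(8) by auto
  qed
  let ?V = "U \<inter> {\<xi> k<..<\<xi> (k + 1)}"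
  show ?thesis
    by (rule bspline_independent_on_span[OF mono, of ?V k p n c i])
      (use assms yU k \<open>i \<le> k\<close> \<open>p \<le> k\<close> \<open>k \<le> n\<close> in \<open>auto intro!: exI[of _ y]\<close>)
qed

text \<open>The normalised B-spline of degree \<open>p - 1\<close> is the derivative of the sum of the B-splines of degree
  \<open>p\<close> starting at or to the right of it. For that sum to reach the value 1 continuously, the
  local knots are continued by simple knots.\<close>

lemma bspline_normalised_integral:
  assumes mono: "mono \<xi>" and p: "1 \<le> p" and lt: "\<xi> i < \<xi> (i + p)"
  shows "((\<lambda>x. real p / (\<xi> (i + p) - \<xi> i) * bspline \<xi> (p - 1) i x) has_integral 1) {\<xi> i..\<xi> (i + p)}"
proof -
  define \<eta> where "\<eta> k = (if k < i then \<xi> i else if k \<le> i + p then \<xi> k else \<xi> (i + p) + real (k - (i + p)))" for k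
  have le: "\<eta> k \<le> \<eta> l" if "k \<le> l" for k l
  proof -
    consider "l < i" | "i \<le> l" "l \<le> i + p" | "i + p < l" "k \<le> i + p" | "i + p < k" by linarith
    then show ?thesis
    proof cases
      case 2
      then show ?thesis using that monoD[OF mono, of k l] monoD[OF mono, of i l] by (auto simp: \<eta>_def)
    next
      case 3
      then have "\<eta> k \<le> \<xi> (i + p)"
        using monoD[OF mono, of k "i + p"] monoD[OF mono, of i "i + p"] by (auto simp: \<eta>_def)
      then show ?thesis using 3 by (auto simp: \<eta>_def intro: order.trans)
    qed (use that in \<open>auto simp: \<eta>_def\<close>)
  qed
  then have mono': "mono \<eta>" by (simp add: monoI)
  have lt': "\<eta> k < \<eta> (k + p)" if "i \<le> k" for k
  proof (cases "k \<le> i + p")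
    case True
    then have "\<xi> k \<le> \<xi> (i + p)" using monoD[OF mono] by auto
    then show ?thesis using True that lt p by (cases "k = i") (auto simp: \<eta>_def)
  next
    case False
    then show ?thesis using p by (auto simp: \<eta>_def)
  qed
  define B where "B k = bspline \<eta> p k" for k
  define D where "D k x = real p / (\<eta> (k + p) - \<eta> k) * bspline \<eta> (p - 1) k x" for k x
  define g where "g x = (\<Sum>k=i..i + p. B k x)" for x
  have cont: "isCont (B k) x" if "i \<le> k" for k x
    unfolding B_def by (rule bspline_isCont[OF mono']) (use lt'[of k] lt'[of "k + 1"] that in auto)
  have deriv: "(g has_real_derivative D i x) (at x)"
    if x: "x \<in> {\<xi> i<..<\<xi> (i + p)} - \<eta> ` {..i + 2 * p + 1}" for x
  proof -
    have "(B k has_real_derivative D k x - D (k + 1) x) (at x)" if "k \<in> {i..i + p}" for k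
    proof -
      have "{k..k + p + 1} \<subseteq> {..i + 2 * p + 1}" using that by auto
      then have "x \<notin> \<eta> ` {k..k + p + 1}" using x by blast
      from bspline_has_derivative_off_knots[OF mono' this] show ?thesis
        by (simp add: B_def D_def)
    qed
    then have "(g has_real_derivative (\<Sum>k=i..i + p. D k x - D (k + 1) x)) (at x)"
      unfolding g_def by (intro DERIV_sum)
    also have "(\<Sum>k=i..i + p. D k x - D (k + 1) x) = D i x - D (i + p + 1) x"
      using sum_Suc_diff[of i "i + p" "\<lambda>k. - D k x"] by simp
    \<comment> \<open>By the choice of \<open>\<eta>\<close>, this B-spline starts one unit to the
      right of the interval.\<close>
    also have "D (i + p + 1) x = 0"
      using bspline_eq_0[OF mono', of x "i + p + 1" "p - 1"] x by (auto simp: D_def \<eta>_def)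
    finally show ?thesis by simp
  qed
  have "(D i has_integral (g (\<xi> (i + p)) - g (\<xi> i))) {\<xi> i..\<xi> (i + p)}"
  proof (rule fundamental_theorem_of_calculus_interior_strong)
    show "finite (\<eta> ` {..i + 2 * p + 1})" by simp
    show "continuous_on {\<xi> i..\<xi> (i + p)} g"
      unfolding g_def
      by (intro continuous_on_sum continuous_at_imp_continuous_on ballI cont) auto
    show "(g has_vector_derivative D i x) (at x)"
      if "x \<in> {\<xi> i<..<\<xi> (i + p)} - \<eta> ` {..i + 2 * p + 1}" for x
      using deriv[OF that] by (simp add: has_real_derivative_iff_has_vector_derivative)
  qed (use lt in auto)
  moreover have "g (\<xi> i) = 0"
    unfolding g_def B_def
  proof (rule sum.neutral, rule ballI)
    fix k assume k: "k \<in> {i..i + p}"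
    then have "\<eta> i \<le> \<eta> k" by (intro le) auto
    then show "bspline \<eta> p k (\<xi> i) = 0"
      using k lt'[of k] by (intro bspline_eq_0'[OF mono']) (auto simp: \<eta>_def)
  qed
  moreover have "g (\<xi> (i + p)) = 1"
  proof -
    \<comment> \<open>The simple knots put \<open>\<xi> (i + p)\<close> at the left end of a genuine
      span, so the partition of unity applies there. The B-splines with index below \<open>i\<close>
      have ended by then.\<close>
    have "(\<Sum>k\<le>i + p. B k (\<xi> (i + p))) = 1"
      unfolding B_def by (rule bspline_partition_of_unity[OF mono', of "i + p"]) (auto simp: \<eta>_def)
    also have "(\<Sum>k\<le>i + p. B k (\<xi> (i + p))) = g (\<xi> (i + p))"
      unfolding g_def
    proof (rule sum.mono_neutral_right)
      show "\<forall>k\<in>{..i + p} - {i..i + p}. B k (\<xi> (i + p)) = 0"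
      proof
        fix k assume "k \<in> {..i + p} - {i..i + p}"
        then have "\<eta> (k + p + 1) \<le> \<eta> (i + p)" by (intro le) auto
        then show "B k (\<xi> (i + p)) = 0"
          unfolding B_def by (intro bspline_eq_0[OF mono']) (auto simp: \<eta>_def)
      qed
    qed auto
    finally show ?thesis by simp
  qed
  moreover have "D i = (\<lambda>x. real p / (\<xi> (i + p) - \<xi> i) * bspline \<xi> (p - 1) i x)"
  proof
    fix x
    have "bspline \<eta> (p - 1) i x = bspline \<xi> (p - 1) i x"
      by (rule bspline_cong) (use p in \<open>auto simp: \<eta>_def\<close>)
    then show "D i x = real p / (\<xi> (i + p) - \<xi> i) * bspline \<xi> (p - 1) i x"
      by (simp add: D_def \<eta>_def)
  qed
  ultimately show ?thesis by simp
qed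

section \<open>Splines on an open knot vector\<close>

text \<open>Continued by 0 to the left and by 1 to the right, the knots form a monotone sequence.\<close>

definition kn :: "knot_vector \<Rightarrow> nat \<Rightarrow> real" where
  "kn K i = (if i = 0 then 0 else if i \<le> nspl K + deg K + 1 then knot K i else 1)"

definition Bs :: "knot_vector \<Rightarrow> nat \<Rightarrow> real \<Rightarrow> real" where
  "Bs K i = bspline (kn K) (deg K) i"

text \<open>The indices 1 and \<open>nspl K + 1\<close> are allowed: their knots coincide, division
  by zero makes the function 0, and the derivative of every B-spline is a difference of two
  neighbours without boundary cases.\<close>

definition Ds :: "knot_vector \<Rightarrow> nat \<Rightarrow> real \<Rightarrow> real" where
  "Ds K i x = real (deg K) / (kn K (i + deg K) - kn K i) * bspline (kn K) (deg K - 1) i x"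

definition SB :: "knot_vector \<Rightarrow> nat \<Rightarrow> real set" where
  "SB K i = {kn K i<..<kn K (i + deg K + 1)}"

definition SD :: "knot_vector \<Rightarrow> nat \<Rightarrow> real set" where
  "SD K i = {kn K i<..<kn K (i + deg K)}"

context
  fixes K :: knot_vector
  assumes K: "open_knot_vector K"
begin

lemma deg_pos: "1 \<le> deg K" and deg_less_nspl: "deg K + 1 \<le> nspl K"
  using K by (auto simp: open_knot_vector_def Let_def)

lemma kn_eq_0: "i \<le> deg K + 1 \<Longrightarrow> kn K i = 0"
  using K by (cases i) (auto simp: open_knot_vector_def Let_def kn_def)

lemma kn_eq_1: "nspl K < i \<Longrightarrow> kn K i = 1"
  using K by (auto simp: open_knot_vector_def Let_def kn_def)

lemma kn_inner: "deg K + 2 \<le> i \<Longrightarrow> i \<le> nspl K \<Longrightarrow> 0 < kn K i \<and> kn K i < 1"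
  using K by (auto simp: open_knot_vector_def Let_def kn_def)

lemma kn_bounds: "0 \<le> kn K i" "kn K i \<le> 1"
proof -
  have "0 \<le> kn K i \<and> kn K i \<le> 1"
  proof (cases "i \<le> deg K + 1")
    case True
    then show ?thesis using kn_eq_0[of i] by simp
  next
    case False
    then show ?thesis using kn_inner[of i] kn_eq_1[of i] by (cases "i \<le> nspl K") auto
  qed
  then show "0 \<le> kn K i" "kn K i \<le> 1" by auto
qed

lemma kn_pos: "deg K + 1 < i \<Longrightarrow> 0 < kn K i"
  using kn_eq_1[of i] kn_inner[of i] by (cases "i \<le> nspl K") auto

lemma mono_kn: "mono (kn K)"
proof (rule monoI)
  fix i j :: nat assume "i \<le> j"
  have "mono_on {1..nspl K + deg K + 1} (knot K)"
    using K by (auto simp: open_knot_vector_def Let_def)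
  then have "knot K i \<le> knot K j" if "1 \<le> i" "j \<le> nspl K + deg K + 1"
    using that \<open>i \<le> j\<close> by (auto simp: mono_on_def)
  then show "kn K i \<le> kn K j"
    using kn_bounds[of i] kn_bounds[of j] \<open>i \<le> j\<close> by (auto simp: kn_def split: if_splits)
qed

lemma finite_kn: "finite (range (kn K))"
proof (rule finite_subset)
  show "range (kn K) \<subseteq> kn K ` {..nspl K + 1}"
  proof
    fix x assume "x \<in> range (kn K)"
    then obtain i where i: "x = kn K i" by auto
    show "x \<in> kn K ` {..nspl K + 1}"
    proof (cases "i \<le> nspl K")
      case False
      then have "x = kn K (nspl K + 1)" using i by (simp add: kn_eq_1)
      then show ?thesis by auto
    qed (use i in auto)
  qed
qed simp

text \<open>An inner knot cannot repeat \<open>deg K + 1\<close> times. The knot 0 does, which is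
  why \<open>i = 1\<close> is excluded; for larger \<open>i\<close> the knot
  \<open>i + deg K\<close> lies beyond the block of zeros.\<close>

lemma kn_less:
  assumes "2 \<le> i" "i \<le> nspl K"
  shows "kn K i < kn K (i + deg K)"
proof (cases "i \<le> deg K + 1")
  case True
  then show ?thesis
    using kn_eq_0[of i] kn_pos[of "i + deg K"] assms by auto
next
  case False
  show ?thesis
  proof (rule ccontr)
    assume "\<not> kn K i < kn K (i + deg K)"
    then have eq: "kn K j = kn K i" if "i \<le> j" "j \<le> i + deg K" for j
      using monoD[OF mono_kn, of i j] monoD[OF mono_kn, of j "i + deg K"] that by auto
    let ?J = "{j \<in> {1..nspl K + deg K + 1}. knot K j = knot K i}"
    have "{i..i + deg K} \<subseteq> ?J"
    proof
      fix j assume "j \<in> {i..i + deg K}"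
      then show "j \<in> ?J"
        using eq[of j] assms by (auto simp: kn_def)
    qed
    then have "deg K + 1 \<le> card ?J"
      using card_mono[of ?J "{i..i + deg K}"] by simp
    moreover have "card ?J \<le> deg K"
      using K False assms by (auto simp: open_knot_vector_def Let_def)
    ultimately show False by simp
  qed
qed

lemma Bs_eq: "1 \<le> i \<Longrightarrow> i \<le> nspl K \<Longrightarrow> bspline (knot K) (deg K) i = Bs K i"
  unfolding Bs_def by (rule ext, rule bspline_cong) (auto simp: kn_def)

lemma Ds_eq:
  assumes "2 \<le> i" "i \<le> nspl K"
  shows "(\<lambda>x. real (deg K) / (knot K (i + deg K) - knot K i) * bspline (knot K) (deg K - 1) i x) = Ds K i"
proof
  fix x
  have "bspline (knot K) (deg K - 1) i x = bspline (kn K) (deg K - 1) i x"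
    by (rule bspline_cong) (use assms deg_pos in \<open>auto simp: kn_def\<close>)
  then show "real (deg K) / (knot K (i + deg K) - knot K i) * bspline (knot K) (deg K - 1) i x = Ds K i x"
    using assms by (simp add: Ds_def kn_def)
qed

lemma B_ring_eq: "B_ring K = (\<lambda>i. (Bs K i, SB K i)) ` {2..nspl K - 1}"
  unfolding B_ring_def Let_def
  by (intro image_cong) (auto simp: Bs_eq SB_def kn_def)

lemma D_all_eq: "D_all K = (\<lambda>i. (Ds K i, SD K i)) ` {2..nspl K}"
  unfolding D_all_def Let_def
proof (rule image_cong[OF refl])
  fix i assume "i \<in> {2..nspl K}"
  then show "(\<lambda>x. real (deg K) / (knot K (i + deg K) - knot K i) * bspline (knot K) (deg K - 1) i x,
      {knot K i<..<knot K (i + deg K)}) = (Ds K i, SD K i)"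
    using Ds_eq[of i] by (simp add: SD_def kn_def)
qed

lemma spline_space_eq: "spline_space K = span (Bs K ` {1..nspl K})"
proof -
  have "(\<lambda>i. bspline (knot K) (deg K) i) ` {1..nspl K} = Bs K ` {1..nspl K}"
    by (intro image_cong) (auto simp: Bs_eq)
  then show ?thesis by (simp add: spline_space_def)
qed

lemma Bs_eq_0_outside: "x < kn K i \<or> kn K (i + deg K + 1) \<le> x \<Longrightarrow> Bs K i x = 0"
  unfolding Bs_def by (rule bspline_eq_0[OF mono_kn])

lemma Bs_eq_0: "x \<le> kn K i \<Longrightarrow> 2 \<le> i \<Longrightarrow> i \<le> nspl K \<Longrightarrow> Bs K i x = 0"
  unfolding Bs_def using kn_less[of i] by (intro bspline_eq_0'[OF mono_kn]) auto

lemma Bs_eq_0_notin_SB: "0 < x \<Longrightarrow> 1 \<le> i \<Longrightarrow> i \<le> nspl K \<Longrightarrow> x \<notin> SB K i \<Longrightarrow> Bs K i x = 0"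
  using Bs_eq_0[of x i] Bs_eq_0_outside[of x i] kn_eq_0[of 1]
  by (cases "i = 1") (auto simp: SB_def not_less)

lemma Ds_eq_0: "x < kn K i \<or> kn K (i + deg K) \<le> x \<Longrightarrow> Ds K i x = 0"
  using bspline_eq_0[OF mono_kn, of x i "deg K - 1"] deg_pos by (auto simp: Ds_def)

lemma Ds_1: "Ds K 1 = (\<lambda>x. 0)"
  by (auto simp: Ds_def kn_eq_0)

lemma Ds_Suc_nspl: "Ds K (nspl K + 1) = (\<lambda>x. 0)"
  by (auto simp: Ds_def kn_eq_1)

lemma Bs_has_right_derivative: "(Bs K i has_real_derivative Ds K i x - Ds K (i + 1) x) (at_right x)"
  using bspline_has_right_derivative[OF mono_kn, of "deg K" i x] by (simp add: Bs_def Ds_def)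

lemma Bs_has_derivative:
  "x \<notin> range (kn K) \<Longrightarrow> (Bs K i has_real_derivative Ds K i x - Ds K (i + 1) x) (at x)"
  using bspline_has_derivative_off_knots[OF mono_kn, of x i "deg K"] by (auto simp: Bs_def Ds_def)

text \<open>Summation by parts; the boundary terms contain the vanishing normalised B-splines of
  index 1 and \<open>nspl K + 1\<close>.\<close>

lemma spline_derivative_sum:
  fixes a :: "nat \<Rightarrow> real"
  shows "(\<Sum>i=1..nspl K. a i * (Ds K i x - Ds K (i + 1) x)) = (\<Sum>i=2..nspl K. (a i - a (i - 1)) * Ds K i x)"
proof -
  have "(\<Sum>i=1..n. a i * (Ds K i x - Ds K (i + 1) x))
      = (\<Sum>i=2..n. (a i - a (i - 1)) * Ds K i x) - a n * Ds K (n + 1) x" if "1 \<le> n" for n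
    using that
  proof (induction n rule: dec_induct)
    case (step n)
    then have "{2..Suc n} = insert (Suc n) {2..n}" by auto
    with step show ?case by (simp add: algebra_simps)
  qed (use Ds_1 in \<open>auto simp: algebra_simps\<close>)
  then show ?thesis
    using deg_less_nspl Ds_Suc_nspl by simp
qed

lemma spline_has_right_derivative:
  fixes a :: "nat \<Rightarrow> real"
  shows "((\<lambda>x. \<Sum>i=1..nspl K. a i * Bs K i x) has_real_derivative
    (\<Sum>i=2..nspl K. (a i - a (i - 1)) * Ds K i x)) (at_right x)"
  unfolding spline_derivative_sum[symmetric]
  by (intro DERIV_sum DERIV_cmult Bs_has_right_derivative)

lemma Bs_isCont: "2 \<le> i \<Longrightarrow> i < nspl K \<Longrightarrow> isCont (Bs K i) x"
  unfolding Bs_def using kn_less[of i] kn_less[of "i + 1"]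
  by (intro bspline_isCont[OF mono_kn]) auto

lemma Ds_right_continuous: "continuous (at_right x) (Ds K i)"
proof -
  have "continuous (at_right x) (bspline (kn K) (deg K - 1) i)"
    by (rule DERIV_continuous[OF bspline_has_right_derivative[OF mono_kn]])
  then show ?thesis
    unfolding Ds_def by (intro continuous_intros)
qed

lemma Bs_right_continuous: "continuous (at_right x) (Bs K i)"
  by (rule DERIV_continuous[OF Bs_has_right_derivative])

lemma Bs_sum:
  assumes "0 \<le> x" "x < 1"
  shows "(\<Sum>i=1..nspl K. Bs K i x) = 1"
proof -
  define k where "k = Max {j. j \<le> nspl K \<and> kn K j \<le> x}"
  have "k \<in> {j. j \<le> nspl K \<and> kn K j \<le> x}"
    unfolding k_def by (rule Max_in) (use assms kn_eq_0[of 0] in auto)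
  moreover have kmax: "j \<le> k" if "j \<le> nspl K" "kn K j \<le> x" for j
    unfolding k_def by (rule Max_ge) (use that in auto)
  have "deg K + 1 \<le> k" using kmax deg_less_nspl kn_eq_0 assms by auto
  moreover have "x < kn K (k + 1)"
    using kmax[of "k + 1"] kn_eq_1[of "k + 1"] assms by (cases "k + 1 \<le> nspl K") (auto simp: not_le[symmetric])
  ultimately have "(\<Sum>i\<le>nspl K. bspline (kn K) (deg K) i x) = 1"
    by (intro bspline_partition_of_unity[OF mono_kn, of k]) auto
  moreover have "Bs K 0 x = 0"
    using assms kn_eq_0 by (intro Bs_eq_0_outside) auto
  moreover have "{..nspl K} = insert 0 {1..nspl K}" by auto
  ultimately show ?thesis by (simp add: Bs_def)
qed

text \<open>The partition of unity of degree \<open>deg K - 1\<close> in the normalised basis; the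
  weights undo the normalisation. Indices below 2 drop out because their B-splines live on the block
  of zero knots.\<close>

lemma Ds_weighted_sum:
  assumes "0 \<le> x" "x < 1"
  shows "(\<Sum>i=2..nspl K. (kn K (i + deg K) - kn K i) / real (deg K) * Ds K i x) = 1"
proof -
  define k where "k = Max {j. j \<le> nspl K \<and> kn K j \<le> x}"
  have "k \<in> {j. j \<le> nspl K \<and> kn K j \<le> x}"
    unfolding k_def by (rule Max_in) (use assms kn_eq_0[of 0] in auto)
  moreover have kmax: "j \<le> k" if "j \<le> nspl K" "kn K j \<le> x" for j
    unfolding k_def by (rule Max_ge) (use that in auto)
  have "deg K + 1 \<le> k" using kmax deg_less_nspl kn_eq_0 assms by auto
  moreover have "x < kn K (k + 1)"
    using kmax[of "k + 1"] kn_eq_1[of "k + 1"] assms by (cases "k + 1 \<le> nspl K") (auto simp: not_le[symmetric])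
  ultimately have "(\<Sum>i\<le>nspl K. bspline (kn K) (deg K - 1) i x) = 1"
    by (intro bspline_partition_of_unity[OF mono_kn, of k]) auto
  also have "(\<Sum>i\<le>nspl K. bspline (kn K) (deg K - 1) i x) = (\<Sum>i=2..nspl K. bspline (kn K) (deg K - 1) i x)"
  proof (rule sum.mono_neutral_right)
    show "\<forall>i\<in>{..nspl K} - {2..nspl K}. bspline (kn K) (deg K - 1) i x = 0"
    proof
      fix i assume "i \<in> {..nspl K} - {2..nspl K}"
      then have "i + (deg K - 1) + 1 \<le> deg K + 1" using deg_pos by auto
      then show "bspline (kn K) (deg K - 1) i x = 0"
        using assms by (intro bspline_eq_0[OF mono_kn]) (simp add: kn_eq_0)
    qed
  qed auto
  also have "\<dots> = (\<Sum>i=2..nspl K. (kn K (i + deg K) - kn K i) / real (deg K) * Ds K i x)"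
  proof (rule sum.cong[OF refl])
    fix i assume "i \<in> {2..nspl K}"
    then show "bspline (kn K) (deg K - 1) i x = (kn K (i + deg K) - kn K i) / real (deg K) * Ds K i x"
      using kn_less[of i] deg_pos by (simp add: Ds_def)
  qed
  finally show ?thesis by simp
qed

lemma Bs_at_0: "Bs K i 0 = (if i = 1 then 1 else 0)" if "1 \<le> i" "i \<le> nspl K"
proof (cases "i = 1")
  case True
  then show ?thesis
    unfolding Bs_def using bspline_full_knot[OF mono_kn, of 1 0 "deg K"] kn_eq_0 kn_pos[of "deg K + 2"]
    by simp
next
  case False
  then show ?thesis using Bs_eq_0[of 0 i] that kn_bounds by auto
qed

lemma Bs_locally_independent:
  fixes c :: "nat \<Rightarrow> real"
  assumes "open U" "x \<in> U" "x \<in> SB K i" "i \<in> {1..nspl K}"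
    and zero: "\<And>x. x \<in> U \<Longrightarrow> (\<Sum>i=1..nspl K. c i * Bs K i x) = 0"
  shows "c i = 0"
proof -
  define c' where "c' i = (if i = 0 then 0 else c i)" for i
  have "(\<Sum>i\<le>nspl K. c' i * bspline (kn K) (deg K) i x) = (\<Sum>i=1..nspl K. c i * Bs K i x)" for x
    by (rule sum.mono_neutral_cong_right) (auto simp: c'_def Bs_def)
  then have "c' i = 0"
    using assms kn_eq_0[of "deg K"] kn_bounds
    by (intro bspline_locally_independent[OF mono_kn, of "deg K" U x i "nspl K" c'])
      (auto simp: SB_def kn_eq_1)
  then show ?thesis using assms(4) by (simp add: c'_def)
qed

lemma Ds_locally_independent:
  fixes c :: "nat \<Rightarrow> real"
  assumes "open U" "x \<in> U" "x \<in> SD K i" "i \<in> {2..nspl K}"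
    and zero: "\<And>x. x \<in> U \<Longrightarrow> (\<Sum>i=2..nspl K. c i * Ds K i x) = 0"
  shows "c i = 0"
proof -
  define d where "d i = real (deg K) / (kn K (i + deg K) - kn K i)" for i
  define c' where "c' i = (if i < 2 then 0 else c i * d i)" for i
  have "(\<Sum>i\<le>nspl K. c' i * bspline (kn K) (deg K - 1) i x) = (\<Sum>i=2..nspl K. c i * Ds K i x)" for x
    by (rule sum.mono_neutral_cong_right) (auto simp: c'_def d_def Ds_def)
  then have "c' i = 0"
    using assms kn_eq_0[of "deg K - 1"] kn_bounds deg_pos
    by (intro bspline_locally_independent[OF mono_kn, of "deg K - 1" U x i "nspl K" c'])
      (auto simp: SD_def kn_eq_1)
  then show ?thesis using assms(4) kn_less[of i] deg_pos by (auto simp: c'_def d_def)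
qed

lemma Ds_nonneg: "0 \<le> Ds K i x"
  unfolding Ds_def using bspline_nonneg[OF mono_kn] monoD[OF mono_kn, of i "i + deg K"] by auto

lemma Ds_measurable: "Ds K i \<in> borel_measurable borel"
  unfolding Ds_def by measurable

lemma Ds_has_integral: "i \<in> {2..nspl K} \<Longrightarrow> (Ds K i has_integral 1) {0..1}"
proof -
  assume i: "i \<in> {2..nspl K}"
  have "(Ds K i has_integral 1) {kn K i..kn K (i + deg K)}"
    unfolding Ds_def using bspline_normalised_integral[OF mono_kn deg_pos, of i] kn_less i by auto
  then show ?thesis
  proof (rule has_integral_on_superset)
    show "Ds K i x = 0" if "x \<notin> {kn K i..kn K (i + deg K)}" for x
      using that Ds_eq_0[of x i] by auto
    show "{kn K i..kn K (i + deg K)} \<subseteq> {0..1}"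
      using kn_bounds by auto
  qed
qed

end

section \<open>Linear combinations and tensor products of function spaces\<close>

lemma sum_fun_apply: "(\<Sum>i\<in>I. f i) x = (\<Sum>i\<in>I. f i x)" for f :: "'i \<Rightarrow> 'a \<Rightarrow> 'v :: comm_monoid_add"
  by (induction I rule: infinite_finite_induct) auto

lemma scaleR_fun_apply: "(c *\<^sub>R f) x = c *\<^sub>R f x"
  by (simp add: scaleR_fun_def)

text \<open>Coefficients are indexed by \<open>I\<close> rather than by the image, so that
  \<open>f\<close> need not be injective.\<close>

lemma span_image_sum:
  fixes f :: "'i \<Rightarrow> 'v :: real_vector"
  assumes "finite I" "v \<in> span (f ` I)"
  obtains c where "v = (\<Sum>i\<in>I. c i *\<^sub>R f i)"
proof -
  have "span (f ` I) \<subseteq> range (\<lambda>c. \<Sum>i\<in>I. c i *\<^sub>R f i)"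
  proof (rule span_minimal)
    show "f ` I \<subseteq> range (\<lambda>c. \<Sum>i\<in>I. c i *\<^sub>R f i)"
    proof
      fix v assume "v \<in> f ` I"
      then obtain j where j: "j \<in> I" "v = f j" by auto
      have "(\<Sum>i\<in>I. (if i = j then 1 else 0) *\<^sub>R f i) = (\<Sum>i\<in>I. if i = j then f i else 0)"
        by (intro sum.cong) auto
      then have "v = (\<Sum>i\<in>I. (if i = j then 1 else 0) *\<^sub>R f i)"
        using j assms(1) by simp
      then show "v \<in> range (\<lambda>c. \<Sum>i\<in>I. c i *\<^sub>R f i)"
        by (rule range_eqI[where x = "\<lambda>i. if i = j then 1 else 0"])
    qed
    show "subspace (range (\<lambda>c. \<Sum>i\<in>I. c i *\<^sub>R f i))"
    proof (rule subspaceI)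
      show "0 \<in> range (\<lambda>c. \<Sum>i\<in>I. c i *\<^sub>R f i)"
        by (rule image_eqI[of _ _ "\<lambda>_. 0"]) auto
    next
      fix x y assume "x \<in> range (\<lambda>c. \<Sum>i\<in>I. c i *\<^sub>R f i)" "y \<in> range (\<lambda>c. \<Sum>i\<in>I. c i *\<^sub>R f i)"
      then obtain c d where "x = (\<Sum>i\<in>I. c i *\<^sub>R f i)" "y = (\<Sum>i\<in>I. d i *\<^sub>R f i)" by auto
      then have "x + y = (\<Sum>i\<in>I. (c i + d i) *\<^sub>R f i)"
        by (simp add: sum.distrib scaleR_add_left)
      then show "x + y \<in> range (\<lambda>c. \<Sum>i\<in>I. c i *\<^sub>R f i)"
        by (rule range_eqI[where x = "\<lambda>i. c i + d i"])
    next
      fix a x assume "x \<in> range (\<lambda>c. \<Sum>i\<in>I. c i *\<^sub>R f i)"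
      then obtain c where "x = (\<Sum>i\<in>I. c i *\<^sub>R f i)" by auto
      then have "a *\<^sub>R x = (\<Sum>i\<in>I. (a * c i) *\<^sub>R f i)"
        by (simp add: scaleR_sum_right)
      then show "a *\<^sub>R x \<in> range (\<lambda>c. \<Sum>i\<in>I. c i *\<^sub>R f i)"
        by (rule range_eqI[where x = "\<lambda>i. a * c i"])
    qed
  qed
  with assms that show ?thesis by blast
qed

text \<open>Restriction to the line of height \<open>y\<close> maps the fine tensor space into its
  first factor \<open>S1'\<close> and sends the product of \<open>f\<close> and \<open>g\<close> to
  \<open>f\<close>, since \<open>g y = 1\<close>.\<close>

lemma tensor_space_subset_left:
  assumes "tensor_space S1 S2 \<subseteq> tensor_space S1' S2'" "subspace S1'"
    and "f \<in> S1" "g \<in> S2" "g y = 1"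
  shows "f \<in> S1'"
proof -
  let ?T = "{\<lambda>(x1, x2). f x1 * g x2 | f g. f \<in> S1' \<and> g \<in> S2'}"
  have "(\<lambda>(x1, x2). f x1 * g x2) \<in> tensor_space S1 S2"
    unfolding tensor_space_def using assms by (intro span_base) auto
  then have "(\<lambda>(x1, x2). f x1 * g x2) \<in> span ?T"
    using assms(1) by (auto simp: tensor_space_def)
  then have "(\<lambda>x. (\<lambda>(x1, x2). f x1 * g x2) (x, y)) \<in> S1'"
  proof (induction rule: span_induct_alt)
    case base
    then show ?case using subspace_0[OF assms(2)] by (simp add: zero_fun_def)
  next
    case (step c h k)
    then obtain f g where h: "h = (\<lambda>(x1, x2). f x1 * g x2)" "f \<in> S1'" by auto
    have "(\<lambda>x. (c *\<^sub>R h + k) (x, y)) = (c * g y) *\<^sub>R f + (\<lambda>x. k (x, y))"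
      by (auto simp: fun_eq_iff scaleR_fun_def h)
    then show ?case
      using step h by (auto intro: subspace_add subspace_scale assms(2))
  qed
  then show ?thesis using assms(5) by simp
qed

lemma tensor_space_subset_right:
  assumes "tensor_space S1 S2 \<subseteq> tensor_space S1' S2'" "subspace S2'"
    and "f \<in> S1" "g \<in> S2" "f x = 1"
  shows "g \<in> S2'"
proof -
  let ?T = "{\<lambda>(x1, x2). f x1 * g x2 | f g. f \<in> S1' \<and> g \<in> S2'}"
  have "(\<lambda>(x1, x2). f x1 * g x2) \<in> tensor_space S1 S2"
    unfolding tensor_space_def using assms by (intro span_base) auto
  then have "(\<lambda>(x1, x2). f x1 * g x2) \<in> span ?T"
    using assms(1) by (auto simp: tensor_space_def)
  then have "(\<lambda>y. (\<lambda>(x1, x2). f x1 * g x2) (x, y)) \<in> S2'"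
  proof (induction rule: span_induct_alt)
    case base
    then show ?case using subspace_0[OF assms(2)] by (simp add: zero_fun_def)
  next
    case (step c h k)
    then obtain f g where h: "h = (\<lambda>(x1, x2). f x1 * g x2)" "g \<in> S2'" by auto
    have "(\<lambda>y. (c *\<^sub>R h + k) (x, y)) = (c * f x) *\<^sub>R g + (\<lambda>y. k (x, y))"
      by (auto simp: fun_eq_iff scaleR_fun_def h)
    then show ?case
      using step h by (auto intro: subspace_add subspace_scale assms(2))
  qed
  then show ?thesis using assms(5) by simp
qed

lemma spline_space_unit:
  assumes "open_knot_vector K"
  obtains g where "g \<in> spline_space K" "g (1 / 2) = 1"
proof
  show "(\<Sum>i=1..nspl K. Bs K i) \<in> spline_space K"
    unfolding spline_space_eq[OF assms] by (intro span_sum span_base) auto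
  show "(\<Sum>i=1..nspl K. Bs K i) (1 / 2) = 1"
    using Bs_sum[OF assms, of "1 / 2"] by (simp add: sum_fun_apply)
qed

lemma nested_spline_spaces:
  assumes "open_knot_vector K1" "open_knot_vector K2"
    and "tensor_space (spline_space K1) (spline_space K2) \<subseteq> tensor_space (spline_space K1') (spline_space K2')"
  shows "spline_space K1 \<subseteq> spline_space K1'" "spline_space K2 \<subseteq> spline_space K2'"
proof -
  have sub: "subspace (spline_space K)" for K
    by (simp add: spline_space_def)
  from assms(2) obtain g where "g \<in> spline_space K2" "g (1 / 2) = 1" by (rule spline_space_unit)
  then show "spline_space K1 \<subseteq> spline_space K1'"
    using tensor_space_subset_left[OF assms(3) sub] by blast
  from assms(1) obtain f where "f \<in> spline_space K1" "f (1 / 2) = 1" by (rule spline_space_unit)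
  then show "spline_space K2 \<subseteq> spline_space K2'"
    using tensor_space_subset_right[OF assms(3) sub] by blast
qed

lemma Ds_combination_integral:
  assumes "open_knot_vector K"
  shows "((\<lambda>x. \<Sum>j=2..nspl K. c j * Ds K j x) has_integral (\<Sum>j=2..nspl K. c j)) {0..1}"
proof -
  have "((\<lambda>x. \<Sum>j=2..nspl K. c j * Ds K j x) has_integral (\<Sum>j=2..nspl K. c j * 1)) {0..1}"
    by (intro has_integral_sum has_integral_mult_right Ds_has_integral[OF assms]) auto
  then show ?thesis by simp
qed

section \<open>Two-scale relations between nested univariate spline spaces\<close>

context
  fixes K K' :: knot_vector
  assumes K: "open_knot_vector K" and K': "open_knot_vector K'"
    and nested: "spline_space K \<subseteq> spline_space K'"
begin

lemma spline_refine:
  obtains c where "\<And>x. (\<Sum>i=1..nspl K. a i * Bs K i x) = (\<Sum>j=1..nspl K'. c j * Bs K' j x)"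
proof -
  have "(\<Sum>i=1..nspl K. a i *\<^sub>R Bs K i) \<in> spline_space K"
    unfolding spline_space_eq[OF K] by (intro span_sum span_scale span_base) auto
  then have "(\<Sum>i=1..nspl K. a i *\<^sub>R Bs K i) \<in> span (Bs K' ` {1..nspl K'})"
    using nested by (auto simp: spline_space_eq[OF K'])
  then obtain c where "(\<Sum>i=1..nspl K. a i *\<^sub>R Bs K i) = (\<Sum>j=1..nspl K'. c j *\<^sub>R Bs K' j)"
    by (rule span_image_sum[rotated]) auto
  from fun_cong[OF this] show ?thesis
    by (intro that[of c]) (simp add: sum_fun_apply scaleR_fun_apply)
qed

text \<open>Right derivatives exist at every point and are unique, so an identity of splines can be
  differentiated at the knots as well.\<close>

lemma refine_derivative:
  assumes "\<And>x. (\<Sum>i=1..nspl K. a i * Bs K i x) = (\<Sum>j=1..nspl K'. c j * Bs K' j x)"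
  shows "(\<Sum>i=2..nspl K. (a i - a (i - 1)) * Ds K i x) = (\<Sum>j=2..nspl K'. (c j - c (j - 1)) * Ds K' j x)"
proof -
  note spline_has_right_derivative[OF K, of a x]
  moreover note spline_has_right_derivative[OF K', of c x]
  ultimately show ?thesis
    unfolding assms has_field_derivative_iff by (rule tendsto_unique[rotated]) simp
qed

text \<open>An inner B-spline refines to inner ones, as the two boundary coefficients vanish. If a
  fine support leaves the closed coarse support, then near some of its points the coarse B-spline is
  0, and local independence removes the coefficient.\<close>

lemma Bs_refine:
  assumes i: "2 \<le> i" "i < nspl K"
  obtains c where "\<And>x. Bs K i x = (\<Sum>j=2..nspl K' - 1. c j * Bs K' j x)"
    and "\<And>j. j \<in> {2..nspl K' - 1} \<Longrightarrow> c j \<noteq> 0 \<Longrightarrow> SB K' j \<subseteq> SB K i"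
proof -
  define a where "a k = (if k = i then 1 else 0 :: real)" for k
  obtain c where c: "\<And>x. (\<Sum>k=1..nspl K. a k * Bs K k x) = (\<Sum>j=1..nspl K'. c j * Bs K' j x)"
    using spline_refine[of a] by blast
  have a: "(\<Sum>k=1..nspl K. a k * Bs K k x) = Bs K i x" for x
    using i by (simp add: a_def if_distrib[of "\<lambda>t. t * _"] sum.delta cong: if_cong)
  have c1: "c 1 = 0"
  proof -
    have "0 = Bs K i 0"
      using Bs_at_0[OF K, of i] i by simp
    also have "\<dots> = (\<Sum>j=1..nspl K'. c j * (if j = 1 then 1 else 0))"
      unfolding a[symmetric] c by (intro sum.cong refl) (simp add: Bs_at_0[OF K'])
    also have "\<dots> = c 1"
      using deg_less_nspl[OF K'] by (simp add: if_distrib[of "\<lambda>t. _ * t"] sum.delta cong: if_cong)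
    finally show ?thesis by simp
  qed
  \<comment> \<open>All splines are 0 at the point 1 by the half-open convention, so the last
    coefficient cannot be read off there. Integrating the derivative gives the last coefficient
    minus the first.\<close>
  have cm: "c (nspl K') = 0"
  proof -
    have "(\<Sum>k=2..nspl K. a k - a (k - 1)) = (\<Sum>j=2..nspl K'. c j - c (j - 1))"
      using Ds_combination_integral[OF K, of "\<lambda>k. a k - a (k - 1)"]
        Ds_combination_integral[OF K', of "\<lambda>k. c k - c (k - 1)"]
      unfolding refine_derivative[OF c] by (rule has_integral_unique)
    moreover have "(\<Sum>k=2..n. b k - b (k - 1)) = b n - b 1" if "1 \<le> n" for b :: "nat \<Rightarrow> real" and n
      using that
    proof (induction n rule: dec_induct)
      case (step n)
      then have "{2..Suc n} = insert (Suc n) {2..n}" by auto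
      with step show ?case by simp
    qed simp
    ultimately have "a (nspl K) - a 1 = c (nspl K') - c 1"
      using deg_less_nspl[OF K] deg_less_nspl[OF K'] by simp
    then show ?thesis using c1 i by (simp add: a_def)
  qed
  have sub: "SB K' j \<subseteq> SB K i" if j: "j \<in> {1..nspl K'}" "c j \<noteq> 0" for j
  proof -
    have "SB K' j \<subseteq> {kn K i..kn K (i + deg K + 1)}"
    proof
      fix x assume x: "x \<in> SB K' j"
      show "x \<in> {kn K i..kn K (i + deg K + 1)}"
      proof (rule ccontr)
        assume "x \<notin> {kn K i..kn K (i + deg K + 1)}"
        moreover have "Bs K i y = 0" if "y \<in> - {kn K i..kn K (i + deg K + 1)}" for y
          using that by (intro Bs_eq_0_outside[OF K]) auto
        ultimately have "c j = 0"
          using x j unfolding a[symmetric] c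
          by (intro Bs_locally_independent[OF K', of "- {kn K i..kn K (i + deg K + 1)}" x j c]) auto
        with j show False by simp
      qed
    qed
    then show ?thesis
      unfolding SB_def greaterThanLessThan_subseteq_atLeastAtMost_iff
      by (auto simp: greaterThanLessThan_subseteq_greaterThanLessThan)
  qed
  have "Bs K i x = (\<Sum>j=2..nspl K' - 1. c j * Bs K' j x)" for x
    unfolding a[symmetric] c
  proof (rule sum.mono_neutral_right)
    show "\<forall>j\<in>{1..nspl K'} - {2..nspl K' - 1}. c j * Bs K' j x = 0"
    proof
      fix j assume "j \<in> {1..nspl K'} - {2..nspl K' - 1}"
      then have "j = 1 \<or> j = nspl K'" by auto
      then show "c j * Bs K' j x = 0" using c1 cm by auto
    qed
  qed auto
  then show ?thesis by (rule that[OF _ sub]) auto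
qed

lemma Ds_refine:
  assumes i: "2 \<le> i" "i \<le> nspl K"
  obtains c where "\<And>x. Ds K i x = (\<Sum>j=2..nspl K'. c j * Ds K' j x)"
    and "\<And>j. j \<in> {2..nspl K'} \<Longrightarrow> c j \<noteq> 0 \<Longrightarrow> SD K' j \<subseteq> SD K i"
proof -
  \<comment> \<open>The sum of the B-splines from index \<open>i\<close> on has derivative
    \<open>Ds K i\<close>. Its refinement therefore yields that of \<open>Ds K i\<close>, with
    differences of coefficients as coefficients.\<close>
  define a where "a k = (if i \<le> k then 1 else 0 :: real)" for k
  obtain c where c: "\<And>x. (\<Sum>k=1..nspl K. a k * Bs K k x) = (\<Sum>j=1..nspl K'. c j * Bs K' j x)"
    using spline_refine[of a] by blast
  define d where "d j = c j - c (j - 1)" for j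
  have D: "Ds K i x = (\<Sum>j=2..nspl K'. d j * Ds K' j x)" for x
  proof -
    have "(\<Sum>k=2..nspl K. (a k - a (k - 1)) * Ds K k x) = (\<Sum>k=2..nspl K. if k = i then Ds K k x else 0)"
      by (intro sum.cong) (use i in \<open>auto simp: a_def\<close>)
    then show ?thesis
      using refine_derivative[OF c, of x] i by (simp add: d_def)
  qed
  have "SD K' j \<subseteq> SD K i" if j: "j \<in> {2..nspl K'}" "d j \<noteq> 0" for j
  proof -
    have "SD K' j \<subseteq> {kn K i..kn K (i + deg K)}"
    proof
      fix x assume x: "x \<in> SD K' j"
      show "x \<in> {kn K i..kn K (i + deg K)}"
      proof (rule ccontr)
        assume "x \<notin> {kn K i..kn K (i + deg K)}"
        moreover have "Ds K i y = 0" if "y \<in> - {kn K i..kn K (i + deg K)}" for y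
          using that by (intro Ds_eq_0[OF K]) auto
        ultimately have "d j = 0"
          using x j unfolding D
          by (intro Ds_locally_independent[OF K', of "- {kn K i..kn K (i + deg K)}" x j d]) auto
        with j show False by simp
      qed
    qed
    then show ?thesis
      unfolding SD_def greaterThanLessThan_subseteq_atLeastAtMost_iff
      by (auto simp: greaterThanLessThan_subseteq_greaterThanLessThan)
  qed
  with D show ?thesis by (rule that)
qed

text \<open>Every fine B-spline occurs in the expansion of the coarse partition of unity.\<close>

lemma SD_refine:
  assumes j: "j \<in> {2..nspl K'}"
  obtains i where "i \<in> {2..nspl K}" "SD K' j \<subseteq> SD K i"
proof -
  define w where "w K i = (kn K (i + deg K) - kn K i) / real (deg K)" for K i
  define P where "P i c \<longleftrightarrow> (\<forall>x. Ds K i x = (\<Sum>j=2..nspl K'. c j * Ds K' j x)) \<and>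
    (\<forall>j\<in>{2..nspl K'}. c j \<noteq> 0 \<longrightarrow> SD K' j \<subseteq> SD K i)" for i and c :: "nat \<Rightarrow> real"
  have "\<forall>i\<in>{2..nspl K}. \<exists>c. P i c"
  proof
    fix i assume "i \<in> {2..nspl K}"
    then obtain c where "\<And>x. Ds K i x = (\<Sum>j=2..nspl K'. c j * Ds K' j x)"
        "\<And>j. j \<in> {2..nspl K'} \<Longrightarrow> c j \<noteq> 0 \<Longrightarrow> SD K' j \<subseteq> SD K i"
      using Ds_refine[of i] by (metis atLeastAtMost_iff)
    then show "\<exists>c. P i c" unfolding P_def by blast
  qed
  then obtain c where c: "\<And>i. i \<in> {2..nspl K} \<Longrightarrow> P i (c i)" by metis
  have "(\<Sum>j=2..nspl K'. ((\<Sum>i=2..nspl K. w K i * c i j) - w K' j) * Ds K' j x) = 0"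
    if x: "x \<in> {0<..<1}" for x
  proof -
    have "(\<Sum>j=2..nspl K'. (\<Sum>i=2..nspl K. w K i * c i j) * Ds K' j x)
        = (\<Sum>i=2..nspl K. w K i * (\<Sum>j=2..nspl K'. c i j * Ds K' j x))"
      unfolding sum_distrib_left sum_distrib_right
      by (subst sum.swap) (simp add: mult.assoc)
    also have "\<dots> = (\<Sum>i=2..nspl K. w K i * Ds K i x)"
      using c by (intro sum.cong refl) (auto simp: P_def)
    also have "\<dots> = 1"
      using Ds_weighted_sum[OF K, of x] x by (simp add: w_def)
    also have "1 = (\<Sum>j=2..nspl K'. w K' j * Ds K' j x)"
      using Ds_weighted_sum[OF K', of x] x by (simp add: w_def)
    finally show ?thesis by (simp add: left_diff_distrib sum_subtractf)
  qed
  moreover have "kn K' j < kn K' (j + deg K')"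
    using kn_less[OF K', of j] j by auto
  moreover from this obtain x where x: "x \<in> SD K' j"
    using dense by (auto simp: SD_def)
  moreover have "x \<in> {0<..<1}"
    using x kn_bounds[OF K', of j] kn_bounds[OF K', of "j + deg K'"] by (auto simp: SD_def)
  ultimately have "(\<Sum>i=2..nspl K. w K i * c i j) - w K' j = 0"
    using Ds_locally_independent[OF K', of "{0<..<1}" x j "\<lambda>j. (\<Sum>i=2..nspl K. w K i * c i j) - w K' j"] j
    by auto
  moreover have "w K' j \<noteq> 0"
    using \<open>kn K' j < kn K' (j + deg K')\<close> deg_pos[OF K'] by (simp add: w_def)
  ultimately obtain i where "i \<in> {2..nspl K}" "c i j \<noteq> 0"
    by (metis (mono_tags, lifting) mult_zero_right sum.neutral diff_0 neg_equal_0_iff_equal)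
  with c[of i] j show ?thesis
    by (intro that[of i]) (auto simp: P_def)
qed

end

section \<open>Partial derivatives of spline forms\<close>

lemma spline_has_derivative:
  fixes a :: "nat \<Rightarrow> real"
  assumes "open_knot_vector K" "x \<notin> range (kn K)"
  shows "((\<lambda>x. \<Sum>i=1..nspl K. a i * Bs K i x) has_real_derivative
    (\<Sum>i=2..nspl K. (a i - a (i - 1)) * Ds K i x)) (at x)"
  unfolding spline_derivative_sum[OF assms(1), symmetric]
  by (intro DERIV_sum DERIV_cmult Bs_has_derivative[OF assms])

text \<open>The right derivatives fix the value of the derivative at every point, also on knot lines. Thus
  the relations below are single-valued, and equalities almost everywhere between spline forms can be
  replaced by equalities of functions.\<close>

definition dx :: "(real \<times> real \<Rightarrow> real) \<Rightarrow> (real \<times> real \<Rightarrow> real) \<Rightarrow> bool" where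
  "dx u v \<longleftrightarrow> (\<forall>x y. ((\<lambda>t. u (t, y)) has_real_derivative v (x, y)) (at_right x)) \<and>
     (\<exists>X. finite X \<and> (\<forall>x y. x \<notin> X \<longrightarrow> ((\<lambda>t. u (t, y)) has_real_derivative v (x, y)) (at x)))"

definition dy :: "(real \<times> real \<Rightarrow> real) \<Rightarrow> (real \<times> real \<Rightarrow> real) \<Rightarrow> bool" where
  "dy u v \<longleftrightarrow> dx (u \<circ> prod.swap) (v \<circ> prod.swap)"

definition grad_rel :: "(real \<times> real \<Rightarrow> real) \<Rightarrow> (real \<times> real \<Rightarrow> real \<times> real) \<Rightarrow> bool" where
  "grad_rel u v \<longleftrightarrow> dx u (\<lambda>z. fst (v z)) \<and> dy u (\<lambda>z. snd (v z))"

definition curl_rel :: "(real \<times> real \<Rightarrow> real \<times> real) \<Rightarrow> (real \<times> real \<Rightarrow> real) \<Rightarrow> bool" where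
  "curl_rel v w \<longleftrightarrow>
     (\<exists>a b. dx (\<lambda>z. snd (v z)) a \<and> dy (\<lambda>z. fst (v z)) b \<and> w = (\<lambda>z. a z - b z))"

text \<open>A linear map defined on a subspace only, encoded by its graph, because derivatives of
  arbitrary functions need not exist.\<close>

definition linear_rel :: "('a :: real_vector \<Rightarrow> 'b :: real_vector \<Rightarrow> bool) \<Rightarrow> bool" where
  "linear_rel R \<longleftrightarrow> subspace {(a, b). R a b} \<and> (\<forall>a b b'. R a b \<longrightarrow> R a b' \<longrightarrow> b = b')"

lemma linear_rel_zero: "linear_rel R \<Longrightarrow> R 0 0"
  using subspace_0[of "{(a, b). R a b}"] by (auto simp: linear_rel_def zero_prod_def)

lemma linear_rel_add: "linear_rel R \<Longrightarrow> R a b \<Longrightarrow> R a' b' \<Longrightarrow> R (a + a') (b + b')"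
  using subspace_add[of "{(a, b). R a b}" "(a, b)" "(a', b')"] by (auto simp: linear_rel_def)

lemma linear_rel_scale: "linear_rel R \<Longrightarrow> R a b \<Longrightarrow> R (c *\<^sub>R a) (c *\<^sub>R b)"
  using subspace_scale[of "{(a, b). R a b}" "(a, b)" c] by (auto simp: linear_rel_def)

lemma linear_rel_minus: "linear_rel R \<Longrightarrow> R a b \<Longrightarrow> R (- a) (- b)"
  using linear_rel_scale[of R a b "-1"] by simp

lemma linear_rel_diff: "linear_rel R \<Longrightarrow> R a b \<Longrightarrow> R a' b' \<Longrightarrow> R (a - a') (b - b')"
  using linear_rel_add[of R a b "- a'" "- b'"] linear_rel_minus[of R a' b'] by simp

lemma linear_rel_unique: "linear_rel R \<Longrightarrow> R a b \<Longrightarrow> R a b' \<Longrightarrow> b = b'"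
  by (auto simp: linear_rel_def)

lemma linear_rel_image: "linear_rel R \<Longrightarrow> subspace V \<Longrightarrow> subspace {b. \<exists>a\<in>V. R a b}"
  by (rule subspaceI)
    (auto intro: linear_rel_zero linear_rel_add linear_rel_scale subspace_0 subspace_add subspace_scale)

lemma dx_unique:
  assumes "dx u v" "dx u v'"
  shows "v = v'"
proof
  fix z :: "real \<times> real"
  obtain x y where z: "z = (x, y)" by force
  have "((\<lambda>t. u (t, y)) has_real_derivative v z) (at_right x)"
    "((\<lambda>t. u (t, y)) has_real_derivative v' z) (at_right x)"
    using assms by (auto simp: dx_def z)
  then show "v z = v' z"
    unfolding has_field_derivative_iff by (rule tendsto_unique[rotated]) simp
qed

lemma linear_rel_dx: "linear_rel dx"
  unfolding linear_rel_def
proof (intro conjI subspaceI)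
  show "0 \<in> {(a, b). dx a b}"
    by (auto simp: dx_def zero_prod_def zero_fun_def)
next
  fix p q :: "(real \<times> real \<Rightarrow> real) \<times> (real \<times> real \<Rightarrow> real)"
  assume "p \<in> {(a, b). dx a b}" "q \<in> {(a, b). dx a b}"
  then obtain u v u' v' where pq: "p = (u, v)" "q = (u', v')" and d: "dx u v" "dx u' v'" by auto
  from d obtain X X' where X: "finite X" "finite X'"
    "\<And>x y. x \<notin> X \<Longrightarrow> ((\<lambda>t. u (t, y)) has_real_derivative v (x, y)) (at x)"
    "\<And>x y. x \<notin> X' \<Longrightarrow> ((\<lambda>t. u' (t, y)) has_real_derivative v' (x, y)) (at x)"
    by (auto simp: dx_def)
  have "dx (u + u') (v + v')"
    unfolding dx_def
  proof (intro conjI allI exI[of _ "X \<union> X'"] impI)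
    show "((\<lambda>t. (u + u') (t, y)) has_real_derivative (v + v') (x, y)) (at_right x)" for x y
      using d by (auto simp: dx_def intro!: DERIV_add)
    show "((\<lambda>t. (u + u') (t, y)) has_real_derivative (v + v') (x, y)) (at x)" if "x \<notin> X \<union> X'" for x y
      using X that by (auto intro!: DERIV_add)
  qed (use X in auto)
  then show "p + q \<in> {(a, b). dx a b}" by (simp add: pq)
next
  fix c :: real and p :: "(real \<times> real \<Rightarrow> real) \<times> (real \<times> real \<Rightarrow> real)"
  assume "p \<in> {(a, b). dx a b}"
  then obtain u v where p: "p = (u, v)" and d: "dx u v" by auto
  from d obtain X where X: "finite X"
    "\<And>x y. x \<notin> X \<Longrightarrow> ((\<lambda>t. u (t, y)) has_real_derivative v (x, y)) (at x)"
    by (auto simp: dx_def)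
  have "dx (c *\<^sub>R u) (c *\<^sub>R v)"
    unfolding dx_def
  proof (intro conjI allI exI[of _ X] impI)
    show "((\<lambda>t. (c *\<^sub>R u) (t, y)) has_real_derivative (c *\<^sub>R v) (x, y)) (at_right x)" for x y
      using d by (auto simp: dx_def scaleR_fun_apply intro!: DERIV_cmult)
    show "((\<lambda>t. (c *\<^sub>R u) (t, y)) has_real_derivative (c *\<^sub>R v) (x, y)) (at x)" if "x \<notin> X" for x y
      using X that by (auto simp: scaleR_fun_apply intro!: DERIV_cmult)
  qed (use X in auto)
  then show "c *\<^sub>R p \<in> {(a, b). dx a b}" by (simp add: p)
qed (auto dest: dx_unique)

lemma dy_unique: "dy u v \<Longrightarrow> dy u v' \<Longrightarrow> v = v'"
  unfolding dy_def by (drule (1) dx_unique) (metis comp_assoc comp_id swap_comp_swap)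

lemma dy_iff: "dy u v \<longleftrightarrow>
  (\<forall>x y. ((\<lambda>t. u (x, t)) has_real_derivative v (x, y)) (at_right y)) \<and>
  (\<exists>X. finite X \<and> (\<forall>x y. y \<notin> X \<longrightarrow> ((\<lambda>t. u (x, t)) has_real_derivative v (x, y)) (at y)))"
  unfolding dy_def dx_def by auto

lemma linear_rel_dy: "linear_rel dy"
proof -
  have "dx ((u + u') \<circ> prod.swap) ((v + v') \<circ> prod.swap)"
    if "dx (u \<circ> prod.swap) (v \<circ> prod.swap)" "dx (u' \<circ> prod.swap) (v' \<circ> prod.swap)" for u u' v v'
    using linear_rel_add[OF linear_rel_dx, OF that] by (simp add: fun_eq_iff comp_def plus_fun_def)
  moreover have "dx ((c *\<^sub>R u) \<circ> prod.swap) ((c *\<^sub>R v) \<circ> prod.swap)"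
    if "dx (u \<circ> prod.swap) (v \<circ> prod.swap)" for u v c
    using linear_rel_scale[OF linear_rel_dx, OF that, of c] by (simp add: comp_def scaleR_fun_def)
  moreover have "dx (0 \<circ> prod.swap) (0 \<circ> prod.swap)"
    using linear_rel_zero[OF linear_rel_dx] by (simp add: comp_def zero_fun_def)
  ultimately show ?thesis
    unfolding linear_rel_def by (intro conjI subspaceI) (auto simp: dy_def[symmetric] zero_prod_def dest: dy_unique)
qed

lemma linear_rel_grad: "linear_rel grad_rel"
proof -
  have "u = v" if "grad_rel f u" "grad_rel f v" for f u v
    using that unfolding grad_rel_def
    by (auto simp: fun_eq_iff prod_eq_iff dest!: dx_unique[of _ "\<lambda>z. fst (u z)"] dy_unique[of _ "\<lambda>z. snd (u z)"])
  moreover have "grad_rel (u + u') (v + v')" if "grad_rel u v" "grad_rel u' v'" for u u' v v'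
    using linear_rel_add[OF linear_rel_dx, of u "\<lambda>z. fst (v z)" u' "\<lambda>z. fst (v' z)"]
      linear_rel_add[OF linear_rel_dy, of u "\<lambda>z. snd (v z)" u' "\<lambda>z. snd (v' z)"] that
    by (simp add: grad_rel_def plus_fun_def)
  moreover have "grad_rel (c *\<^sub>R u) (c *\<^sub>R v)" if "grad_rel u v" for u v c
    using linear_rel_scale[OF linear_rel_dx, of u "\<lambda>z. fst (v z)" c]
      linear_rel_scale[OF linear_rel_dy, of u "\<lambda>z. snd (v z)" c] that
    by (simp add: grad_rel_def scaleR_fun_def)
  moreover have "grad_rel 0 0"
    using linear_rel_zero[OF linear_rel_dx] linear_rel_zero[OF linear_rel_dy]
    by (simp add: grad_rel_def zero_fun_def)
  ultimately show ?thesis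
    unfolding linear_rel_def by (intro conjI subspaceI) (auto simp: zero_prod_def)
qed

lemma linear_rel_curl: "linear_rel curl_rel"
proof -
  have "w = w'" if "curl_rel v w" "curl_rel v w'" for v w w'
    using that unfolding curl_rel_def by (metis dx_unique dy_unique)
  moreover have "curl_rel (v + v') (w + w')" if "curl_rel v w" "curl_rel v' w'" for v v' w w'
  proof -
    from that obtain a b a' b' where "dx (\<lambda>z. snd (v z)) a" "dy (\<lambda>z. fst (v z)) b" "w = (\<lambda>z. a z - b z)"
      "dx (\<lambda>z. snd (v' z)) a'" "dy (\<lambda>z. fst (v' z)) b'" "w' = (\<lambda>z. a' z - b' z)"
      by (auto simp: curl_rel_def)
    then show ?thesis
      using linear_rel_add[OF linear_rel_dx, of "\<lambda>z. snd (v z)" a "\<lambda>z. snd (v' z)" a']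
        linear_rel_add[OF linear_rel_dy, of "\<lambda>z. fst (v z)" b "\<lambda>z. fst (v' z)" b']
      unfolding curl_rel_def by (intro exI[of _ "a + a'"] exI[of _ "b + b'"]) (auto simp: plus_fun_def)
  qed
  moreover have "curl_rel (c *\<^sub>R v) (c *\<^sub>R w)" if "curl_rel v w" for v w c
  proof -
    from that obtain a b where "dx (\<lambda>z. snd (v z)) a" "dy (\<lambda>z. fst (v z)) b" "w = (\<lambda>z. a z - b z)"
      by (auto simp: curl_rel_def)
    then show ?thesis
      using linear_rel_scale[OF linear_rel_dx, of "\<lambda>z. snd (v z)" a c]
        linear_rel_scale[OF linear_rel_dy, of "\<lambda>z. fst (v z)" b c]
      unfolding curl_rel_def
      by (intro exI[of _ "c *\<^sub>R a"] exI[of _ "c *\<^sub>R b"]) (auto simp: scaleR_fun_def right_diff_distrib)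
  qed
  moreover have "curl_rel 0 0"
    using linear_rel_zero[OF linear_rel_dx] linear_rel_zero[OF linear_rel_dy]
    unfolding curl_rel_def by (intro exI[of _ 0]) (auto simp: zero_fun_def)
  ultimately show ?thesis
    unfolding linear_rel_def by (intro conjI subspaceI) (auto simp: zero_prod_def)
qed

lemma dx_spline:
  assumes "open_knot_vector K"
  shows "dx (\<lambda>(x, y). \<Sum>i=1..nspl K. a i y * Bs K i x)
    (\<lambda>(x, y). \<Sum>i=2..nspl K. (a i y - a (i - 1) y) * Ds K i x)"
  unfolding dx_def split_conv
proof (intro conjI allI exI[of _ "range (kn K)"] impI)
  show "((\<lambda>x. \<Sum>i=1..nspl K. a i y * Bs K i x) has_real_derivative
      (\<Sum>i=2..nspl K. (a i y - a (i - 1) y) * Ds K i x)) (at_right x)" for x y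
    by (rule spline_has_right_derivative[OF assms])
  show "((\<lambda>x. \<Sum>i=1..nspl K. a i y * Bs K i x) has_real_derivative
      (\<Sum>i=2..nspl K. (a i y - a (i - 1) y) * Ds K i x)) (at x)" if "x \<notin> range (kn K)" for x y
    by (rule spline_has_derivative[OF assms that])
qed (rule finite_kn[OF assms])

text \<open>The sums include the boundary B-splines. In this way derivatives act on coefficients as
  plain differences, and the boundary conditions turn into conditions on where the coefficients may
  be nonzero.\<close>

definition scalar_form :: "knot_vector \<Rightarrow> knot_vector \<Rightarrow> (nat \<Rightarrow> nat \<Rightarrow> real) \<Rightarrow> real \<times> real \<Rightarrow> real" where
  "scalar_form K1 K2 c = (\<lambda>(x, y). \<Sum>i=1..nspl K1. \<Sum>j=1..nspl K2. c i j * (Bs K1 i x * Bs K2 j y))"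

definition vector_form ::
    "knot_vector \<Rightarrow> knot_vector \<Rightarrow> (nat \<Rightarrow> nat \<Rightarrow> real) \<Rightarrow> (nat \<Rightarrow> nat \<Rightarrow> real) \<Rightarrow> real \<times> real \<Rightarrow> real \<times> real" where
  "vector_form K1 K2 a b = (\<lambda>(x, y).
     (\<Sum>i=2..nspl K1. \<Sum>j=1..nspl K2. a i j * (Ds K1 i x * Bs K2 j y),
      \<Sum>i=1..nspl K1. \<Sum>j=2..nspl K2. b i j * (Bs K1 i x * Ds K2 j y)))"

definition density_form :: "knot_vector \<Rightarrow> knot_vector \<Rightarrow> (nat \<Rightarrow> nat \<Rightarrow> real) \<Rightarrow> real \<times> real \<Rightarrow> real" where
  "density_form K1 K2 c = (\<lambda>(x, y). \<Sum>i=2..nspl K1. \<Sum>j=2..nspl K2. c i j * (Ds K1 i x * Ds K2 j y))"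

lemma sum_product_left:
  fixes c :: "'a \<Rightarrow> 'b \<Rightarrow> real"
  shows "(\<Sum>i\<in>I. \<Sum>j\<in>J. c i j * (f i * g j)) = (\<Sum>i\<in>I. (\<Sum>j\<in>J. c i j * g j) * f i)"
  by (simp add: sum_distrib_right mult.assoc mult.commute[of "f _"])

lemma sum_product_right:
  fixes c :: "'a \<Rightarrow> 'b \<Rightarrow> real"
  shows "(\<Sum>i\<in>I. \<Sum>j\<in>J. c i j * (f i * g j)) = (\<Sum>j\<in>J. (\<Sum>i\<in>I. c i j * f i) * g j)"
  by (subst sum.swap) (simp add: sum_distrib_right mult.assoc)

lemma dy_spline:
  assumes "open_knot_vector K"
  shows "dy (\<lambda>(x, y). \<Sum>i=1..nspl K. a i x * Bs K i y)
    (\<lambda>(x, y). \<Sum>i=2..nspl K. (a i x - a (i - 1) x) * Ds K i y)"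
  using dx_spline[OF assms, of a] by (simp add: dy_def comp_def case_prod_beta')

context
  fixes K1 K2 :: knot_vector
  assumes K: "open_knot_vector K1" "open_knot_vector K2"
begin

lemma grad_scalar_form:
  "grad_rel (scalar_form K1 K2 c)
     (vector_form K1 K2 (\<lambda>i j. c i j - c (i - 1) j) (\<lambda>i j. c i j - c i (j - 1)))"
  unfolding grad_rel_def
proof
  show "dx (scalar_form K1 K2 c) (\<lambda>z. fst (vector_form K1 K2 (\<lambda>i j. c i j - c (i - 1) j) (\<lambda>i j. c i j - c i (j - 1)) z))"
    using dx_spline[OF K(1), of "\<lambda>i y. \<Sum>j=1..nspl K2. c i j * Bs K2 j y"]
    by (simp only: scalar_form_def vector_form_def case_prod_beta' fst_conv sum_product_left sum_subtractf left_diff_distrib)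
  show "dy (scalar_form K1 K2 c) (\<lambda>z. snd (vector_form K1 K2 (\<lambda>i j. c i j - c (i - 1) j) (\<lambda>i j. c i j - c i (j - 1)) z))"
    using dy_spline[OF K(2), of "\<lambda>j x. \<Sum>i=1..nspl K1. c i j * Bs K1 i x"]
    by (simp only: scalar_form_def vector_form_def case_prod_beta' snd_conv sum_product_right sum_subtractf left_diff_distrib)
qed

lemma curl_vector_form:
  "curl_rel (vector_form K1 K2 a b)
     (density_form K1 K2 (\<lambda>i j. (b i j - b (i - 1) j) - (a i j - a i (j - 1))))"
proof -
  have "dx (\<lambda>z. snd (vector_form K1 K2 a b z)) (density_form K1 K2 (\<lambda>i j. b i j - b (i - 1) j))"
    using dx_spline[OF K(1), of "\<lambda>i y. \<Sum>j=2..nspl K2. b i j * Ds K2 j y"]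
    by (simp only: density_form_def vector_form_def case_prod_beta' snd_conv sum_product_left sum_subtractf left_diff_distrib)
  moreover have "dy (\<lambda>z. fst (vector_form K1 K2 a b z)) (density_form K1 K2 (\<lambda>i j. a i j - a i (j - 1)))"
    using dy_spline[OF K(2), of "\<lambda>j x. \<Sum>i=2..nspl K1. a i j * Ds K1 i x"]
    by (simp only: density_form_def vector_form_def case_prod_beta' fst_conv sum_product_right sum_subtractf left_diff_distrib)
  ultimately show ?thesis
    unfolding curl_rel_def
    by (intro exI conjI) (auto simp: density_form_def fun_eq_iff sum_subtractf left_diff_distrib)
qed

end

section \<open>Spaces of spline forms supported in a subdomain\<close>

definition form0 :: "knot_vector \<Rightarrow> knot_vector \<Rightarrow> (real \<times> real) set \<Rightarrow> (real \<times> real \<Rightarrow> real) set" where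
  "form0 K1 K2 U = span ((\<lambda>(i, j). \<lambda>(x, y). Bs K1 i x * Bs K2 j y) `
     {(i, j) \<in> {2..nspl K1 - 1} \<times> {2..nspl K2 - 1}. SB K1 i \<times> SB K2 j \<subseteq> U})"

definition form1 :: "knot_vector \<Rightarrow> knot_vector \<Rightarrow> (real \<times> real) set \<Rightarrow> (real \<times> real \<Rightarrow> real \<times> real) set" where
  "form1 K1 K2 U = span (
     (\<lambda>(i, j). \<lambda>(x, y). (Ds K1 i x * Bs K2 j y, 0)) `
       {(i, j) \<in> {2..nspl K1} \<times> {2..nspl K2 - 1}. SD K1 i \<times> SB K2 j \<subseteq> U} \<union>
     (\<lambda>(i, j). \<lambda>(x, y). (0, Bs K1 i x * Ds K2 j y)) `
       {(i, j) \<in> {2..nspl K1 - 1} \<times> {2..nspl K2}. SB K1 i \<times> SD K2 j \<subseteq> U})"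

definition form2 :: "knot_vector \<Rightarrow> knot_vector \<Rightarrow> (real \<times> real) set \<Rightarrow> (real \<times> real \<Rightarrow> real) set" where
  "form2 K1 K2 U = span ((\<lambda>(i, j). \<lambda>(x, y). Ds K1 i x * Ds K2 j y) `
     {(i, j) \<in> {2..nspl K1} \<times> {2..nspl K2}. SD K1 i \<times> SD K2 j \<subseteq> U})"

lemma subspace_form: "subspace (form0 K1 K2 U)" "subspace (form1 K1 K2 U)" "subspace (form2 K1 K2 U)"
  by (simp_all add: form0_def form1_def form2_def)

lemma form_mono:
  assumes "U \<subseteq> U'"
  shows "form0 K1 K2 U \<subseteq> form0 K1 K2 U'" "form1 K1 K2 U \<subseteq> form1 K1 K2 U'" "form2 K1 K2 U \<subseteq> form2 K1 K2 U'"
  unfolding form0_def form1_def form2_def using assms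
  by (intro span_mono Un_mono image_mono; blast)+

text \<open>Coefficients are extended by 0 to the rectangle \<open>I \<times> J\<close>. Membership
  in any of the spans then refers to one fixed sum, and only the place where the coefficients live
  depends on the subdomain.\<close>

lemma span_image_pairs:
  fixes f :: "'i \<Rightarrow> 'j \<Rightarrow> 'v :: real_vector"
  assumes fin: "finite I" "finite J" and sub: "I' \<subseteq> I" "J' \<subseteq> J"
  shows "v \<in> span ((\<lambda>(i, j). f i j) ` {(i, j) \<in> I' \<times> J'. P i j}) \<longleftrightarrow>
    (\<exists>c. v = (\<Sum>i\<in>I. \<Sum>j\<in>J. c i j *\<^sub>R f i j) \<and> (\<forall>i j. c i j \<noteq> 0 \<longrightarrow> i \<in> I' \<and> j \<in> J' \<and> P i j))"
    (is "v \<in> span (?f ` ?S) \<longleftrightarrow> ?R")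
proof
  assume v: "v \<in> span (?f ` ?S)"
  have "?S \<subseteq> I \<times> J" using sub by auto
  then have finS: "finite ?S" using fin finite_subset by blast
  from span_image_sum[OF this v] obtain c where c: "v = (\<Sum>p\<in>?S. c p *\<^sub>R ?f p)" by blast
  define d where "d i j = (if (i, j) \<in> ?S then c (i, j) else 0)" for i j
  have "v = (\<Sum>p\<in>I \<times> J. d (fst p) (snd p) *\<^sub>R ?f p)"
    unfolding c by (rule sum.mono_neutral_cong_left) (use fin \<open>?S \<subseteq> I \<times> J\<close> in \<open>auto simp: d_def\<close>)
  also have "\<dots> = (\<Sum>i\<in>I. \<Sum>j\<in>J. d i j *\<^sub>R f i j)"
    by (simp add: sum.cartesian_product case_prod_beta)
  finally show ?R
    by (intro exI[of _ d]) (auto simp: d_def)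
next
  assume ?R
  then obtain c where c: "v = (\<Sum>i\<in>I. \<Sum>j\<in>J. c i j *\<^sub>R f i j)"
    "\<And>i j. c i j \<noteq> 0 \<Longrightarrow> i \<in> I' \<and> j \<in> J' \<and> P i j" by blast
  have "c i j *\<^sub>R f i j \<in> span (?f ` ?S)" for i j
  proof (cases "c i j = 0")
    case False
    then have "(i, j) \<in> ?S" using c(2) by auto
    from imageI[OF this, of ?f] have "f i j \<in> ?f ` ?S" by simp
    then have "f i j \<in> span (?f ` ?S)" by (rule span_base)
    then show ?thesis by (rule span_scale)
  qed (simp add: span_zero)
  then show "v \<in> span (?f ` ?S)"
    unfolding c(1) by (intro span_sum)
qed

lemma form0_iff:
  "w \<in> form0 K1 K2 U \<longleftrightarrow> (\<exists>c. w = scalar_form K1 K2 c \<and>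
    (\<forall>i j. c i j \<noteq> 0 \<longrightarrow> i \<in> {2..nspl K1 - 1} \<and> j \<in> {2..nspl K2 - 1} \<and> SB K1 i \<times> SB K2 j \<subseteq> U))"
proof -
  have eq: "scalar_form K1 K2 c
      = (\<Sum>i=1..nspl K1. \<Sum>j=1..nspl K2. c i j *\<^sub>R (\<lambda>(x, y). Bs K1 i x * Bs K2 j y))" for c
    by (auto simp: fun_eq_iff scalar_form_def sum_fun_apply scaleR_fun_apply)
  show ?thesis
    unfolding eq form0_def by (rule span_image_pairs) auto
qed

lemma form2_iff:
  "w \<in> form2 K1 K2 U \<longleftrightarrow> (\<exists>c. w = density_form K1 K2 c \<and>
    (\<forall>i j. c i j \<noteq> 0 \<longrightarrow> i \<in> {2..nspl K1} \<and> j \<in> {2..nspl K2} \<and> SD K1 i \<times> SD K2 j \<subseteq> U))"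
proof -
  have eq: "density_form K1 K2 c
      = (\<Sum>i=2..nspl K1. \<Sum>j=2..nspl K2. c i j *\<^sub>R (\<lambda>(x, y). Ds K1 i x * Ds K2 j y))" for c
    by (auto simp: fun_eq_iff density_form_def sum_fun_apply scaleR_fun_apply)
  show ?thesis
    unfolding eq form2_def by (rule span_image_pairs) auto
qed

lemma form1_iff:
  "v \<in> form1 K1 K2 U \<longleftrightarrow> (\<exists>a b. v = vector_form K1 K2 a b \<and>
    (\<forall>i j. a i j \<noteq> 0 \<longrightarrow> i \<in> {2..nspl K1} \<and> j \<in> {2..nspl K2 - 1} \<and> SD K1 i \<times> SB K2 j \<subseteq> U) \<and>
    (\<forall>i j. b i j \<noteq> 0 \<longrightarrow> i \<in> {2..nspl K1 - 1} \<and> j \<in> {2..nspl K2} \<and> SB K1 i \<times> SD K2 j \<subseteq> U))"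
    (is "_ \<longleftrightarrow> (\<exists>a b. _ \<and> ?A a \<and> ?B b)")
proof -
  define f :: "nat \<Rightarrow> nat \<Rightarrow> real \<times> real \<Rightarrow> real \<times> real" where
    "f i j = (\<lambda>(x, y). (Ds K1 i x * Bs K2 j y, 0))" for i j
  define g :: "nat \<Rightarrow> nat \<Rightarrow> real \<times> real \<Rightarrow> real \<times> real" where
    "g i j = (\<lambda>(x, y). (0, Bs K1 i x * Ds K2 j y))" for i j
  have eq: "vector_form K1 K2 a b = (\<Sum>i=2..nspl K1. \<Sum>j=1..nspl K2. a i j *\<^sub>R f i j)
      + (\<Sum>i=1..nspl K1. \<Sum>j=2..nspl K2. b i j *\<^sub>R g i j)" for a b
    by (auto simp: fun_eq_iff vector_form_def sum_fun_apply scaleR_fun_apply f_def g_def prod_eq_iff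
        fst_sum snd_sum)
  let ?F = "(\<lambda>(i, j). f i j) ` {(i, j) \<in> {2..nspl K1} \<times> {2..nspl K2 - 1}. SD K1 i \<times> SB K2 j \<subseteq> U}"
  let ?G = "(\<lambda>(i, j). g i j) ` {(i, j) \<in> {2..nspl K1 - 1} \<times> {2..nspl K2}. SB K1 i \<times> SD K2 j \<subseteq> U}"
  have F: "u \<in> span ?F \<longleftrightarrow> (\<exists>a. u = (\<Sum>i=2..nspl K1. \<Sum>j=1..nspl K2. a i j *\<^sub>R f i j) \<and> ?A a)" for u
    by (rule span_image_pairs) auto
  have G: "u \<in> span ?G \<longleftrightarrow> (\<exists>b. u = (\<Sum>i=1..nspl K1. \<Sum>j=2..nspl K2. b i j *\<^sub>R g i j) \<and> ?B b)" for u
    by (rule span_image_pairs) auto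
  have "form1 K1 K2 U = span (?F \<union> ?G)"
    by (simp add: form1_def f_def g_def)
  then have "v \<in> form1 K1 K2 U \<longleftrightarrow> (\<exists>p q. p \<in> span ?F \<and> q \<in> span ?G \<and> v = p + q)"
    by (auto simp: span_Un)
  then show ?thesis
    unfolding F G eq by blast
qed

text \<open>For fixed \<open>y\<close> the double sum is a combination of the \<open>f i\<close>
  with coefficients depending on \<open>y\<close>. Independence in the first variable leaves a
  vanishing combination of the \<open>g j\<close>, to which independence in the second
  applies.\<close>

lemma tensor_locally_independent:
  fixes f g :: "nat \<Rightarrow> real \<Rightarrow> real"
  assumes f: "\<And>U x i c. open U \<Longrightarrow> x \<in> U \<Longrightarrow> x \<in> S i \<Longrightarrow> i \<in> I \<Longrightarrow>
      (\<And>x. x \<in> U \<Longrightarrow> (\<Sum>i\<in>I. c i * f i x) = 0) \<Longrightarrow> c i = 0"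
    and g: "\<And>U x i c. open U \<Longrightarrow> x \<in> U \<Longrightarrow> x \<in> T i \<Longrightarrow> i \<in> J \<Longrightarrow>
      (\<And>x. x \<in> U \<Longrightarrow> (\<Sum>i\<in>J. c i * g i x) = 0) \<Longrightarrow> c i = 0"
    and "open W" "z \<in> W" "z \<in> S i \<times> T j" "i \<in> I" "j \<in> J"
    and zero: "\<And>x y. (x, y) \<in> W \<Longrightarrow> (\<Sum>i\<in>I. \<Sum>j\<in>J. c i j * (f i x * g j y)) = 0"
  shows "c i j = 0"
proof -
  from open_prod_elim[OF \<open>open W\<close> \<open>z \<in> W\<close>] obtain A B
    where AB: "open A" "open B" "z \<in> A \<times> B" "A \<times> B \<subseteq> W" by blast
  have "(\<Sum>j\<in>J. c i j * g j y) = 0" if "y \<in> B" for y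
  proof (rule f[of A "fst z" i "\<lambda>i. \<Sum>j\<in>J. c i j * g j y"])
    fix x assume "x \<in> A"
    then show "(\<Sum>i\<in>I. (\<Sum>j\<in>J. c i j * g j y) * f i x) = 0"
      using zero[of x y] that AB(4) by (auto simp: sum_product_left)
  qed (use assms AB in auto)
  then show ?thesis
    using g[of B "snd z" j "c i"] assms AB by auto
qed

context
  fixes K1 K2 :: knot_vector
  assumes K: "open_knot_vector K1" "open_knot_vector K2"
begin

lemma density_form_locally_independent:
  assumes "open W" "z \<in> W" "z \<in> SD K1 i \<times> SD K2 j" "i \<in> {2..nspl K1}" "j \<in> {2..nspl K2}"
    and "\<And>z. z \<in> W \<Longrightarrow> density_form K1 K2 c z = 0"
  shows "c i j = 0"
proof (rule tensor_locally_independent[where W = W and z = z and f = "Ds K1" and g = "Ds K2"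
        and S = "SD K1" and T = "SD K2" and I = "{2..nspl K1}" and J = "{2..nspl K2}"])
  show "(\<Sum>i=2..nspl K1. \<Sum>j=2..nspl K2. c i j * (Ds K1 i x * Ds K2 j y)) = 0" if "(x, y) \<in> W" for x y
    using assms(6)[OF that] by (simp add: density_form_def)
next
  fix U x i and c :: "nat \<Rightarrow> real"
  assume "open U" "x \<in> U" "x \<in> SD K1 i" "i \<in> {2..nspl K1}"
    "\<And>x. x \<in> U \<Longrightarrow> (\<Sum>i=2..nspl K1. c i * Ds K1 i x) = 0"
  then show "c i = 0" by (rule Ds_locally_independent[OF K(1)])
next
  fix U x i and c :: "nat \<Rightarrow> real"
  assume "open U" "x \<in> U" "x \<in> SD K2 i" "i \<in> {2..nspl K2}"
    "\<And>x. x \<in> U \<Longrightarrow> (\<Sum>i=2..nspl K2. c i * Ds K2 i x) = 0"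
  then show "c i = 0" by (rule Ds_locally_independent[OF K(2)])
qed (use assms in auto)

lemma scalar_form_locally_independent:
  assumes "open W" "z \<in> W" "z \<in> SB K1 i \<times> SB K2 j" "i \<in> {1..nspl K1}" "j \<in> {1..nspl K2}"
    and "\<And>z. z \<in> W \<Longrightarrow> scalar_form K1 K2 c z = 0"
  shows "c i j = 0"
proof (rule tensor_locally_independent[where W = W and z = z and f = "Bs K1" and g = "Bs K2"
        and S = "SB K1" and T = "SB K2" and I = "{1..nspl K1}" and J = "{1..nspl K2}"])
  show "(\<Sum>i=1..nspl K1. \<Sum>j=1..nspl K2. c i j * (Bs K1 i x * Bs K2 j y)) = 0" if "(x, y) \<in> W" for x y
    using assms(6)[OF that] by (simp add: scalar_form_def)
next
  fix U x i and c :: "nat \<Rightarrow> real"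
  assume "open U" "x \<in> U" "x \<in> SB K1 i" "i \<in> {1..nspl K1}"
    "\<And>x. x \<in> U \<Longrightarrow> (\<Sum>i=1..nspl K1. c i * Bs K1 i x) = 0"
  then show "c i = 0" by (rule Bs_locally_independent[OF K(1)])
next
  fix U x i and c :: "nat \<Rightarrow> real"
  assume "open U" "x \<in> U" "x \<in> SB K2 i" "i \<in> {1..nspl K2}"
    "\<And>x. x \<in> U \<Longrightarrow> (\<Sum>i=1..nspl K2. c i * Bs K2 i x) = 0"
  then show "c i = 0" by (rule Bs_locally_independent[OF K(2)])
qed (use assms in auto)

end

text \<open>\<open>U\<close> is the interior of its closure, so an open set inside the closure is
  inside \<open>U\<close>. This turns a support not contained in \<open>U\<close> into a point at
  which local independence can be used.\<close>

lemma open_subset_regular: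
  fixes S U :: "(real \<times> real) set"
  assumes "open S" "interior (closure U) = U" "\<not> S \<subseteq> U"
  obtains z where "z \<in> S" "z \<notin> closure U"
proof -
  have "\<not> S \<subseteq> closure U"
    using interior_maximal[of S "closure U"] assms by auto
  with that show ?thesis by blast
qed

lemma open_Omega_hat: "open Omega_hat"
  by (simp add: Omega_hat_def open_Times)

lemma SD_nonempty: "open_knot_vector K \<Longrightarrow> i \<in> {2..nspl K} \<Longrightarrow> SD K i \<noteq> {}"
  using kn_less[of K i] by (auto simp: SD_def)

lemma SB_nonempty:
  assumes "open_knot_vector K" "i \<in> {1..nspl K}"
  shows "SB K i \<noteq> {}"
proof (cases "i = 1")
  case True
  then show ?thesis
    using kn_eq_0[OF assms(1), of 1] kn_pos[OF assms(1), of "deg K + 2"] by (auto simp: SB_def)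
next
  case False
  then show ?thesis
    using kn_less[OF assms(1), of i] monoD[OF mono_kn[OF assms(1)], of "i + deg K" "i + deg K + 1"] assms(2)
    by (auto simp: SB_def)
qed

lemma SB_SD_bounds:
  assumes "open_knot_vector K"
  shows "SB K i \<subseteq> {0<..<1}" "SD K i \<subseteq> {0<..<1}"
  using kn_bounds[OF assms] by (auto simp: SB_def SD_def greaterThanLessThan_subseteq_greaterThanLessThan)

lemma SD_subset_SB:
  assumes "open_knot_vector K"
  shows "SD K i \<subseteq> SB K i" "2 \<le> i \<Longrightarrow> SD K i \<subseteq> SB K (i - 1)"
proof -
  have "kn K (i + deg K) \<le> kn K (i + deg K + 1)" "kn K (i - 1) \<le> kn K i"
    by (intro monoD[OF mono_kn[OF assms]], simp)+
  then show "SD K i \<subseteq> SB K i" "2 \<le> i \<Longrightarrow> SD K i \<subseteq> SB K (i - 1)"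
    by (auto simp: SD_def SB_def)
qed

lemma open_SB: "open (SB K i)" and open_SD: "open (SD K i)"
  by (simp_all add: SB_def SD_def)

lemma Ds_eq_0_closure: "open_knot_vector K \<Longrightarrow> i \<in> {2..nspl K} \<Longrightarrow> x \<notin> closure (SD K i) \<Longrightarrow> Ds K i x = 0"
  using Ds_eq_0[of K x i] kn_less[of K i] by (auto simp: SD_def)

lemma Bs_eq_0_closure:
  assumes "open_knot_vector K" "i \<in> {2..nspl K - 1}" "x \<notin> closure (SB K i)"
  shows "Bs K i x = 0"
proof -
  have "SB K i \<noteq> {}" using assms by (intro SB_nonempty) auto
  then show ?thesis
    using Bs_eq_0_outside[OF assms(1), of x i] assms(3) by (auto simp: SB_def)
qed

lemma spline_eq_0_unit:
  assumes "open_knot_vector K" "x \<notin> {0..<1}"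
  shows "Bs K i x = 0" "Ds K i x = 0"
proof -
  have "x < kn K i \<or> 1 \<le> x"
    using assms(2) kn_bounds(1)[OF assms(1), of i] by auto
  then show "Bs K i x = 0" "Ds K i x = 0"
    using Bs_eq_0_outside[OF assms(1), of x i] Ds_eq_0[OF assms(1), of x i]
      kn_bounds(2)[OF assms(1), of "i + deg K + 1"] kn_bounds(2)[OF assms(1), of "i + deg K"]
    by auto
qed

context
  fixes K1 K2 :: knot_vector
  assumes K: "open_knot_vector K1" "open_knot_vector K2"
begin

lemma form_eq_0:
  assumes z: "z \<notin> closure U"
  shows "u \<in> form0 K1 K2 U \<Longrightarrow> u z = 0" "v \<in> form1 K1 K2 U \<Longrightarrow> v z = 0" "w \<in> form2 K1 K2 U \<Longrightarrow> w z = 0"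
proof -
  obtain x y where xy: "z = (x, y)" by force
  have out: "x \<notin> closure S \<or> y \<notin> closure T" if "S \<times> T \<subseteq> U" for S T
    using closure_mono[OF that] z by (auto simp: closure_Times xy)
  show "u z = 0" if "u \<in> form0 K1 K2 U"
  proof -
    from that obtain c where u: "u = scalar_form K1 K2 c" and
      c: "\<And>i j. c i j \<noteq> 0 \<Longrightarrow> i \<in> {2..nspl K1 - 1} \<and> j \<in> {2..nspl K2 - 1} \<and> SB K1 i \<times> SB K2 j \<subseteq> U"
      by (auto simp: form0_iff)
    have "c i j * (Bs K1 i x * Bs K2 j y) = 0" for i j
      using c[of i j] out[of "SB K1 i" "SB K2 j"] Bs_eq_0_closure[OF K(1), of i x] Bs_eq_0_closure[OF K(2), of j y]
      by auto
    then show ?thesis unfolding u scalar_form_def xy split_conv by (simp only: sum.neutral_const)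
  qed
  show "v z = 0" if "v \<in> form1 K1 K2 U"
  proof -
    from that obtain a b where v: "v = vector_form K1 K2 a b" and
      a: "\<And>i j. a i j \<noteq> 0 \<Longrightarrow> i \<in> {2..nspl K1} \<and> j \<in> {2..nspl K2 - 1} \<and> SD K1 i \<times> SB K2 j \<subseteq> U" and
      b: "\<And>i j. b i j \<noteq> 0 \<Longrightarrow> i \<in> {2..nspl K1 - 1} \<and> j \<in> {2..nspl K2} \<and> SB K1 i \<times> SD K2 j \<subseteq> U"
      by (auto simp: form1_iff)
    have "a i j * (Ds K1 i x * Bs K2 j y) = 0" for i j
      using a[of i j] out[of "SD K1 i" "SB K2 j"] Ds_eq_0_closure[OF K(1), of i x] Bs_eq_0_closure[OF K(2), of j y]
      by auto
    moreover have "b i j * (Bs K1 i x * Ds K2 j y) = 0" for i j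
      using b[of i j] out[of "SB K1 i" "SD K2 j"] Bs_eq_0_closure[OF K(1), of i x] Ds_eq_0_closure[OF K(2), of j y]
      by auto
    ultimately show ?thesis
      unfolding v vector_form_def xy split_conv by (simp only: sum.neutral_const zero_prod_def)
  qed
  show "w z = 0" if "w \<in> form2 K1 K2 U"
  proof -
    from that obtain c where w: "w = density_form K1 K2 c" and
      c: "\<And>i j. c i j \<noteq> 0 \<Longrightarrow> i \<in> {2..nspl K1} \<and> j \<in> {2..nspl K2} \<and> SD K1 i \<times> SD K2 j \<subseteq> U"
      by (auto simp: form2_iff)
    have "c i j * (Ds K1 i x * Ds K2 j y) = 0" for i j
      using c[of i j] out[of "SD K1 i" "SD K2 j"] Ds_eq_0_closure[OF K(1), of i x] Ds_eq_0_closure[OF K(2), of j y]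
      by auto
    then show ?thesis unfolding w density_form_def xy split_conv by (simp only: sum.neutral_const)
  qed
qed

text \<open>A difference of coefficients is nonzero only if one of two neighbouring B-splines
  occurs, and the support of the normalised B-spline is contained in both their supports.\<close>

lemma grad_form:
  assumes "u \<in> form0 K1 K2 U"
  shows "\<exists>v\<in>form1 K1 K2 U. grad_rel u v"
proof -
  from assms obtain c where u: "u = scalar_form K1 K2 c" and
    c: "\<And>i j. c i j \<noteq> 0 \<Longrightarrow> i \<in> {2..nspl K1 - 1} \<and> j \<in> {2..nspl K2 - 1} \<and> SB K1 i \<times> SB K2 j \<subseteq> U"
    by (auto simp: form0_iff)
  show ?thesis
  proof
    show "grad_rel u (vector_form K1 K2 (\<lambda>i j. c i j - c (i - 1) j) (\<lambda>i j. c i j - c i (j - 1)))"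
      unfolding u by (rule grad_scalar_form[OF K])
    have "i \<in> {2..nspl K1} \<and> j \<in> {2..nspl K2 - 1} \<and> SD K1 i \<times> SB K2 j \<subseteq> U" if "c i j - c (i - 1) j \<noteq> 0" for i j
    proof (cases "c i j = 0")
      case True
      then show ?thesis
        using c[of "i - 1" j] that SD_subset_SB(2)[OF K(1), of i] by fastforce
    next
      case False
      then show ?thesis using c[of i j] SD_subset_SB(1)[OF K(1), of i] by fastforce
    qed
    moreover have "i \<in> {2..nspl K1 - 1} \<and> j \<in> {2..nspl K2} \<and> SB K1 i \<times> SD K2 j \<subseteq> U" if "c i j - c i (j - 1) \<noteq> 0" for i j
    proof (cases "c i j = 0")
      case True
      then show ?thesis
        using c[of i "j - 1"] that SD_subset_SB(2)[OF K(2), of j] by fastforce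
    next
      case False
      then show ?thesis using c[of i j] SD_subset_SB(1)[OF K(2), of j] by fastforce
    qed
    ultimately show "vector_form K1 K2 (\<lambda>i j. c i j - c (i - 1) j) (\<lambda>i j. c i j - c i (j - 1)) \<in> form1 K1 K2 U"
      unfolding form1_iff by blast
  qed
qed

lemma curl_form:
  assumes "v \<in> form1 K1 K2 U"
  shows "\<exists>w\<in>form2 K1 K2 U. curl_rel v w"
proof -
  from assms obtain a b where v: "v = vector_form K1 K2 a b" and
    a: "\<And>i j. a i j \<noteq> 0 \<Longrightarrow> i \<in> {2..nspl K1} \<and> j \<in> {2..nspl K2 - 1} \<and> SD K1 i \<times> SB K2 j \<subseteq> U" and
    b: "\<And>i j. b i j \<noteq> 0 \<Longrightarrow> i \<in> {2..nspl K1 - 1} \<and> j \<in> {2..nspl K2} \<and> SB K1 i \<times> SD K2 j \<subseteq> U"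
    by (auto simp: form1_iff)
  let ?c = "\<lambda>i j. (b i j - b (i - 1) j) - (a i j - a i (j - 1))"
  show ?thesis
  proof
    show "curl_rel v (density_form K1 K2 ?c)"
      unfolding v by (rule curl_vector_form[OF K])
    have "i \<in> {2..nspl K1} \<and> j \<in> {2..nspl K2} \<and> SD K1 i \<times> SD K2 j \<subseteq> U" if "?c i j \<noteq> 0" for i j
    proof -
      from that consider "b i j \<noteq> 0" | "b (i - 1) j \<noteq> 0" | "a i j \<noteq> 0" | "a i (j - 1) \<noteq> 0" by force
      then show ?thesis
      proof cases
        case 1
        then show ?thesis using b[of i j] SD_subset_SB(1)[OF K(1), of i] by fastforce
      next
        case 2
        then show ?thesis using b[of "i - 1" j] SD_subset_SB(2)[OF K(1), of i] by fastforce
      next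
        case 3
        then show ?thesis using a[of i j] SD_subset_SB(1)[OF K(2), of j] by fastforce
      next
        case 4
        then show ?thesis using a[of i "j - 1"] SD_subset_SB(2)[OF K(2), of j] by fastforce
      qed
    qed
    then show "density_form K1 K2 ?c \<in> form2 K1 K2 U"
      unfolding form2_iff by blast
  qed
qed

lemma curl_grad:
  assumes "u \<in> form0 K1 K2 U" "grad_rel u v"
  shows "curl_rel v 0"
proof -
  from assms(1) obtain c where u: "u = scalar_form K1 K2 c"
    by (auto simp: form0_iff)
  have v: "v = vector_form K1 K2 (\<lambda>i j. c i j - c (i - 1) j) (\<lambda>i j. c i j - c i (j - 1))"
    using linear_rel_unique[OF linear_rel_grad, OF assms(2)] grad_scalar_form[OF K, of c] u by simp
  have "curl_rel v (density_form K1 K2 (\<lambda>i j. (c i j - c i (j - 1) - (c (i - 1) j - c (i - 1) (j - 1)))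
      - (c i j - c (i - 1) j - (c i (j - 1) - c (i - 1) (j - 1)))))"
    unfolding v by (rule curl_vector_form[OF K])
  moreover have "density_form K1 K2 (\<lambda>i j. (c i j - c i (j - 1) - (c (i - 1) j - c (i - 1) (j - 1)))
      - (c i j - c (i - 1) j - (c i (j - 1) - c (i - 1) (j - 1)))) = 0"
    by (simp add: density_form_def fun_eq_iff)
  ultimately show ?thesis by simp
qed

lemma support_in_unit_square:
  "SB K1 i \<times> SB K2 j \<subseteq> Omega_hat" "SD K1 i \<times> SB K2 j \<subseteq> Omega_hat"
  "SB K1 i \<times> SD K2 j \<subseteq> Omega_hat" "SD K1 i \<times> SD K2 j \<subseteq> Omega_hat"
  using SB_SD_bounds[OF K(1), of i] SB_SD_bounds[OF K(2), of j] by (auto simp: Omega_hat_def)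

text \<open>The potential is the partial sum of the coefficients in the first direction.\<close>

lemma closed_form_exact:
  assumes "v \<in> form1 K1 K2 Omega_hat" "curl_rel v 0"
  shows "\<exists>u\<in>form0 K1 K2 Omega_hat. grad_rel u v"
proof -
  from assms(1) obtain a b where v: "v = vector_form K1 K2 a b" and
    a: "\<And>i j. a i j \<noteq> 0 \<Longrightarrow> i \<in> {2..nspl K1} \<and> j \<in> {2..nspl K2 - 1}" and
    b: "\<And>i j. b i j \<noteq> 0 \<Longrightarrow> i \<in> {2..nspl K1 - 1} \<and> j \<in> {2..nspl K2}"
    unfolding form1_iff by blast
  have "density_form K1 K2 (\<lambda>i j. (b i j - b (i - 1) j) - (a i j - a i (j - 1))) = 0"
    using linear_rel_unique[OF linear_rel_curl, OF assms(2)] curl_vector_form[OF K, of a b] v by simp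
  then have closed: "b i j - b (i - 1) j = a i j - a i (j - 1)" if ij: "i \<in> {2..nspl K1}" "j \<in> {2..nspl K2}" for i j
  proof -
    from ij obtain z where "z \<in> SD K1 i \<times> SD K2 j"
      using SD_nonempty[OF K(1)] SD_nonempty[OF K(2)] by fast
    then show ?thesis
      using density_form_locally_independent[OF K open_UNIV, of z i j
          "\<lambda>i j. (b i j - b (i - 1) j) - (a i j - a i (j - 1))"] ij \<open>density_form K1 K2 _ = 0\<close>
      by simp
  qed
  define c where "c i j = (\<Sum>s=2..i. a s j)" for i j
  have c_Suc: "c i j - c (i - 1) j = a i j" if "2 \<le> i" for i j
  proof -
    from that have "{2..i} = insert i {2..i - 1}" by auto
    then show ?thesis using that by (simp add: c_def)
  qed
  \<comment> \<open>The second component is recovered by induction on \<open>i\<close>: both sides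
    vanish for \<open>i = 1\<close> by the boundary condition, and closedness says that they grow by
    the same amount.\<close>
  have cb: "c i j - c i (j - 1) = b i j" if "1 \<le> i" "i \<le> nspl K1" "j \<in> {2..nspl K2}" for i j
    using that(1,2)
  proof (induction i rule: dec_induct)
    case base
    then show ?case using b[of 1 j] by (auto simp: c_def)
  next
    case (step i)
    then show ?case
      using c_Suc[of "Suc i" j] c_Suc[of "Suc i" "j - 1"] closed[of "Suc i" j] that(3) by auto
  qed
  have c_edge: "c i 1 = 0" "c i (nspl K2) = 0" for i
    using a deg_less_nspl[OF K(2)] deg_pos[OF K(2)] by (force simp: c_def intro!: sum.neutral)+
  \<comment> \<open>For the last index in the first direction \<open>b\<close> vanishes, so the
    potential keeps the value 0 that it has at the corner.\<close>
  have c_top: "c (nspl K1) j = 0" if "1 \<le> j" "j \<le> nspl K2" for j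
    using that
  proof (induction j rule: dec_induct)
    case base
    show ?case by (rule c_edge)
  next
    case (step j)
    have "b (nspl K1) (Suc j) = 0"
      by (rule ccontr) (use b[of "nspl K1" "Suc j"] deg_less_nspl[OF K(1)] in auto)
    then show ?case using cb[of "nspl K1" "Suc j"] step deg_less_nspl[OF K(1)] by auto
  qed
  \<comment> \<open>The cut-off changes nothing on the index rectangle, as \<open>c\<close> vanishes
    along its edges; it brings the coefficients into the form that \<open>form0_iff\<close> asks
    for.\<close>
  define d where "d i j = (if i \<in> {2..nspl K1 - 1} \<and> j \<in> {2..nspl K2 - 1} then c i j else 0)" for i j
  have d: "d i j = c i j" if "i \<in> {1..nspl K1}" "j \<in> {1..nspl K2}" for i j
  proof (cases "i \<in> {2..nspl K1 - 1} \<and> j \<in> {2..nspl K2 - 1}")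
    case False
    then have "i = 1 \<or> i = nspl K1 \<or> j = 1 \<or> j = nspl K2" using that by auto
    then have "c i j = 0" using c_edge c_top that by (auto simp: c_def)
    then show ?thesis using False by (auto simp: d_def)
  qed (auto simp: d_def)
  have "vector_form K1 K2 (\<lambda>i j. d i j - d (i - 1) j) (\<lambda>i j. d i j - d i (j - 1)) = vector_form K1 K2 a b"
    unfolding vector_form_def
  proof (intro ext, clarsimp, intro conjI sum.cong refl)
    fix i j x y assume "i \<in> {2..nspl K1}" "j \<in> {Suc 0..nspl K2}"
    moreover from this have "i - 1 \<in> {1..nspl K1}" by auto
    ultimately have "d i j - d (i - 1) j = a i j"
      using d[of i j] d[of "i - 1" j] c_Suc[of i j] by auto
    then show "(d i j - d (i - Suc 0) j) * (Ds K1 i x * Bs K2 j y) = a i j * (Ds K1 i x * Bs K2 j y)" by simp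
  next
    fix i j x y assume "i \<in> {Suc 0..nspl K1}" "j \<in> {2..nspl K2}"
    moreover from this have "j - 1 \<in> {1..nspl K2}" by auto
    ultimately have "d i j - d i (j - 1) = b i j"
      using d[of i j] d[of i "j - 1"] cb[of i j] by auto
    then show "(d i j - d i (j - Suc 0)) * (Bs K1 i x * Ds K2 j y) = b i j * (Bs K1 i x * Ds K2 j y)" by simp
  qed
  then have "grad_rel (scalar_form K1 K2 d) v"
    using grad_scalar_form[OF K, of d] v by simp
  moreover have "scalar_form K1 K2 d \<in> form0 K1 K2 Omega_hat"
    unfolding form0_iff using support_in_unit_square by (intro exI[of _ d]) (auto simp: d_def)
  ultimately show ?thesis by blast
qed

text \<open>A basis function whose support is not contained in \<open>U\<close> is active somewhere
  in the open set off the closure of \<open>U\<close>. There the form is 0, and local independence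
  removes the coefficient.\<close>

lemma form2_vanishing:
  assumes "w \<in> form2 K1 K2 V" "interior (closure U) = U"
    and "\<And>z. z \<in> Omega_hat - closure U \<Longrightarrow> w z = 0"
  shows "w \<in> form2 K1 K2 U"
proof -
  from assms(1) obtain c where w: "w = density_form K1 K2 c" and
    c: "\<And>i j. c i j \<noteq> 0 \<Longrightarrow> i \<in> {2..nspl K1} \<and> j \<in> {2..nspl K2}"
    unfolding form2_iff by blast
  have "SD K1 i \<times> SD K2 j \<subseteq> U" if "c i j \<noteq> 0" for i j
  proof (rule ccontr)
    assume "\<not> SD K1 i \<times> SD K2 j \<subseteq> U"
    then obtain z where z: "z \<in> SD K1 i \<times> SD K2 j" "z \<notin> closure U"
      using open_subset_regular[OF open_Times[OF open_SD open_SD] assms(2)] by blast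
    have "z \<in> Omega_hat - closure U" using z support_in_unit_square by blast
    then have "c i j = 0"
      by (rule density_form_locally_independent[OF K open_Diff[OF open_Omega_hat closed_closure] _ z(1)])
        (use c[OF that] assms(3) w in auto)
    with that show False by simp
  qed
  then show ?thesis using w c unfolding form2_iff by blast
qed

lemma form0_vanishing:
  assumes "w \<in> form0 K1 K2 V" "interior (closure U) = U"
    and "\<And>z. z \<in> Omega_hat - closure U \<Longrightarrow> w z = 0"
  shows "w \<in> form0 K1 K2 U"
proof -
  from assms(1) obtain c where w: "w = scalar_form K1 K2 c" and
    c: "\<And>i j. c i j \<noteq> 0 \<Longrightarrow> i \<in> {2..nspl K1 - 1} \<and> j \<in> {2..nspl K2 - 1}"
    unfolding form0_iff by blast
  have "SB K1 i \<times> SB K2 j \<subseteq> U" if "c i j \<noteq> 0" for i j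
  proof (rule ccontr)
    assume "\<not> SB K1 i \<times> SB K2 j \<subseteq> U"
    then obtain z where z: "z \<in> SB K1 i \<times> SB K2 j" "z \<notin> closure U"
      using open_subset_regular[OF open_Times[OF open_SB open_SB] assms(2)] by blast
    have ij: "i \<in> {1..nspl K1}" "j \<in> {1..nspl K2}" using c[OF that] by auto
    have "z \<in> Omega_hat - closure U" using z support_in_unit_square by blast
    then have "c i j = 0"
      by (rule scalar_form_locally_independent[OF K open_Diff[OF open_Omega_hat closed_closure] _ z(1) ij])
        (use assms(3) w in auto)
    with that show False by simp
  qed
  then show ?thesis using w c unfolding form0_iff by blast
qed

end

text \<open>The map \<open>\<phi>\<close> is the identity or one of the two embeddings of the line
  as a component of the plane, so that scalar forms, densities and both kinds of basis fields are
  refined by one argument.\<close>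

lemma tensor_refine:
  fixes \<phi> :: "real \<Rightarrow> 'v :: real_vector"
  assumes \<phi>: "linear \<phi>" and fin: "finite I" "finite J"
    and f: "\<And>x. f x = (\<Sum>k\<in>I. c k * F k x)" "\<And>k. k \<in> I \<Longrightarrow> c k \<noteq> 0 \<Longrightarrow> S k \<subseteq> A"
    and g: "\<And>y. g y = (\<Sum>l\<in>J. d l * G l y)" "\<And>l. l \<in> J \<Longrightarrow> d l \<noteq> 0 \<Longrightarrow> T l \<subseteq> B"
    and "A \<times> B \<subseteq> U"
  shows "(\<lambda>(x, y). \<phi> (f x * g y)) \<in>
    span ((\<lambda>(k, l). \<lambda>(x, y). \<phi> (F k x * G l y)) ` {(k, l) \<in> I \<times> J. S k \<times> T l \<subseteq> U})"
proof -
  let ?c = "\<lambda>k l. if k \<in> I \<and> l \<in> J then c k * d l else 0"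
  have "\<phi> (f x * g y) = (\<Sum>k\<in>I. \<Sum>l\<in>J. ?c k l *\<^sub>R \<phi> (F k x * G l y))" for x y
  proof -
    have "f x * g y = (\<Sum>k\<in>I. \<Sum>l\<in>J. ?c k l *\<^sub>R (F k x * G l y))"
      unfolding f g sum_product by (intro sum.cong) auto
    then show ?thesis
      by (simp add: linear_sum[OF \<phi>] linear_scale[OF \<phi>] flip: real_scaleR_def)
  qed
  then have "(\<lambda>(x, y). \<phi> (f x * g y)) = (\<Sum>k\<in>I. \<Sum>l\<in>J. ?c k l *\<^sub>R (\<lambda>(x, y). \<phi> (F k x * G l y)))"
    by (simp add: fun_eq_iff sum_fun_apply scaleR_fun_apply)
  moreover have "\<forall>k l. ?c k l \<noteq> 0 \<longrightarrow> k \<in> I \<and> l \<in> J \<and> S k \<times> T l \<subseteq> U"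
    using f(2) g(2) assms(8) by (auto split: if_splits) blast
  ultimately show ?thesis
    unfolding span_image_pairs[OF fin subset_refl subset_refl] by (intro exI conjI)
qed

lemma form_refine:
  assumes K: "open_knot_vector K1" "open_knot_vector K2" "open_knot_vector K1'" "open_knot_vector K2'"
    and nested: "spline_space K1 \<subseteq> spline_space K1'" "spline_space K2 \<subseteq> spline_space K2'"
  shows "form0 K1 K2 U \<subseteq> form0 K1' K2' U" "form1 K1 K2 U \<subseteq> form1 K1' K2' U"
    "form2 K1 K2 U \<subseteq> form2 K1' K2' U"
proof -
  note B1 = Bs_refine[OF K(1,3) nested(1)] and D1 = Ds_refine[OF K(1,3) nested(1)]
  note B2 = Bs_refine[OF K(2,4) nested(2)] and D2 = Ds_refine[OF K(2,4) nested(2)]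
  have lin: "linear (\<lambda>t::real. t)" "linear (\<lambda>t::real. (t, 0::real))" "linear (\<lambda>t::real. (0::real, t))"
    by (auto intro!: linearI)
  show "form0 K1 K2 U \<subseteq> form0 K1' K2' U"
    unfolding form0_def
  proof (intro span_minimal subspace_span subsetI)
    fix h assume "h \<in> (\<lambda>(i, j). \<lambda>(x, y). Bs K1 i x * Bs K2 j y) `
      {(i, j) \<in> {2..nspl K1 - 1} \<times> {2..nspl K2 - 1}. SB K1 i \<times> SB K2 j \<subseteq> U}"
    then obtain i j where h: "h = (\<lambda>(x, y). Bs K1 i x * Bs K2 j y)"
      and i: "2 \<le> i" "i < nspl K1" and j: "2 \<le> j" "j < nspl K2" and U: "SB K1 i \<times> SB K2 j \<subseteq> U" by auto
    show "h \<in> span ((\<lambda>(i, j). \<lambda>(x, y). Bs K1' i x * Bs K2' j y) `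
      {(i, j) \<in> {2..nspl K1' - 1} \<times> {2..nspl K2' - 1}. SB K1' i \<times> SB K2' j \<subseteq> U})"
      unfolding h by (rule B1[OF i], rule B2[OF j], rule tensor_refine[OF lin(1) _ _ _ _ _ _ U]) (assumption | rule finite_atLeastAtMost)+
  qed
  show "form2 K1 K2 U \<subseteq> form2 K1' K2' U"
    unfolding form2_def
  proof (intro span_minimal subspace_span subsetI)
    fix h assume "h \<in> (\<lambda>(i, j). \<lambda>(x, y). Ds K1 i x * Ds K2 j y) `
      {(i, j) \<in> {2..nspl K1} \<times> {2..nspl K2}. SD K1 i \<times> SD K2 j \<subseteq> U}"
    then obtain i j where h: "h = (\<lambda>(x, y). Ds K1 i x * Ds K2 j y)"
      and i: "2 \<le> i" "i \<le> nspl K1" and j: "2 \<le> j" "j \<le> nspl K2" and U: "SD K1 i \<times> SD K2 j \<subseteq> U" by auto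
    show "h \<in> span ((\<lambda>(i, j). \<lambda>(x, y). Ds K1' i x * Ds K2' j y) `
      {(i, j) \<in> {2..nspl K1'} \<times> {2..nspl K2'}. SD K1' i \<times> SD K2' j \<subseteq> U})"
      unfolding h by (rule D1[OF i], rule D2[OF j], rule tensor_refine[OF lin(1) _ _ _ _ _ _ U]) (assumption | rule finite_atLeastAtMost)+
  qed
  show "form1 K1 K2 U \<subseteq> form1 K1' K2' U"
    unfolding form1_def
  proof (intro span_minimal subspace_span Un_least subsetI)
    fix h :: "real \<times> real \<Rightarrow> real \<times> real"
    assume "h \<in> (\<lambda>(i, j). \<lambda>(x, y). (Ds K1 i x * Bs K2 j y, 0)) `
      {(i, j) \<in> {2..nspl K1} \<times> {2..nspl K2 - 1}. SD K1 i \<times> SB K2 j \<subseteq> U}"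
    then obtain i j where h: "h = (\<lambda>(x, y). (Ds K1 i x * Bs K2 j y, 0))"
      and i: "2 \<le> i" "i \<le> nspl K1" and j: "2 \<le> j" "j < nspl K2" and U: "SD K1 i \<times> SB K2 j \<subseteq> U" by auto
    have "h \<in> span ((\<lambda>(i, j). \<lambda>(x, y). (Ds K1' i x * Bs K2' j y, 0)) `
      {(i, j) \<in> {2..nspl K1'} \<times> {2..nspl K2' - 1}. SD K1' i \<times> SB K2' j \<subseteq> U})"
      unfolding h by (rule D1[OF i], rule B2[OF j], rule tensor_refine[OF lin(2) _ _ _ _ _ _ U]) (assumption | rule finite_atLeastAtMost)+
    then show "h \<in> span (
     (\<lambda>(i, j). \<lambda>(x, y). (Ds K1' i x * Bs K2' j y, 0)) `
       {(i, j) \<in> {2..nspl K1'} \<times> {2..nspl K2' - 1}. SD K1' i \<times> SB K2' j \<subseteq> U} \<union>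
     (\<lambda>(i, j). \<lambda>(x, y). (0, Bs K1' i x * Ds K2' j y)) `
       {(i, j) \<in> {2..nspl K1' - 1} \<times> {2..nspl K2'}. SB K1' i \<times> SD K2' j \<subseteq> U})"
      by (rule span_mono[THEN subsetD, rotated]) simp
  next
    fix h :: "real \<times> real \<Rightarrow> real \<times> real"
    assume "h \<in> (\<lambda>(i, j). \<lambda>(x, y). (0, Bs K1 i x * Ds K2 j y)) `
      {(i, j) \<in> {2..nspl K1 - 1} \<times> {2..nspl K2}. SB K1 i \<times> SD K2 j \<subseteq> U}"
    then obtain i j where h: "h = (\<lambda>(x, y). (0, Bs K1 i x * Ds K2 j y))"
      and i: "2 \<le> i" "i < nspl K1" and j: "2 \<le> j" "j \<le> nspl K2" and U: "SB K1 i \<times> SD K2 j \<subseteq> U" by auto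
    have "h \<in> span ((\<lambda>(i, j). \<lambda>(x, y). (0, Bs K1' i x * Ds K2' j y)) `
      {(i, j) \<in> {2..nspl K1' - 1} \<times> {2..nspl K2'}. SB K1' i \<times> SD K2' j \<subseteq> U})"
      unfolding h by (rule B1[OF i], rule D2[OF j], rule tensor_refine[OF lin(3) _ _ _ _ _ _ U]) (assumption | rule finite_atLeastAtMost)+
    then show "h \<in> span (
     (\<lambda>(i, j). \<lambda>(x, y). (Ds K1' i x * Bs K2' j y, 0)) `
       {(i, j) \<in> {2..nspl K1'} \<times> {2..nspl K2' - 1}. SD K1' i \<times> SB K2' j \<subseteq> U} \<union>
     (\<lambda>(i, j). \<lambda>(x, y). (0, Bs K1' i x * Ds K2' j y)) `
       {(i, j) \<in> {2..nspl K1' - 1} \<times> {2..nspl K2'}. SB K1' i \<times> SD K2' j \<subseteq> U})"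
      by (rule span_mono[THEN subsetD, rotated]) simp
  qed
qed

lemma image_pairs_eq:
  "{F b1 b2 I J | b1 b2 I J. (b1, I) \<in> (\<lambda>i. (f i, S i)) ` A \<and> (b2, J) \<in> (\<lambda>j. (g j, T j)) ` B}
    = (\<lambda>(i, j). F (f i) (g j) (S i) (T j)) ` (A \<times> B)" (is "?L = ?R")
proof
  show "?R \<subseteq> ?L"
  proof
    fix x assume "x \<in> ?R"
    then obtain i j where "i \<in> A" "j \<in> B" "x = F (f i) (g j) (S i) (T j)" by auto
    then show "x \<in> ?L" by blast
  qed
qed auto

lemma fst_image_filter:
  "fst ` {\<beta> \<in> (\<lambda>(i, j). (F i j, S i j)) ` A. supp \<beta> \<subseteq> U} = (\<lambda>(i, j). F i j) ` {(i, j) \<in> A. S i j \<subseteq> U}"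
  (is "?L = ?R")
proof
  show "?R \<subseteq> ?L"
  proof
    fix x assume "x \<in> ?R"
    then obtain i j where "(i, j) \<in> A" "S i j \<subseteq> U" "x = fst (F i j, S i j)" by auto
    then show "x \<in> ?L" by (intro image_eqI[where f = fst]) auto
  qed
qed auto

lemma span_basis:
  assumes K: "open_knot_vector K1" "open_knot_vector K2"
  shows "span (fst ` {\<beta> \<in> basis0 K1 K2. supp \<beta> \<subseteq> U}) = form0 K1 K2 U"
    "span (fst ` {\<beta> \<in> basis1 K1 K2. supp \<beta> \<subseteq> U}) = form1 K1 K2 U"
    "span (fst ` {\<beta> \<in> basis2 K1 K2. supp \<beta> \<subseteq> U}) = form2 K1 K2 U"
proof -
  note eqs = B_ring_eq[OF K(1)] B_ring_eq[OF K(2)] D_all_eq[OF K(1)] D_all_eq[OF K(2)]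
  have "basis0 K1 K2 = (\<lambda>(i, j). (\<lambda>(x, y). Bs K1 i x * Bs K2 j y, SB K1 i \<times> SB K2 j)) `
      ({2..nspl K1 - 1} \<times> {2..nspl K2 - 1})"
    unfolding basis0_def eqs by (rule image_pairs_eq)
  then show "span (fst ` {\<beta> \<in> basis0 K1 K2. supp \<beta> \<subseteq> U}) = form0 K1 K2 U"
    unfolding form0_def by (simp only: fst_image_filter)
  have "basis2 K1 K2 = (\<lambda>(i, j). (\<lambda>(x, y). Ds K1 i x * Ds K2 j y, SD K1 i \<times> SD K2 j)) `
      ({2..nspl K1} \<times> {2..nspl K2})"
    unfolding basis2_def eqs by (rule image_pairs_eq)
  then show "span (fst ` {\<beta> \<in> basis2 K1 K2. supp \<beta> \<subseteq> U}) = form2 K1 K2 U"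
    unfolding form2_def by (simp only: fst_image_filter)
  have "basis1 K1 K2 = (\<lambda>(i, j). (\<lambda>(x, y). (Ds K1 i x * Bs K2 j y, 0), SD K1 i \<times> SB K2 j)) `
      ({2..nspl K1} \<times> {2..nspl K2 - 1}) \<union>
    (\<lambda>(i, j). (\<lambda>(x, y). (0, Bs K1 i x * Ds K2 j y), SB K1 i \<times> SD K2 j)) `
      ({2..nspl K1 - 1} \<times> {2..nspl K2})"
    unfolding basis1_def eqs by (intro arg_cong2[of _ _ _ _ "(\<union>)"] image_pairs_eq)
  then show "span (fst ` {\<beta> \<in> basis1 K1 K2. supp \<beta> \<subseteq> U}) = form1 K1 K2 U"
    unfolding form1_def by (simp only: Un_iff conj_disj_distribR Collect_disj_eq image_Un fst_image_filter)
qed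

section \<open>Equality almost everywhere and integration\<close>

text \<open>Continuity from the closed upper right quadrant is what half-open knot spans give for
  tensor products, including those that jump across knot lines.\<close>

definition right_continuous :: "(real \<times> real \<Rightarrow> 'a :: topological_space) \<Rightarrow> bool" where
  "right_continuous h \<longleftrightarrow> (\<forall>x y. continuous (at (x, y) within {x..} \<times> {y..}) h)"

lemma right_continuous_comp:
  fixes f g :: "real \<Rightarrow> real"
  assumes "\<And>x. continuous (at_right x) f"
  shows "continuous (at (x, y) within {x..} \<times> {y..}) (\<lambda>z. f (fst z))"
    "continuous (at (x, y) within {x..} \<times> {y..}) (\<lambda>z. f (snd z))"
proof -
  have right: "continuous (at x within {x..}) f" for x
    using assms[of x] by (simp add: at_within_def continuous_def Diff_insert_absorb
      atLeast_Suc_greaterThan ivl_disj_un_singleton flip: ivl_disj_un_singleton)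
  have "continuous (at (x, y) within {x..} \<times> {y..}) (f \<circ> fst)"
    by (rule continuous_within_compose) (auto intro!: continuous_intros right)
  then show "continuous (at (x, y) within {x..} \<times> {y..}) (\<lambda>z. f (fst z))" by (simp add: comp_def)
  have "continuous (at (x, y) within {x..} \<times> {y..}) (f \<circ> snd)"
    by (rule continuous_within_compose) (auto intro!: continuous_intros right)
  then show "continuous (at (x, y) within {x..} \<times> {y..}) (\<lambda>z. f (snd z))" by (simp add: comp_def)
qed

lemma right_continuous_forms:
  assumes K: "open_knot_vector K1" "open_knot_vector K2"
  shows "v \<in> form1 K1 K2 U \<Longrightarrow> right_continuous v" "w \<in> form2 K1 K2 U \<Longrightarrow> right_continuous w"
proof -
  note rc = right_continuous_comp[OF Ds_right_continuous[OF K(1)]] right_continuous_comp[OF Ds_right_continuous[OF K(2)]]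
    right_continuous_comp[OF Bs_right_continuous[OF K(1)]] right_continuous_comp[OF Bs_right_continuous[OF K(2)]]
  show "right_continuous v" if "v \<in> form1 K1 K2 U"
    using that unfolding form1_iff right_continuous_def vector_form_def case_prod_beta'
    by (auto intro!: continuous_Pair continuous_sum continuous_mult continuous_const rc)
  show "right_continuous w" if "w \<in> form2 K1 K2 U"
    using that unfolding form2_iff right_continuous_def density_form_def case_prod_beta'
    by (auto intro!: continuous_sum continuous_mult continuous_const rc)
qed

text \<open>If the functions differ at a point of the half-open square, they differ on a small open
  set to its upper right, which is not a null set. Outside that square agreement is assumed; spline
  forms are 0 there.\<close>

lemma ae_eq_imp_eq:
  fixes h k :: "real \<times> real \<Rightarrow> 'a :: t2_space"
  assumes "right_continuous h" "right_continuous k"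
    and ae: "AE z in lborel. z \<in> Omega_hat \<longrightarrow> h z = k z"
    and out: "\<And>z. z \<notin> {0..<1} \<times> {0..<1} \<Longrightarrow> h z = k z"
  shows "h = k"
proof
  fix z :: "real \<times> real"
  obtain x y where z: "z = (x, y)" by force
  show "h z = k z"
  proof (rule ccontr)
    assume ne: "h z \<noteq> k z"
    then have xy: "0 \<le> x" "x < 1" "0 \<le> y" "y < 1" using out[of z] z by auto
    from ne obtain A B where AB: "open A" "open B" "h z \<in> A" "k z \<in> B" "A \<inter> B = {}"
      using hausdorff[OF ne] by auto
    have "(h \<longlongrightarrow> h z) (at z within {x..} \<times> {y..})" "(k \<longlongrightarrow> k z) (at z within {x..} \<times> {y..})"
      using assms(1,2) by (auto simp: right_continuous_def continuous_within z)
    from topological_tendstoD[OF this(1) AB(1,3)] topological_tendstoD[OF this(2) AB(2,4)]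
    have "\<forall>\<^sub>F u in at z within {x..} \<times> {y..}. h u \<noteq> k u"
      by eventually_elim (use AB(5) in auto)
    then obtain d where d: "d > 0" "\<And>u. u \<in> {x..} \<times> {y..} \<Longrightarrow> u \<noteq> z \<Longrightarrow> dist u z < d \<Longrightarrow> h u \<noteq> k u"
      unfolding eventually_at by blast
    let ?W = "ball z d \<inter> ({x<..<1} \<times> {y<..<1})"
    have "open ?W" by (intro open_Int open_ball open_Times open_greaterThanLessThan)
    moreover have "?W \<noteq> {}"
    proof -
      \<comment> \<open>Half the distances to the sides keep the shifted point inside the square;
        \<open>d / 3\<close> keeps it in the ball, as it moves by at most
        \<open>2 * e\<close>.\<close>
      define e where "e = min (d / 3) (min ((1 - x) / 2) ((1 - y) / 2))"
      have e: "0 < e" "e \<le> d / 3" "e < 1 - x" "e < 1 - y"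
        using d(1) xy by (auto simp: e_def min_less_iff_disj)
      have "dist (x + e, y + e) z \<le> dist (x + e) x + dist (y + e) y"
        using norm_Pair_le[of "x + e - x" "y + e - y"] by (simp add: dist_norm z)
      also have "\<dots> = 2 * e" using e by (simp add: dist_real_def)
      also have "\<dots> < d" using e by simp
      finally have "dist (x + e, y + e) z < d" .
      then have "(x + e, y + e) \<in> ?W" using e by (auto simp: dist_commute z)
      then show ?thesis by blast
    qed
    ultimately have "\<not> negligible ?W" by (rule open_not_negligible)
    moreover have "AE u in lborel. u \<notin> ?W"
      using ae
    proof eventually_elim
      case (elim u)
      have "h u \<noteq> k u" "u \<in> Omega_hat" if "u \<in> ?W"
        using that d(2)[of u] xy by (auto simp: dist_commute Omega_hat_def z)
      with elim show ?case by blast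
    qed
    then have "?W \<in> null_sets lborel"
      using \<open>open ?W\<close> by (subst AE_iff_null_sets) auto
    then have "negligible ?W"
      by (simp add: negligible_iff_null_sets null_sets_completionI)
    ultimately show False by simp
  qed
qed

lemma AE_off_grid:
  fixes X Y :: "real set"
  assumes "finite X" "finite Y"
  shows "AE z in lborel. fst z \<notin> X \<and> snd z \<notin> Y"
proof -
  have vertical: "{a} \<times> (UNIV :: real set) \<in> null_sets lborel" for a :: real
    unfolding lborel_prod[symmetric]
    by (auto simp: null_sets_def lborel.emeasure_pair_measure_Times)
  have horizontal: "(UNIV :: real set) \<times> {a} \<in> null_sets lborel" for a :: real
    unfolding lborel_prod[symmetric]
    by (auto simp: null_sets_def lborel.emeasure_pair_measure_Times)
  have "(\<Union>a\<in>X. {a} \<times> UNIV) \<union> (\<Union>a\<in>Y. UNIV \<times> {a}) \<in> null_sets lborel"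
    using assms by (intro null_sets.Un null_sets.finite_UN vertical horizontal)
  then show ?thesis
    by (rule AE_I') auto
qed

lemma grad_rel_imp_is_grad:
  assumes "grad_rel u v"
  shows "is_grad u v"
proof -
  from assms obtain X Y where XY: "finite X" "finite Y"
    "\<And>x y. x \<notin> X \<Longrightarrow> ((\<lambda>t. u (t, y)) has_real_derivative fst (v (x, y))) (at x)"
    "\<And>x y. y \<notin> Y \<Longrightarrow> ((\<lambda>t. u (x, t)) has_real_derivative snd (v (x, y))) (at y)"
    unfolding grad_rel_def dx_def dy_iff by blast
  show ?thesis
    unfolding is_grad_def using AE_off_grid[OF XY(1,2)]
    by eventually_elim (auto intro: XY(3,4))
qed

lemma curl_rel_imp_is_curl:
  assumes "curl_rel v w"
  shows "is_curl v w"
proof -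
  from assms obtain a b X Y where w: "w = (\<lambda>z. a z - b z)" and XY: "finite X" "finite Y"
    "\<And>x y. x \<notin> X \<Longrightarrow> ((\<lambda>t. snd (v (t, y))) has_real_derivative a (x, y)) (at x)"
    "\<And>x y. y \<notin> Y \<Longrightarrow> ((\<lambda>t. fst (v (x, t))) has_real_derivative b (x, y)) (at y)"
    unfolding curl_rel_def dx_def dy_iff by blast
  show ?thesis
    unfolding is_curl_def using AE_off_grid[OF XY(1,2)]
  proof eventually_elim
    case (elim z)
    then show ?case
      using XY(3)[of "fst z" "snd z"] XY(4)[of "snd z" "fst z"] w
      by (intro impI exI[of _ "a z"] exI[of _ "b z"]) simp
  qed
qed

lemma is_grad_unique_ae:
  assumes "is_grad u v" "is_grad u v'"
  shows "AE z in lborel. z \<in> Omega_hat \<longrightarrow> v z = v' z"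
  using assms unfolding is_grad_def
  by eventually_elim (auto simp: prod_eq_iff dest: DERIV_unique)

lemma is_curl_unique_ae:
  assumes "is_curl v w" "is_curl v w'"
  shows "AE z in lborel. z \<in> Omega_hat \<longrightarrow> w z = w' z"
  using assms unfolding is_curl_def
  by eventually_elim (metis DERIV_unique)

text \<open>Nonnegativity lets Tonelli's theorem reduce the claim to the univariate normalisation,
  and it gives integrability at the same time.\<close>

lemma has_bochner_integral_density:
  assumes K: "open_knot_vector K1" "open_knot_vector K2" and ij: "i \<in> {2..nspl K1}" "j \<in> {2..nspl K2}"
  shows "has_bochner_integral lborel (\<lambda>z. indicator Omega_hat z *\<^sub>R (Ds K1 i (fst z) * Ds K2 j (snd z))) 1"
proof -
  define f where "f K i x = indicator {0<..<1} x * Ds K i x" for K i and x :: real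
  have meas [measurable]: "f K1 i \<in> borel_measurable borel" "f K2 j \<in> borel_measurable borel"
    unfolding f_def using Ds_measurable[OF K(1)] Ds_measurable[OF K(2)] by measurable
  have nonneg: "0 \<le> f K1 i x" "0 \<le> f K2 j x" for x
    using Ds_nonneg[OF K(1)] Ds_nonneg[OF K(2)] by (auto simp: f_def)
  have nn: "(\<integral>\<^sup>+x. ennreal (f K i x) \<partial>lborel) = 1" if K: "open_knot_vector K" and i: "i \<in> {2..nspl K}" for K i
  proof -
    have "(Ds K i has_integral 1) {0<..<1}"
      using Ds_has_integral[OF K i] by (simp add: has_integral_Icc_iff_Ioo)
    then have "((\<lambda>x. if x \<in> {0<..<1} then Ds K i x else 0) has_integral 1) UNIV"
      by (simp only: has_integral_restrict_UNIV)
    also have "(\<lambda>x. if x \<in> {0<..<1} then Ds K i x else 0) = f K i"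
      by (auto simp: f_def fun_eq_iff)
    finally have "(f K i has_integral 1) UNIV" .
    moreover have "f K i \<in> borel_measurable borel"
      unfolding f_def using Ds_measurable[OF K] by measurable
    moreover have "0 \<le> f K i x" for x
      using Ds_nonneg[OF K] by (simp add: f_def)
    ultimately have "(\<integral>\<^sup>+x. ennreal (f K i x) \<partial>lborel) = ennreal 1"
      by (intro nn_integral_has_integral_lborel)
    then show ?thesis by simp
  qed
  have eq: "indicator Omega_hat z *\<^sub>R (Ds K1 i (fst z) * Ds K2 j (snd z)) = f K1 i (fst z) * f K2 j (snd z)" for z
    by (cases z) (auto simp: f_def Omega_hat_def indicator_def)
  have "(\<integral>\<^sup>+z. ennreal (f K1 i (fst z) * f K2 j (snd z)) \<partial>(lborel \<Otimes>\<^sub>M lborel))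
      = (\<integral>\<^sup>+x. \<integral>\<^sup>+y. ennreal (f K1 i x * f K2 j y) \<partial>lborel \<partial>lborel)"
    by (subst lborel.nn_integral_fst[symmetric]) auto
  also have "\<dots> = (\<integral>\<^sup>+x. ennreal (f K1 i x) * (\<integral>\<^sup>+y. ennreal (f K2 j y) \<partial>lborel) \<partial>lborel)"
    using nonneg by (simp add: ennreal_mult nn_integral_cmult)
  also have "\<dots> = 1"
    using nn[OF K(1) ij(1)] nn[OF K(2) ij(2)] by simp
  finally have "(\<integral>\<^sup>+z. ennreal (f K1 i (fst z) * f K2 j (snd z)) \<partial>lborel) = ennreal 1"
    by (simp add: lborel_prod)
  moreover have "(\<lambda>z. f K1 i (fst z) * f K2 j (snd z)) \<in> borel_measurable lborel"
    unfolding lborel_prod[symmetric] by measurable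
  ultimately show ?thesis
    unfolding eq using nonneg by (intro has_bochner_integral_nn_integral) auto
qed

lemma density_form_integral:
  assumes K: "open_knot_vector K1" "open_knot_vector K2"
  shows "set_integrable lborel Omega_hat (density_form K1 K2 c)"
    "(LINT z:Omega_hat|lborel. density_form K1 K2 c z) = (\<Sum>i=2..nspl K1. \<Sum>j=2..nspl K2. c i j)"
proof -
  have "has_bochner_integral lborel
     (\<lambda>z. \<Sum>i=2..nspl K1. \<Sum>j=2..nspl K2. c i j * (indicator Omega_hat z *\<^sub>R (Ds K1 i (fst z) * Ds K2 j (snd z))))
     (\<Sum>i=2..nspl K1. \<Sum>j=2..nspl K2. c i j * 1)"
    by (intro has_bochner_integral_sum has_bochner_integral_mult_right has_bochner_integral_density[OF K])
  moreover have "(\<Sum>i=2..nspl K1. \<Sum>j=2..nspl K2. c i j * (indicator Omega_hat z *\<^sub>R (Ds K1 i (fst z) * Ds K2 j (snd z))))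
     = indicator Omega_hat z *\<^sub>R density_form K1 K2 c z" for z
    by (simp add: density_form_def case_prod_beta sum_distrib_left mult.left_commute)
  ultimately have "has_bochner_integral lborel (\<lambda>z. indicator Omega_hat z *\<^sub>R density_form K1 K2 c z)
     (\<Sum>i=2..nspl K1. \<Sum>j=2..nspl K2. c i j)"
    by simp
  then show "set_integrable lborel Omega_hat (density_form K1 K2 c)"
    "(LINT z:Omega_hat|lborel. density_form K1 K2 c z) = (\<Sum>i=2..nspl K1. \<Sum>j=2..nspl K2. c i j)"
    by (auto simp: set_integrable_def set_lebesgue_integral_def has_bochner_integral_iff)
qed

section \<open>Connectivity of the cells of a subdomain\<close>

text \<open>The intervals starting at or before \<open>\<alpha>\<close> and those ending at or after
  \<open>\<beta>\<close> have closed unions that together cover a connected interval, so the two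
  unions share a point \<open>t\<close> of it.\<close>

lemma interval_cover_meet:
  fixes l r :: "'k \<Rightarrow> real"
  assumes "finite \<K>" "\<alpha> < \<beta>" and cover: "{\<alpha><..<\<beta>} \<subseteq> (\<Union>k\<in>\<K>. {l k..r k})"
    and long: "\<And>k. k \<in> \<K> \<Longrightarrow> l k \<le> \<alpha> \<or> \<beta> \<le> r k"
  shows "\<exists>k\<in>\<K>. \<exists>k'\<in>\<K>. \<exists>t. l k \<le> \<alpha> \<and> \<beta> \<le> r k' \<and> t \<in> {l k..r k} \<and> t \<in> {l k'..r k'}"
proof -
  have "closed (\<Union>k\<in>\<K>. {l k..r k})"
    using assms(1) by (intro closed_UN) auto
  then have cover': "{\<alpha>..\<beta>} \<subseteq> (\<Union>k\<in>\<K>. {l k..r k})"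
    using closure_minimal[OF cover] \<open>\<alpha> < \<beta>\<close> by simp
  let ?U = "\<Union>k\<in>{k \<in> \<K>. l k \<le> \<alpha>}. {l k..r k}" and ?V = "\<Union>k\<in>{k \<in> \<K>. \<beta> \<le> r k}. {l k..r k}"
  have "closed ?U" "closed ?V"
    using assms(1) by (intro closed_UN; simp)+
  moreover have "{\<alpha>..\<beta>} \<subseteq> ?U \<union> ?V"
  proof
    fix x assume "x \<in> {\<alpha>..\<beta>}"
    then obtain k where "k \<in> \<K>" "x \<in> {l k..r k}" using cover' by blast
    then show "x \<in> ?U \<union> ?V" using long[of k] by blast
  qed
  moreover have "?U \<inter> {\<alpha>..\<beta>} \<noteq> {}"
  proof -
    have "\<alpha> \<in> {\<alpha>..\<beta>}" using \<open>\<alpha> < \<beta>\<close> by simp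
    then obtain k where "k \<in> \<K>" "\<alpha> \<in> {l k..r k}" using cover' by blast
    then have "\<alpha> \<in> ?U" by auto
    then show ?thesis using \<open>\<alpha> \<in> {\<alpha>..\<beta>}\<close> by blast
  qed
  moreover have "?V \<inter> {\<alpha>..\<beta>} \<noteq> {}"
  proof -
    have "\<beta> \<in> {\<alpha>..\<beta>}" using \<open>\<alpha> < \<beta>\<close> by simp
    then obtain k where "k \<in> \<K>" "\<beta> \<in> {l k..r k}" using cover' by blast
    then have "\<beta> \<in> ?V" by auto
    then show ?thesis using \<open>\<beta> \<in> {\<alpha>..\<beta>}\<close> by blast
  qed
  ultimately have "?U \<inter> ?V \<inter> {\<alpha>..\<beta>} \<noteq> {}"
    using connected_closedD[OF connected_Icc[of \<alpha> \<beta>], of ?U ?V] by blast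
  then show ?thesis by blast
qed

text \<open>The supports of normalised B-splines without the splines: cells may overlap, and only
  the order of their sides is prescribed. A block reaches from the lower left corner of the cell
  \<open>(i, j)\<close> to the upper right corner of \<open>(i + 1, j + 1)\<close>, like the support
  of a scalar basis function.\<close>

locale cell_cover =
  fixes a b c d :: "nat \<Rightarrow> real" and m n :: nat and M :: "(real \<times> real) set"
  assumes mono: "mono a" "mono b" "mono c" "mono d"
    and nondegenerate: "\<And>i. i \<in> {2..m} \<Longrightarrow> a i < b i" "\<And>j. j \<in> {2..n} \<Longrightarrow> c j < d j"
    and cover: "M = (\<Union>(i, j)\<in>{(i, j) \<in> {2..m} \<times> {2..n}. {a i..b i} \<times> {c j..d j} \<subseteq> M}. {a i..b i} \<times> {c j..d j})"
    and connected_block: "\<And>i j. \<lbrakk>i \<in> {2..<m}; j \<in> {2..<n}\<rbrakk> \<Longrightarrow>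
      connected ({a i<..<b (i + 1)} \<times> {c j<..<d (j + 1)} - M)"
begin

definition cell :: "nat \<Rightarrow> nat \<Rightarrow> (real \<times> real) set" where
  "cell i j = {a i..b i} \<times> {c j..d j}"

definition cells :: "(nat \<times> nat) set" where
  "cells = {(i, j) \<in> {2..m} \<times> {2..n}. cell i j \<subseteq> M}"

text \<open>The set \<open>S\<close> confines paths to an index box; this later ensures that a cell
  found on the way, in a prescribed row or column, still lies between the ends of the path.\<close>

definition adjacent :: "(nat \<times> nat) set \<Rightarrow> ((nat \<times> nat) \<times> (nat \<times> nat)) set" where
  "adjacent S = {((i, j), (i', j')). (i, j) \<in> cells \<inter> S \<and> (i', j') \<in> cells \<inter> S \<and>
     (j = j' \<and> (i' = i + 1 \<or> i = i' + 1) \<or> i = i' \<and> (j' = j + 1 \<or> j = j' + 1))}"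

lemma M_eq: "M = (\<Union>(i, j)\<in>cells. cell i j)"
  using cover by (simp add: cells_def cell_def)

lemma finite_cells: "finite cells"
  by (rule finite_subset[of _ "{2..m} \<times> {2..n}"]) (auto simp: cells_def)

lemma closed_M: "closed M"
  by (subst M_eq) (auto simp: cell_def intro!: closed_UN finite_cells closed_Times)

lemma mono_le: "i \<le> j \<Longrightarrow> a i \<le> a j \<and> b i \<le> b j \<and> c i \<le> c j \<and> d i \<le> d j"
  using mono by (auto dest: monoD)

lemma not_cell:
  assumes "i \<in> {2..m}" "j \<in> {2..n}" "(i, j) \<notin> cells"
  obtains z where "z \<in> {a i<..<b i} \<times> {c j<..<d j}" "z \<notin> M"
proof -
  have "\<not> {a i<..<b i} \<times> {c j<..<d j} \<subseteq> M"
  proof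
    assume "{a i<..<b i} \<times> {c j<..<d j} \<subseteq> M"
    then have "closure ({a i<..<b i} \<times> {c j<..<d j}) \<subseteq> M"
      using closed_M by (rule closure_minimal)
    then have "cell i j \<subseteq> M"
      using nondegenerate assms by (simp add: closure_Times cell_def)
    then show False using assms by (simp add: cells_def)
  qed
  with that show ?thesis by blast
qed

lemma sym_adjacent: "sym (adjacent S)"
  by (auto simp: sym_def adjacent_def)

lemma adjacent_mono: "S \<subseteq> S' \<Longrightarrow> (adjacent S)\<^sup>* \<subseteq> (adjacent S')\<^sup>*"
  by (rule rtrancl_mono) (auto simp: adjacent_def)

text \<open>If two cells meet, and neither neighbour of the first in the direction of the second is a cell,
  then their union separates a block.\<close>

lemma step_up:
  assumes "(i, j) \<in> cells" "(i2, j2) \<in> cells" "i < i2" "j < j2" "a i2 \<le> b i" "c j2 \<le> d j"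
  shows "(i + 1, j) \<in> cells \<or> (i, j + 1) \<in> cells"
proof (rule ccontr)
  assume neg: "\<not> ((i + 1, j) \<in> cells \<or> (i, j + 1) \<in> cells)"
  have ij: "i \<in> {2..<m}" "j \<in> {2..<n}" using assms by (auto simp: cells_def)
  have in_M: "cell i j \<subseteq> M" "cell i2 j2 \<subseteq> M" using assms by (auto simp: cells_def)
  \<comment> \<open>The two absent neighbours supply points of the block off \<open>M\<close>, on
    either side of the strip between the abscissae \<open>a i2\<close> and
    \<open>b i\<close>.\<close>
  obtain u where u: "u \<in> {a i<..<b i} \<times> {c (j + 1)<..<d (j + 1)}" "u \<notin> M"
    using not_cell[of i "j + 1"] ij neg by auto
  obtain v where v: "v \<in> {a (i + 1)<..<b (i + 1)} \<times> {c j<..<d j}" "v \<notin> M"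
    using not_cell[of "i + 1" j] ij neg by auto
  let ?C = "{a i<..<b (i + 1)} \<times> {c j<..<d (j + 1)} - M"
  have le: "b (i + 1) \<le> b i2" "d (j + 1) \<le> d j2" "a i \<le> a (i + 1)" "b i \<le> b (i + 1)"
    "c j \<le> c (j + 1)" "d j \<le> d (j + 1)"
    using mono_le[of "i + 1" i2] mono_le[of "j + 1" j2] mono_le[of i "i + 1"] mono_le[of j "j + 1"] assms by auto
  \<comment> \<open>Within the block this closed strip is covered: by the cell \<open>(i, j)\<close>
    up to height \<open>d j\<close>, and above that by \<open>(i2, j2)\<close>, which starts no
    higher than \<open>d j\<close>.\<close>
  have split: "fst z < a i2 \<or> b i < fst z" if "z \<in> ?C" for z
  proof (rule ccontr)
    assume "\<not> ?thesis"
    then have "z \<in> cell i j \<union> cell i2 j2"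
      using that assms le by (cases "snd z \<le> d j") (auto simp: cell_def)
    then show False using that in_M by blast
  qed
  have uv: "u \<in> ?C" "v \<in> ?C" using u v le by auto
  have "fst u < a i2" using split[OF uv(1)] u by auto
  have "b i < fst v"
  proof (rule ccontr)
    assume "\<not> b i < fst v"
    then have "v \<in> cell i j" using v le by (auto simp: cell_def)
    then show False using in_M v by blast
  qed
  have conn: "connected (fst ` ?C)"
    using connected_block[OF ij] by (intro connected_continuous_image continuous_intros)
  \<comment> \<open>The projection of a connected set is an interval and cannot skip the
    strip.\<close>
  have "a i2 \<in> fst ` ?C"
    by (rule connectedD_interval[OF conn imageI[OF uv(1)] imageI[OF uv(2)]])
      (use \<open>fst u < a i2\<close> \<open>b i < fst v\<close> assms(5) in auto)
  then obtain z where "z \<in> ?C" "fst z = a i2" by auto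
  then show False using split[of z] assms(5) by simp
qed

lemma step_down:
  assumes "(i, j) \<in> cells" "(i2, j2) \<in> cells" "i < i2" "j2 < j" "a i2 \<le> b i" "c j \<le> d j2"
  shows "(i + 1, j) \<in> cells \<or> (i, j - 1) \<in> cells"
proof (rule ccontr)
  assume neg: "\<not> ((i + 1, j) \<in> cells \<or> (i, j - 1) \<in> cells)"
  have ij: "i \<in> {2..<m}" "j - 1 \<in> {2..<n}" "j - 1 + 1 = j" using assms by (auto simp: cells_def)
  have in_M: "cell i j \<subseteq> M" "cell i2 j2 \<subseteq> M" using assms by (auto simp: cells_def)
  obtain u where u: "u \<in> {a i<..<b i} \<times> {c (j - 1)<..<d (j - 1)}" "u \<notin> M"
    using not_cell[of i "j - 1"] ij neg by auto
  obtain v where v: "v \<in> {a (i + 1)<..<b (i + 1)} \<times> {c j<..<d j}" "v \<notin> M"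
    using not_cell[of "i + 1" j] ij neg by auto
  let ?C = "{a i<..<b (i + 1)} \<times> {c (j - 1)<..<d j} - M"
  have le: "b (i + 1) \<le> b i2" "c j2 \<le> c (j - 1)" "a i \<le> a (i + 1)" "b i \<le> b (i + 1)"
    "c (j - 1) \<le> c j" "d (j - 1) \<le> d j"
    using mono_le[of "i + 1" i2] mono_le[of j2 "j - 1"] mono_le[of i "i + 1"] mono_le[of "j - 1" j] assms by auto
  have split: "fst z < a i2 \<or> b i < fst z" if "z \<in> ?C" for z
  proof (rule ccontr)
    assume "\<not> ?thesis"
    then have "z \<in> cell i j \<union> cell i2 j2"
      using that assms le by (cases "c j \<le> snd z") (auto simp: cell_def)
    then show False using that in_M by blast
  qed
  have uv: "u \<in> ?C" "v \<in> ?C" using u v le by auto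
  have "fst u < a i2" using split[OF uv(1)] u by auto
  have "b i < fst v"
  proof (rule ccontr)
    assume "\<not> b i < fst v"
    then have "v \<in> cell i j" using v le by (auto simp: cell_def)
    then show False using in_M v by blast
  qed
  have conn: "connected (fst ` ?C)"
    using connected_block[OF ij(1,2)] unfolding ij(3)
    by (intro connected_continuous_image continuous_intros)
  have "a i2 \<in> fst ` ?C"
    by (rule connectedD_interval[OF conn imageI[OF uv(1)] imageI[OF uv(2)]])
      (use \<open>fst u < a i2\<close> \<open>b i < fst v\<close> assms(5) in auto)
  then obtain z where "z \<in> ?C" "fst z = a i2" by auto
  then show False using split[of z] assms(5) by simp
qed

text \<open>Induction on the index distance. If one index already agrees, the next cell lies in the
  union of the two given ones, hence in \<open>M\<close>. Otherwise \<open>step_up\<close> supplies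
  a neighbour nearer to the target, and monotonicity of the sides preserves the inequalities
  assumed.\<close>

lemma path_up:
  assumes "(i, j) \<in> cells" "(i2, j2) \<in> cells" "i \<le> i2" "j \<le> j2" "a i2 \<le> b i" "c j2 \<le> d j"
  shows "((i, j), (i2, j2)) \<in> (adjacent ({i..i2} \<times> {j..j2}))\<^sup>*"
  using assms
proof (induction "(i2 - i) + (j2 - j)" arbitrary: i j rule: less_induct)
  case less
  have in_M: "cell i j \<subseteq> M" "cell i2 j2 \<subseteq> M" and range: "i \<in> {2..m}" "j \<in> {2..n}" "i2 \<in> {2..m}" "j2 \<in> {2..n}"
    using less.prems by (auto simp: cells_def)
  consider "i = i2" "j = j2" | "i < i2" "(i + 1, j) \<in> cells" | "j < j2" "(i, j + 1) \<in> cells"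
  proof -
    have "(i + 1, j) \<in> cells" if "i < i2" "j = j2"
    proof -
      have "cell (i + 1) j \<subseteq> cell i j \<union> cell i2 j2"
        using mono_le[of i "i + 1"] mono_le[of "i + 1" i2] less.prems(5) that by (auto simp: cell_def)
      then show ?thesis using in_M range that by (auto simp: cells_def)
    qed
    moreover have "(i, j + 1) \<in> cells" if "i = i2" "j < j2"
    proof -
      have "cell i (j + 1) \<subseteq> cell i j \<union> cell i2 j2"
        using mono_le[of j "j + 1"] mono_le[of "j + 1" j2] less.prems(6) that by (auto simp: cell_def)
      then show ?thesis using in_M range that by (auto simp: cells_def)
    qed
    ultimately show ?thesis
      using that step_up[OF less.prems(1,2)] less.prems(3-6) by (cases "i = i2"; cases "j = j2") auto
  qed
  then show ?case
  proof cases
    case 1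
    then show ?thesis by simp
  next
    case 2
    then have "((i + 1, j), (i2, j2)) \<in> (adjacent ({i + 1..i2} \<times> {j..j2}))\<^sup>*"
      using less.prems mono_le[of i "i + 1"] by (intro less.hyps) auto
    also have "\<dots> \<subseteq> (adjacent ({i..i2} \<times> {j..j2}))\<^sup>*"
      by (rule adjacent_mono) auto
    finally show ?thesis
      using 2 less.prems by (intro converse_rtrancl_into_rtrancl[of "(i, j)" "(i + 1, j)"]) (auto simp: adjacent_def)
  next
    case 3
    then have "((i, j + 1), (i2, j2)) \<in> (adjacent ({i..i2} \<times> {j + 1..j2}))\<^sup>*"
      using less.prems mono_le[of j "j + 1"] by (intro less.hyps) auto
    also have "\<dots> \<subseteq> (adjacent ({i..i2} \<times> {j..j2}))\<^sup>*"
      by (rule adjacent_mono) auto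
    finally show ?thesis
      using 3 less.prems by (intro converse_rtrancl_into_rtrancl[of "(i, j)" "(i, j + 1)"]) (auto simp: adjacent_def)
  qed
qed

lemma path_down:
  assumes "(i, j) \<in> cells" "(i2, j2) \<in> cells" "i \<le> i2" "j2 \<le> j" "a i2 \<le> b i" "c j \<le> d j2"
  shows "((i, j), (i2, j2)) \<in> (adjacent ({i..i2} \<times> {j2..j}))\<^sup>*"
  using assms
proof (induction "(i2 - i) + (j - j2)" arbitrary: i j rule: less_induct)
  case less
  have in_M: "cell i j \<subseteq> M" "cell i2 j2 \<subseteq> M" and range: "i \<in> {2..m}" "j \<in> {2..n}" "i2 \<in> {2..m}" "j2 \<in> {2..n}"
    using less.prems by (auto simp: cells_def)
  consider "i = i2" "j = j2" | "i < i2" "(i + 1, j) \<in> cells" | "j2 < j" "(i, j - 1) \<in> cells"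
  proof -
    have "(i + 1, j) \<in> cells" if "i < i2" "j = j2"
    proof -
      have "cell (i + 1) j \<subseteq> cell i j \<union> cell i2 j2"
        using mono_le[of i "i + 1"] mono_le[of "i + 1" i2] less.prems(5) that by (auto simp: cell_def)
      then show ?thesis using in_M range that by (auto simp: cells_def)
    qed
    moreover have "(i, j - 1) \<in> cells" if "i = i2" "j2 < j"
    proof -
      have "cell i (j - 1) \<subseteq> cell i j \<union> cell i2 j2"
      proof -
        have "j2 \<le> j - 1" using that by simp
        then show ?thesis
          using mono_le[of "j - 1" j] mono_le[of j2 "j - 1"] less.prems(6) that by (auto simp: cell_def)
      qed
      then show ?thesis using in_M range that by (auto simp: cells_def)
    qed
    ultimately show ?thesis
      using that step_down[OF less.prems(1,2)] less.prems(3-6) by (cases "i = i2"; cases "j = j2") auto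
  qed
  then show ?case
  proof cases
    case 1
    then show ?thesis by simp
  next
    case 2
    then have "((i + 1, j), (i2, j2)) \<in> (adjacent ({i + 1..i2} \<times> {j2..j}))\<^sup>*"
      using less.prems mono_le[of i "i + 1"] by (intro less.hyps) auto
    also have "\<dots> \<subseteq> (adjacent ({i..i2} \<times> {j2..j}))\<^sup>*"
      by (rule adjacent_mono) auto
    finally show ?thesis
      using 2 less.prems by (intro converse_rtrancl_into_rtrancl[of "(i, j)" "(i + 1, j)"]) (auto simp: adjacent_def)
  next
    case 3
    then have "((i, j - 1), (i2, j2)) \<in> (adjacent ({i..i2} \<times> {j2..j - 1}))\<^sup>*"
      using less.prems mono_le[of "j - 1" j] by (intro less.hyps) auto
    also have "\<dots> \<subseteq> (adjacent ({i..i2} \<times> {j2..j}))\<^sup>*"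
      by (rule adjacent_mono) auto
    finally show ?thesis
      using 3 less.prems by (intro converse_rtrancl_into_rtrancl[of "(i, j)" "(i, j - 1)"]) (auto simp: adjacent_def)
  qed
qed

lemma path_between:
  assumes P: "(i, j) \<in> cells" "(i2, j2) \<in> cells" and meet: "cell i j \<inter> cell i2 j2 \<noteq> {}"
  shows "((i, j), (i2, j2)) \<in> (adjacent ({min i i2..max i i2} \<times> {min j j2..max j j2}))\<^sup>*"
proof -
  from meet obtain x y where "(x, y) \<in> cell i j" "(x, y) \<in> cell i2 j2" by auto
  then have le: "a i2 \<le> b i" "a i \<le> b i2" "c j2 \<le> d j" "c j \<le> d j2"
    by (auto simp: cell_def)
  have path_sym: "(q, p) \<in> (adjacent S)\<^sup>*" if "(p, q) \<in> (adjacent S)\<^sup>*" for p q S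
    using symD[OF sym_rtrancl[OF sym_adjacent]] that by blast
  show ?thesis
  proof (cases "i \<le> i2"; cases "j \<le> j2")
    assume "i \<le> i2" "j \<le> j2"
    then show ?thesis using path_up[OF P] le by (simp add: min_def max_def)
  next
    assume "i \<le> i2" "\<not> j \<le> j2"
    then show ?thesis using path_down[OF P] le by (simp add: min_def max_def)
  next
    assume "\<not> i \<le> i2" "j \<le> j2"
    then have "((i2, j2), (i, j)) \<in> (adjacent ({i2..i} \<times> {j..j2}))\<^sup>*"
      using path_down[OF P(2,1)] le by auto
    from path_sym[OF this] show ?thesis
      using \<open>\<not> i \<le> i2\<close> \<open>j \<le> j2\<close> by (simp add: min_def max_def)
  next
    assume "\<not> i \<le> i2" "\<not> j \<le> j2"
    then have "((i2, j2), (i, j)) \<in> (adjacent ({i2..i} \<times> {j2..j}))\<^sup>*"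
      using path_up[OF P(2,1)] le by auto
    from path_sym[OF this] show ?thesis
      using \<open>\<not> i \<le> i2\<close> \<open>\<not> j \<le> j2\<close> by (simp add: min_def max_def)
  qed
qed

text \<open>A discrete intermediate value property: one step changes each index by at most
  1.\<close>

lemma path_meets:
  assumes "(p, q) \<in> (adjacent S)\<^sup>*" "p \<in> cells \<inter> S"
  shows "k \<in> {min (fst p) (fst q)..max (fst p) (fst q)} \<Longrightarrow> \<exists>l. (k, l) \<in> cells \<inter> S"
    "k \<in> {min (snd p) (snd q)..max (snd p) (snd q)} \<Longrightarrow> \<exists>l. (l, k) \<in> cells \<inter> S"
proof -
  have "(\<forall>k\<in>{min (fst p) (fst q)..max (fst p) (fst q)}. \<exists>l. (k, l) \<in> cells \<inter> S) \<and>
    (\<forall>k\<in>{min (snd p) (snd q)..max (snd p) (snd q)}. \<exists>l. (l, k) \<in> cells \<inter> S)"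
    using assms(1)
  proof (induction rule: rtrancl_induct)
    case base
    show ?case using assms(2) by (cases p) auto
  next
    case (step q r)
    obtain i j i' j' where qr: "q = (i, j)" "r = (i', j')" by force
    from step(2) have r: "(i', j') \<in> cells \<inter> S"
      and adj: "j = j' \<and> (i' = i + 1 \<or> i = i' + 1) \<or> i = i' \<and> (j' = j + 1 \<or> j = j' + 1)"
      by (auto simp: adjacent_def qr)
    have "\<exists>l. (k, l) \<in> cells \<inter> S" if "k \<in> {min (fst p) (fst r)..max (fst p) (fst r)}" for k
    proof (cases "k = i'")
      case False
      then have "k \<in> {min (fst p) (fst q)..max (fst p) (fst q)}"
        using that adj by (auto simp: qr min_def max_def split: if_splits)
      then show ?thesis using step.IH by blast
    qed (use r in blast)
    moreover have "\<exists>l. (l, k) \<in> cells \<inter> S" if "k \<in> {min (snd p) (snd r)..max (snd p) (snd r)}" for k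
    proof (cases "k = j'")
      case False
      then have "k \<in> {min (snd p) (snd q)..max (snd p) (snd q)}"
        using that adj by (auto simp: qr min_def max_def split: if_splits)
      then show ?thesis using step.IH by blast
    qed (use r in blast)
    ultimately show ?case by blast
  qed
  then show "k \<in> {min (fst p) (fst q)..max (fst p) (fst q)} \<Longrightarrow> \<exists>l. (k, l) \<in> cells \<inter> S"
    "k \<in> {min (snd p) (snd q)..max (snd p) (snd q)} \<Longrightarrow> \<exists>l. (l, k) \<in> cells \<inter> S"
    by blast+
qed

text \<open>A rectangle that fits into some cell-sized rectangle, and lies in the subdomain, lies in one cell
  of the subdomain: a path of cells joins a cell reaching its one side to a cell reaching the opposite
  side, and on the way some cell reaches both.\<close>

lemma rectangle_in_cell:
  assumes rect: "\<alpha> < \<beta>" "\<gamma> < \<delta>" "{\<alpha><..<\<beta>} \<times> {\<gamma><..<\<delta>} \<subseteq> M"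
    and fit: "a i0 \<le> \<alpha>" "\<beta> \<le> b i0" "c j0 \<le> \<gamma>" "\<delta> \<le> d j0"
  obtains i j where "(i, j) \<in> cells" "{\<alpha><..<\<beta>} \<times> {\<gamma><..<\<delta>} \<subseteq> cell i j"
proof -
  \<comment> \<open>A cell with index at most \<open>i0\<close> starts at or before
    \<open>\<alpha>\<close>, one with index at least \<open>i0\<close> ends at or after
    \<open>\<beta>\<close>; likewise for \<open>j0\<close>.\<close>
  have anchored: "a i \<le> \<alpha> \<or> \<beta> \<le> b i" "c j \<le> \<gamma> \<or> \<delta> \<le> d j" for i j
    using mono_le[of i i0] mono_le[of i0 i] mono_le[of j j0] mono_le[of j0 j] fit by linarith+
  \<comment> \<open>Over a fixed abscissa one cell contains the whole vertical segment. The
    horizontal direction is then treated in the same way, with these tall cells alone.\<close>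
  have column: "\<exists>i j. (i, j) \<in> cells \<and> x \<in> {a i..b i} \<and> c j \<le> \<gamma> \<and> \<delta> \<le> d j" if x: "x \<in> {\<alpha><..<\<beta>}" for x
  proof -
    let ?\<K> = "{p \<in> cells. x \<in> {a (fst p)..b (fst p)}}"
    have fin: "finite ?\<K>" using finite_cells by (rule rev_finite_subset) auto
    have "{\<gamma><..<\<delta>} \<subseteq> (\<Union>p\<in>?\<K>. {c (snd p)..d (snd p)})"
    proof
      fix y assume "y \<in> {\<gamma><..<\<delta>}"
      then have "(x, y) \<in> M" using x rect(3) by blast
      then obtain i j where "(i, j) \<in> cells" "(x, y) \<in> cell i j" by (subst (asm) M_eq) blast
      then show "y \<in> (\<Union>p\<in>?\<K>. {c (snd p)..d (snd p)})"
        by (intro UN_I[of "(i, j)"]) (auto simp: cell_def)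
    qed
    from interval_cover_meet[OF fin rect(2) this anchored(2)]
    obtain p q t where pq: "p \<in> ?\<K>" "q \<in> ?\<K>" "c (snd p) \<le> \<gamma>" "\<delta> \<le> d (snd q)"
      "t \<in> {c (snd p)..d (snd p)}" "t \<in> {c (snd q)..d (snd q)}"
      by blast
    show ?thesis
    proof (cases "c (snd q) \<le> \<gamma> \<or> \<delta> \<le> d (snd p)")
      case True
      then show ?thesis using pq by (metis (no_types, lifting) mem_Collect_eq prod.collapse)
    next
      case False
      have "snd p \<le> j0" using False fit mono_le[of j0 "snd p"] by linarith
      moreover have "j0 \<le> snd q" using False fit mono_le[of "snd q" j0] by linarith
      ultimately have j0: "j0 \<in> {min (snd p) (snd q)..max (snd p) (snd q)}" by auto
      have "(x, t) \<in> cell (fst p) (snd p) \<inter> cell (fst q) (snd q)"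
        using pq by (auto simp: cell_def)
      then have "(p, q) \<in> (adjacent ({min (fst p) (fst q)..max (fst p) (fst q)} \<times> {min (snd p) (snd q)..max (snd p) (snd q)}))\<^sup>*"
        using path_between[of "fst p" "snd p" "fst q" "snd q"] pq by auto
      from path_meets(2)[OF this _ j0] pq(1)
      obtain l where l: "(l, j0) \<in> cells" "l \<in> {min (fst p) (fst q)..max (fst p) (fst q)}"
        by (cases p) auto
      \<comment> \<open>Both end cells lie over \<open>x\<close>, and by monotonicity so does every
        cell whose first index is between theirs; row \<open>j0\<close> makes the cell tall
        enough.\<close>
      then have "x \<in> {a l..b l}"
        using pq mono_le[of "fst p" l] mono_le[of "fst q" l] mono_le[of l "fst p"] mono_le[of l "fst q"]
        by (auto simp: min_def max_def split: if_splits)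
      then show ?thesis using l fit by blast
    qed
  qed
  let ?\<K> = "{p \<in> cells. c (snd p) \<le> \<gamma> \<and> \<delta> \<le> d (snd p)}"
  have fin: "finite ?\<K>" using finite_cells by (rule rev_finite_subset) auto
  have "{\<alpha><..<\<beta>} \<subseteq> (\<Union>p\<in>?\<K>. {a (fst p)..b (fst p)})"
  proof
    fix x assume "x \<in> {\<alpha><..<\<beta>}"
    then obtain i j where "(i, j) \<in> cells" "x \<in> {a i..b i}" "c j \<le> \<gamma>" "\<delta> \<le> d j" using column by blast
    then show "x \<in> (\<Union>p\<in>?\<K>. {a (fst p)..b (fst p)})" by (intro UN_I[of "(i, j)"]) auto
  qed
  from interval_cover_meet[OF fin rect(1) this anchored(1)]
  obtain p q t where pq: "p \<in> ?\<K>" "q \<in> ?\<K>" "a (fst p) \<le> \<alpha>" "\<beta> \<le> b (fst q)"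
    "t \<in> {a (fst p)..b (fst p)}" "t \<in> {a (fst q)..b (fst q)}"
    by blast
  have "\<exists>i j. (i, j) \<in> cells \<and> a i \<le> \<alpha> \<and> \<beta> \<le> b i \<and> c j \<le> \<gamma> \<and> \<delta> \<le> d j"
  proof (cases "a (fst q) \<le> \<alpha> \<or> \<beta> \<le> b (fst p)")
    case True
    then show ?thesis using pq by (metis (no_types, lifting) mem_Collect_eq prod.collapse)
  next
    case False
    have "fst p \<le> i0" using False fit mono_le[of i0 "fst p"] by linarith
    moreover have "i0 \<le> fst q" using False fit mono_le[of "fst q" i0] by linarith
    ultimately have i0: "i0 \<in> {min (fst p) (fst q)..max (fst p) (fst q)}" by auto
    have "(t, \<gamma>) \<in> cell (fst p) (snd p) \<inter> cell (fst q) (snd q)"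
      using pq rect(2) by (auto simp: cell_def)
    then have "(p, q) \<in> (adjacent ({min (fst p) (fst q)..max (fst p) (fst q)} \<times> {min (snd p) (snd q)..max (snd p) (snd q)}))\<^sup>*"
      using path_between[of "fst p" "snd p" "fst q" "snd q"] pq by auto
    from path_meets(1)[OF this _ i0] pq(1)
    obtain l where l: "(i0, l) \<in> cells" "l \<in> {min (snd p) (snd q)..max (snd p) (snd q)}"
      by (cases p) auto
    then have "c l \<le> \<gamma>" "\<delta> \<le> d l"
      using pq mono_le[of "snd p" l] mono_le[of "snd q" l] mono_le[of l "snd p"] mono_le[of l "snd q"]
      by (auto simp: min_def max_def split: if_splits)
    then show ?thesis using l fit by blast
  qed
  then obtain i j where "(i, j) \<in> cells" "a i \<le> \<alpha>" "\<beta> \<le> b i" "c j \<le> \<gamma>" "\<delta> \<le> d j" by blast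
  then show ?thesis by (intro that[of i j]) (auto simp: cell_def)
qed

end

section \<open>Curls of forms supported in a subdomain\<close>

definition cell_density :: "knot_vector \<Rightarrow> knot_vector \<Rightarrow> nat \<Rightarrow> nat \<Rightarrow> real \<times> real \<Rightarrow> real" where
  "cell_density K1 K2 i j = (\<lambda>(x, y). Ds K1 i x * Ds K2 j y)"

lemma density_form_sum:
  "density_form K1 K2 c = (\<Sum>(i, j)\<in>{2..nspl K1} \<times> {2..nspl K2}. c i j *\<^sub>R cell_density K1 K2 i j)"
  by (auto simp: fun_eq_iff density_form_def cell_density_def sum_fun_apply scaleR_fun_apply
      sum.cartesian_product[symmetric] case_prod_beta' sum.cartesian_product')

definition curls :: "knot_vector \<Rightarrow> knot_vector \<Rightarrow> (real \<times> real) set \<Rightarrow> (real \<times> real \<Rightarrow> real) set" where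
  "curls K1 K2 U = {w. \<exists>v\<in>form1 K1 K2 U. curl_rel v w}"

lemma subspace_curls: "subspace (curls K1 K2 U)"
  unfolding curls_def by (rule linear_rel_image[OF linear_rel_curl subspace_form(2)])

lemma curls_minus_commute: "v - w \<in> curls K1 K2 U \<Longrightarrow> w - v \<in> curls K1 K2 U"
  using subspace_neg[OF subspace_curls] by fastforce

lemma curls_diff_trans: "u - v \<in> curls K1 K2 U \<Longrightarrow> v - w \<in> curls K1 K2 U \<Longrightarrow> u - w \<in> curls K1 K2 U"
  using subspace_add[OF subspace_curls, of "u - v" K1 K2 U "v - w"] by simp

lemma sum_diff_pred:
  fixes f :: "nat \<Rightarrow> real"
  assumes "1 \<le> n"
  shows "(\<Sum>i=2..n. f i - f (i - 1)) = f n - f 1"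
  using assms
proof (induction n rule: dec_induct)
  case (step n)
  then have "{2..Suc n} = insert (Suc n) {2..n}" by auto
  with step show ?case by simp
qed simp

context
  fixes K1 K2 :: knot_vector
  assumes K: "open_knot_vector K1" "open_knot_vector K2"
begin

lemma density_form_delta:
  assumes "i \<in> {2..nspl K1}" "j \<in> {2..nspl K2}"
  shows "density_form K1 K2 (\<lambda>k l. if k = i \<and> l = j then 1 else 0) = cell_density K1 K2 i j"
proof -
  have "(\<Sum>(k, l)\<in>{2..nspl K1} \<times> {2..nspl K2}. (if k = i \<and> l = j then 1 else 0) *\<^sub>R cell_density K1 K2 k l)
    = (\<Sum>p\<in>{2..nspl K1} \<times> {2..nspl K2}. if p = (i, j) then cell_density K1 K2 i j else 0)"
    by (intro sum.cong) auto
  then show ?thesis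
    using assms by (simp add: density_form_sum)
qed

lemma density_integral:
  assumes "i \<in> {2..nspl K1}" "j \<in> {2..nspl K2}"
  shows "(LINT z:Omega_hat|lborel. cell_density K1 K2 i j z) = 1"
proof -
  have "(LINT z:Omega_hat|lborel. cell_density K1 K2 i j z)
    = (\<Sum>k=2..nspl K1. \<Sum>l=2..nspl K2. if k = i \<and> l = j then 1 else 0)"
    unfolding density_form_delta[OF assms, symmetric] by (rule density_form_integral(2)[OF K])
  also have "\<dots> = (\<Sum>k=2..nspl K1. if k = i then 1 else 0)"
    using assms by (intro sum.cong) auto
  finally show ?thesis using assms by simp
qed

text \<open>The integral is the sum of the coefficients. The differences telescope to boundary
  coefficients, which the boundary conditions make 0.\<close>

lemma curl_integral:
  assumes "w \<in> curls K1 K2 U"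
  shows "(LINT z:Omega_hat|lborel. w z) = 0"
proof -
  from assms obtain v where v: "v \<in> form1 K1 K2 U" "curl_rel v w" by (auto simp: curls_def)
  then obtain a b where ab: "v = vector_form K1 K2 a b" and
    a: "\<And>i j. a i j \<noteq> 0 \<Longrightarrow> j \<in> {2..nspl K2 - 1}" and b: "\<And>i j. b i j \<noteq> 0 \<Longrightarrow> i \<in> {2..nspl K1 - 1}"
    unfolding form1_iff by blast
  have "w = density_form K1 K2 (\<lambda>i j. (b i j - b (i - 1) j) - (a i j - a i (j - 1)))"
    using linear_rel_unique[OF linear_rel_curl, OF v(2)] curl_vector_form[OF K] ab by blast
  then have "(LINT z:Omega_hat|lborel. w z)
    = (\<Sum>i=2..nspl K1. \<Sum>j=2..nspl K2. (b i j - b (i - 1) j) - (a i j - a i (j - 1)))"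
    by (simp only: density_form_integral(2)[OF K])
  also have "\<dots> = (\<Sum>j=2..nspl K2. \<Sum>i=2..nspl K1. b i j - b (i - 1) j)
      - (\<Sum>i=2..nspl K1. \<Sum>j=2..nspl K2. a i j - a i (j - 1))"
    unfolding sum_subtractf by (subst (1 2) sum.swap) simp
  also have "\<dots> = (\<Sum>j=2..nspl K2. b (nspl K1) j - b 1 j) - (\<Sum>i=2..nspl K1. a i (nspl K2) - a i 1)"
  proof -
    have "1 \<le> nspl K1" "1 \<le> nspl K2"
      using deg_less_nspl[OF K(1)] deg_less_nspl[OF K(2)] by auto
    then have "(\<Sum>i=2..nspl K1. b i j - b (i - 1) j) = b (nspl K1) j - b 1 j"
      "(\<Sum>j=2..nspl K2. a i j - a i (j - 1)) = a i (nspl K2) - a i 1" for i j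
      using sum_diff_pred[of _ "\<lambda>i. b i j"] sum_diff_pred[of _ "a i"] by blast+
    then show ?thesis by (simp only:)
  qed
  also have "\<dots> = 0"
  proof -
    have "b (nspl K1) j = 0" "b 1 j = 0" for j
      using b[of "nspl K1" j] b[of 1 j] deg_less_nspl[OF K(1)] by force+
    moreover have "a i (nspl K2) = 0" "a i 1 = 0" for i
      using a[of i "nspl K2"] a[of i 1] deg_less_nspl[OF K(2)] by force+
    ultimately show ?thesis by simp
  qed
  finally show ?thesis .
qed

end

text \<open>The two closed supports leave no gap: the degree is at least 1, so the second starts no
  later than the first ends.\<close>

lemma SB_subset_closure_SD:
  assumes "open_knot_vector K" "i \<in> {2..nspl K}" "i + 1 \<in> {2..nspl K}"
  shows "SB K i \<subseteq> closure (SD K i) \<union> closure (SD K (i + 1))"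
proof -
  have "kn K (i + 1) \<le> kn K (i + deg K)"
    using deg_pos[OF assms(1)] by (intro monoD[OF mono_kn[OF assms(1)]]) simp
  then show ?thesis
    using kn_less[OF assms(1), of i] kn_less[OF assms(1), of "i + 1"] assms(2,3)
    by (auto simp: SB_def SD_def)
qed

context
  fixes K1 K2 :: knot_vector and U :: "(real \<times> real) set"
  assumes K: "open_knot_vector K1" "open_knot_vector K2" and regular: "interior (closure U) = U"
begin

text \<open>The difference is the curl of a single basis field. Its support is covered by the
  closures of the two cells, hence contained in \<open>U\<close> by regularity.\<close>

lemma density_diff_in_curls1:
  assumes i: "i \<in> {2..nspl K1}" "i + 1 \<in> {2..nspl K1}" and j: "j \<in> {2..nspl K2}"
    and U: "SD K1 i \<times> SD K2 j \<subseteq> U" "SD K1 (i + 1) \<times> SD K2 j \<subseteq> U"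
  shows "cell_density K1 K2 i j - cell_density K1 K2 (i + 1) j \<in> curls K1 K2 U"
proof -
  have "SB K1 i \<times> SD K2 j \<subseteq> closure (SD K1 i \<times> SD K2 j) \<union> closure (SD K1 (i + 1) \<times> SD K2 j)"
    using SB_subset_closure_SD[OF K(1) i] closure_subset[of "SD K2 j"] by (auto simp: closure_Times)
  also have "\<dots> \<subseteq> closure U"
    using closure_mono[OF U(1)] closure_mono[OF U(2)] by blast
  finally have sub: "SB K1 i \<times> SD K2 j \<subseteq> U"
    using open_subset_regular[OF open_Times[OF open_SB open_SD] regular] by blast
  define b :: "nat \<Rightarrow> nat \<Rightarrow> real" where "b k l = (if k = i \<and> l = j then 1 else 0)" for k l
  have "vector_form K1 K2 (\<lambda>_ _. 0) b \<in> form1 K1 K2 U"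
    unfolding form1_iff using i j sub by (intro exI[of _ "\<lambda>_ _. 0"] exI[of _ b]) (auto simp: b_def)
  moreover have "curl_rel (vector_form K1 K2 (\<lambda>_ _. 0) b)
      (density_form K1 K2 (\<lambda>k l. (b k l - b (k - 1) l) - (0 - 0)))"
    by (rule curl_vector_form[OF K])
  moreover have "density_form K1 K2 (\<lambda>k l. (b k l - b (k - 1) l) - (0 - 0))
      = density_form K1 K2 (\<lambda>k l. if k = i \<and> l = j then 1 else 0)
      - density_form K1 K2 (\<lambda>k l. if k = i + 1 \<and> l = j then 1 else 0)"
    unfolding density_form_sum sum_subtractf[symmetric]
    by (intro sum.cong refl) (auto simp: b_def scaleR_diff_left[symmetric])
  ultimately show ?thesis
    unfolding curls_def density_form_delta[OF K i(1) j] density_form_delta[OF K i(2) j] by force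
qed

lemma density_diff_in_curls2:
  assumes i: "i \<in> {2..nspl K1}" and j: "j \<in> {2..nspl K2}" "j + 1 \<in> {2..nspl K2}"
    and U: "SD K1 i \<times> SD K2 j \<subseteq> U" "SD K1 i \<times> SD K2 (j + 1) \<subseteq> U"
  shows "cell_density K1 K2 i j - cell_density K1 K2 i (j + 1) \<in> curls K1 K2 U"
proof -
  have "SD K1 i \<times> SB K2 j \<subseteq> closure (SD K1 i \<times> SD K2 j) \<union> closure (SD K1 i \<times> SD K2 (j + 1))"
    using SB_subset_closure_SD[OF K(2) j] closure_subset[of "SD K1 i"] by (auto simp: closure_Times)
  also have "\<dots> \<subseteq> closure U"
    using closure_mono[OF U(1)] closure_mono[OF U(2)] by blast
  finally have sub: "SD K1 i \<times> SB K2 j \<subseteq> U"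
    using open_subset_regular[OF open_Times[OF open_SD open_SB] regular] by blast
  \<comment> \<open>The sign compensates for the minus sign with which the first component enters
    the curl.\<close>
  define a :: "nat \<Rightarrow> nat \<Rightarrow> real" where "a k l = (if k = i \<and> l = j then - 1 else 0)" for k l
  have "vector_form K1 K2 a (\<lambda>_ _. 0) \<in> form1 K1 K2 U"
    unfolding form1_iff using i j sub by (intro exI[of _ "\<lambda>_ _. 0"] exI[of _ a]) (auto simp: a_def)
  moreover have "curl_rel (vector_form K1 K2 a (\<lambda>_ _. 0))
      (density_form K1 K2 (\<lambda>k l. (0 - 0) - (a k l - a k (l - 1))))"
    by (rule curl_vector_form[OF K])
  moreover have "density_form K1 K2 (\<lambda>k l. (0 - 0) - (a k l - a k (l - 1)))
      = density_form K1 K2 (\<lambda>k l. if k = i \<and> l = j then 1 else 0)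
      - density_form K1 K2 (\<lambda>k l. if k = i \<and> l = j + 1 then 1 else 0)"
    unfolding density_form_sum sum_subtractf[symmetric]
    by (intro sum.cong refl) (auto simp: a_def scaleR_diff_left[symmetric])
  ultimately show ?thesis
    unfolding curls_def density_form_delta[OF K i j(1)] density_form_delta[OF K i j(2)] by force
qed

text \<open>The path varies the first index and then the second; monotone knots keep the cells on
  the way inside the rectangle.\<close>

lemma densities_in_rectangle:
  assumes ij: "i \<in> {2..nspl K1}" "j \<in> {2..nspl K2}" "k \<in> {2..nspl K1}" "l \<in> {2..nspl K2}"
    and sub: "SD K1 i \<times> SD K2 j \<subseteq> {\<alpha><..<\<beta>} \<times> {\<gamma><..<\<delta>}" "SD K1 k \<times> SD K2 l \<subseteq> {\<alpha><..<\<beta>} \<times> {\<gamma><..<\<delta>}"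
    and U: "{\<alpha><..<\<beta>} \<times> {\<gamma><..<\<delta>} \<subseteq> U"
  shows "cell_density K1 K2 i j - cell_density K1 K2 k l \<in> curls K1 K2 U"
proof -
  have box: "SD K1 i \<subseteq> {\<alpha><..<\<beta>} \<and> SD K2 j \<subseteq> {\<gamma><..<\<delta>}"
    if "i \<in> {2..nspl K1}" "j \<in> {2..nspl K2}" "SD K1 i \<times> SD K2 j \<subseteq> {\<alpha><..<\<beta>} \<times> {\<gamma><..<\<delta>}" for i j
    using that SD_nonempty[OF K(1), of i] SD_nonempty[OF K(2), of j] by auto
  have between: "SD K s \<subseteq> {\<alpha><..<\<beta>}"
    if "open_knot_vector K" "SD K i \<subseteq> {\<alpha><..<\<beta>}" "SD K k \<subseteq> {\<alpha><..<\<beta>}" "i \<le> s" "s \<le> k"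
      "i \<in> {2..nspl K}" "k \<in> {2..nspl K}" for K i k s \<alpha> \<beta>
  proof -
    have "kn K i \<le> kn K s" "kn K (s + deg K) \<le> kn K (k + deg K)"
      using that by (auto intro: monoD[OF mono_kn[OF that(1)]])
    moreover have "\<alpha> \<le> kn K i" "kn K (k + deg K) \<le> \<beta>"
      using that kn_less[OF that(1), of i] kn_less[OF that(1), of k]
      by (auto simp: SD_def greaterThanLessThan_subseteq_greaterThanLessThan)
    ultimately show ?thesis by (auto simp: SD_def)
  qed
  have row: "cell_density K1 K2 i j - cell_density K1 K2 k j \<in> curls K1 K2 U"
    if "i \<le> k" "i \<in> {2..nspl K1}" "k \<in> {2..nspl K1}" "j \<in> {2..nspl K2}"
      "SD K1 i \<subseteq> {\<alpha><..<\<beta>}" "SD K1 k \<subseteq> {\<alpha><..<\<beta>}" "SD K2 j \<subseteq> {\<gamma><..<\<delta>}" for i j k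
    using that(1,3,6)
  proof (induction k rule: dec_induct)
    case base
    then show ?case using subspace_0[OF subspace_curls] by (simp add: zero_fun_def)
  next
    case (step k)
    have k: "k \<in> {2..nspl K1}" using step that(2) by auto
    have sk: "SD K1 k \<subseteq> {\<alpha><..<\<beta>}"
      using between[OF K(1), of i \<alpha> \<beta> "Suc k" k] step that by auto
    then have "cell_density K1 K2 k j - cell_density K1 K2 (k + 1) j \<in> curls K1 K2 U"
      using step k that U by (intro density_diff_in_curls1) (auto simp: subset_eq)
    then show ?case
      unfolding Suc_eq_plus1 by (rule curls_diff_trans[OF step.IH[OF k sk]])
  qed
  have column: "cell_density K1 K2 i j - cell_density K1 K2 i l \<in> curls K1 K2 U"
    if "j \<le> l" "i \<in> {2..nspl K1}" "j \<in> {2..nspl K2}" "l \<in> {2..nspl K2}"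
      "SD K1 i \<subseteq> {\<alpha><..<\<beta>}" "SD K2 j \<subseteq> {\<gamma><..<\<delta>}" "SD K2 l \<subseteq> {\<gamma><..<\<delta>}" for i j l
    using that(1,4,7)
  proof (induction l rule: dec_induct)
    case base
    then show ?case using subspace_0[OF subspace_curls] by (simp add: zero_fun_def)
  next
    case (step l)
    have l: "l \<in> {2..nspl K2}" using step that(3) by auto
    have sl: "SD K2 l \<subseteq> {\<gamma><..<\<delta>}"
      using between[OF K(2), of j \<gamma> \<delta> "Suc l" l] step that by auto
    then have "cell_density K1 K2 i l - cell_density K1 K2 i (l + 1) \<in> curls K1 K2 U"
      using step l that U by (intro density_diff_in_curls2) (auto simp: subset_eq)
    then show ?case
      unfolding Suc_eq_plus1 by (rule curls_diff_trans[OF step.IH[OF l sl]])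
  qed
  have "cell_density K1 K2 i j - cell_density K1 K2 k j \<in> curls K1 K2 U"
    using row[of i k j] row[of k i j] curls_minus_commute box[OF ij(1,2) sub(1)] box[OF ij(3,4) sub(2)] ij
    by (cases "i \<le> k") auto
  moreover have "cell_density K1 K2 k j - cell_density K1 K2 k l \<in> curls K1 K2 U"
    using column[of j l k] column[of l j k] curls_minus_commute box[OF ij(1,2) sub(1)] box[OF ij(3,4) sub(2)] ij
    by (cases "j \<le> l") auto
  ultimately show ?thesis by (rule curls_diff_trans)
qed

end

section \<open>Cohomology of coarse and fine forms supported in a subdomain\<close>

text \<open>In a small box every point is joined to the centre by a horizontal and a vertical
  segment, along which \<open>u\<close> is continuous with derivative 0 off finitely many points. So
  \<open>u\<close> is locally constant on the connected set \<open>C\<close>.\<close>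

lemma grad_zero_constant:
  assumes u: "continuous_on UNIV u" "grad_rel u v" and G: "open G" "\<And>z. z \<in> G \<Longrightarrow> v z = 0"
    and C: "connected C" "C \<subseteq> G" "z \<in> C" "z' \<in> C"
  shows "u z = u z'"
proof -
  from u(2) obtain X Y where XY: "finite X" "finite Y"
    "\<And>x y. x \<notin> X \<Longrightarrow> ((\<lambda>t. u (t, y)) has_real_derivative fst (v (x, y))) (at x)"
    "\<And>x y. y \<notin> Y \<Longrightarrow> ((\<lambda>t. u (x, t)) has_real_derivative snd (v (x, y))) (at y)"
    unfolding grad_rel_def dx_def dy_iff by blast
  have const: "f s = f t"
    if "continuous_on {\<alpha>..\<beta>} f" "finite X" "\<And>t. t \<in> {\<alpha>..\<beta>} \<Longrightarrow> t \<notin> X \<Longrightarrow> (f has_real_derivative 0) (at t)"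
      "s \<in> {\<alpha>..\<beta>}" "t \<in> {\<alpha>..\<beta>}" for f :: "real \<Rightarrow> real" and \<alpha> \<beta> s t X
  proof -
    have "f s = f \<alpha>" if "s \<in> {\<alpha>..\<beta>}" for s
    proof (rule has_derivative_zero_unique_strong_interval[OF \<open>finite X\<close> \<open>continuous_on {\<alpha>..\<beta>} f\<close> refl _ that])
      fix t assume "t \<in> {\<alpha>..\<beta>} - X"
      then have "(f has_real_derivative 0) (at t within {\<alpha>..\<beta>})"
        using \<open>\<And>t. t \<in> {\<alpha>..\<beta>} \<Longrightarrow> t \<notin> X \<Longrightarrow> (f has_real_derivative 0) (at t)\<close>
        by (auto intro: has_field_derivative_at_within)
      then show "(f has_derivative (\<lambda>h. 0)) (at t within {\<alpha>..\<beta>})"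
        by (simp add: has_field_derivative_def lambda_zero)
    qed
    then show ?thesis using that by metis
  qed
  have "u constant_on C"
  proof (rule locally_constant_imp_constant[OF C(1)])
    fix z0 assume "z0 \<in> C"
    then have "z0 \<in> G" using C(2) by auto
    obtain x0 y0 where z0: "z0 = (x0, y0)" by force
    from open_prod_elim[OF G(1) \<open>z0 \<in> G\<close>] obtain A B
      where AB: "open A" "open B" "z0 \<in> A \<times> B" "A \<times> B \<subseteq> G" by blast
    from AB z0 obtain e f where ef: "0 < e" "cball x0 e \<subseteq> A" "0 < f" "cball y0 f \<subseteq> B"
      by (meson mem_Sigma_iff open_contains_cball)
    have box: "{x0 - e..x0 + e} \<times> {y0 - f..y0 + f} \<subseteq> G"
      using AB(4) ef(2,4) by (auto simp: cball_eq_atLeastAtMost)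
    have eq: "u z = u z0" if "z \<in> {x0 - e<..<x0 + e} \<times> {y0 - f<..<y0 + f}" for z
    proof -
      obtain x y where z: "z = (x, y)" by force
      have "u (x, y) = u (x0, y)"
      proof (rule const[where f = "\<lambda>t. u (t, y)"])
        show "continuous_on {x0 - e..x0 + e} (\<lambda>t. u (t, y))"
          by (intro continuous_on_compose2[OF u(1)] continuous_intros) auto
        show "((\<lambda>t. u (t, y)) has_real_derivative 0) (at t)" if "t \<in> {x0 - e..x0 + e}" "t \<notin> X" for t
        proof -
          have "(t, y) \<in> G"
            using box that \<open>z \<in> _\<close> z by auto
          then show ?thesis using XY(3)[OF that(2), of y] G(2) by simp
        qed
      qed (use that z ef XY in auto)
      also have "\<dots> = u (x0, y0)"
      proof (rule const[where f = "\<lambda>t. u (x0, t)"])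
        show "continuous_on {y0 - f..y0 + f} (\<lambda>t. u (x0, t))"
          by (intro continuous_on_compose2[OF u(1)] continuous_intros) auto
        show "((\<lambda>t. u (x0, t)) has_real_derivative 0) (at t)" if "t \<in> {y0 - f..y0 + f}" "t \<notin> Y" for t
        proof -
          have "(x0, t) \<in> G"
            using box that ef by auto
          then show ?thesis using XY(4)[OF that(2), of x0] G(2) by simp
        qed
      qed (use that z ef XY in auto)
      finally show ?thesis by (simp add: z z0)
    qed
    let ?T = "C \<inter> ({x0 - e<..<x0 + e} \<times> {y0 - f<..<y0 + f})"
    have "openin (top_of_set C) ?T"
      by (intro openin_open_Int open_Times open_greaterThanLessThan)
    moreover have "z0 \<in> ?T" using \<open>z0 \<in> C\<close> ef by (simp add: z0)
    ultimately show "\<exists>T. openin (top_of_set C) T \<and> z0 \<in> T \<and> (\<forall>x\<in>T. u x = u z0)"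
      using eq by blast
  qed
  then show ?thesis using C(3,4) by (auto simp: constant_on_def)
qed

lemma form0_continuous:
  assumes K: "open_knot_vector K1" "open_knot_vector K2" and u: "u \<in> form0 K1 K2 U"
  shows "continuous_on UNIV u"
proof -
  have cont: "continuous_on UNIV (Bs K i)" if "open_knot_vector K" "i \<in> {2..nspl K - 1}" for K i
  proof -
    have "2 \<le> i" "i < nspl K" using that(2) by auto
    then show ?thesis
      by (intro continuous_at_imp_continuous_on ballI Bs_isCont[OF that(1)])
  qed
  show ?thesis
    using u unfolding form0_def
  proof (induction rule: span_induct_alt)
    case base
    then show ?case by (simp add: zero_fun_def)
  next
    case (step c h k)
    then obtain i j where ij: "i \<in> {2..nspl K1 - 1}" "j \<in> {2..nspl K2 - 1}"
      and h: "h = (\<lambda>(x, y). Bs K1 i x * Bs K2 j y)" by auto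
    have "continuous_on UNIV (\<lambda>z::real \<times> real. Bs K1 i (fst z))" "continuous_on UNIV (\<lambda>z::real \<times> real. Bs K2 j (snd z))"
      by (intro continuous_on_compose2[OF cont[OF K(1) ij(1)]] continuous_on_compose2[OF cont[OF K(2) ij(2)]] continuous_intros; simp)+
    then have "continuous_on UNIV (\<lambda>z. c * h z + k z)"
      unfolding h case_prod_beta' using step by (intro continuous_intros)
    then show ?case by (simp add: plus_fun_def scaleR_fun_def)
  qed
qed

text \<open>One step of the hierarchy, with \<open>U\<close> as the domain of the finer level. In
  \<open>cover\<close>, the unspecified family of supports is replaced by all cells inside
  \<open>U\<close>, which have the same union up to closure.\<close>

locale refinement =
  fixes K1 K2 K1' K2' :: knot_vector and U :: "(real \<times> real) set"
  assumes coarse: "open_knot_vector K1" "open_knot_vector K2"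
    and fine: "open_knot_vector K1'" "open_knot_vector K2'"
    and nested: "spline_space K1 \<subseteq> spline_space K1'" "spline_space K2 \<subseteq> spline_space K2'"
    and regular: "interior (closure U) = U"
    and in_unit_square: "U \<subseteq> Omega_hat"
    and cover: "closure U = (\<Union>(i, j)\<in>{(i, j) \<in> {2..nspl K1} \<times> {2..nspl K2}. SD K1 i \<times> SD K2 j \<subseteq> U}.
      closure (SD K1 i \<times> SD K2 j))"
    and connected_overlap: "\<And>i j. \<lbrakk>i \<in> {2..nspl K1 - 1}; j \<in> {2..nspl K2 - 1}\<rbrakk> \<Longrightarrow>
      connected (SB K1 i \<times> SB K2 j - closure U)"
begin

lemma closure_SD: "i \<in> {2..nspl K1} \<Longrightarrow> closure (SD K1 i) = {kn K1 i..kn K1 (i + deg K1)}"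
  "j \<in> {2..nspl K2} \<Longrightarrow> closure (SD K2 j) = {kn K2 j..kn K2 (j + deg K2)}"
  using kn_less[OF coarse(1), of i] kn_less[OF coarse(2), of j] by (auto simp: SD_def)

lemma subset_iff_closure_subset:
  fixes S :: "(real \<times> real) set"
  assumes "open S"
  shows "closure S \<subseteq> closure U \<longleftrightarrow> S \<subseteq> U"
proof
  assume "closure S \<subseteq> closure U"
  then have "S \<subseteq> interior (closure U)"
    using closure_subset by (intro interior_maximal[OF _ assms]) blast
  then show "S \<subseteq> U" by (simp add: regular)
qed (rule closure_mono)

lemma cells_set_eq: "{(i, j) \<in> {2..nspl K1} \<times> {2..nspl K2}.
    {kn K1 i..kn K1 (i + deg K1)} \<times> {kn K2 j..kn K2 (j + deg K2)} \<subseteq> closure U}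
  = {(i, j) \<in> {2..nspl K1} \<times> {2..nspl K2}. SD K1 i \<times> SD K2 j \<subseteq> U}"
proof -
  have "{kn K1 i..kn K1 (i + deg K1)} \<times> {kn K2 j..kn K2 (j + deg K2)} \<subseteq> closure U \<longleftrightarrow> SD K1 i \<times> SD K2 j \<subseteq> U"
    if "i \<in> {2..nspl K1}" "j \<in> {2..nspl K2}" for i j
    using subset_iff_closure_subset[OF open_Times[OF open_SD open_SD], of K1 i K2 j] closure_SD(1)[OF that(1)]
      closure_SD(2)[OF that(2)] by (simp add: closure_Times)
  then show ?thesis by auto
qed

text \<open>A block of four cells is exactly the support of an inner scalar basis function, so
  \<open>connected_overlap\<close> is \<open>connected_block\<close>.\<close>

sublocale cell_cover "kn K1" "\<lambda>i. kn K1 (i + deg K1)" "kn K2" "\<lambda>j. kn K2 (j + deg K2)"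
  "nspl K1" "nspl K2" "closure U"
proof
  show "mono (kn K1)" "mono (kn K2)"
    by (rule mono_kn coarse)+
  then show "mono (\<lambda>i. kn K1 (i + deg K1))" "mono (\<lambda>j. kn K2 (j + deg K2))"
    by (auto simp: mono_def)
  show "kn K1 i < kn K1 (i + deg K1)" if "i \<in> {2..nspl K1}" for i
    using that kn_less[OF coarse(1)] by auto
  show "kn K2 j < kn K2 (j + deg K2)" if "j \<in> {2..nspl K2}" for j
    using that kn_less[OF coarse(2)] by auto
  show "closure U = (\<Union>(i, j)\<in>{(i, j) \<in> {2..nspl K1} \<times> {2..nspl K2}.
      {kn K1 i..kn K1 (i + deg K1)} \<times> {kn K2 j..kn K2 (j + deg K2)} \<subseteq> closure U}.
      {kn K1 i..kn K1 (i + deg K1)} \<times> {kn K2 j..kn K2 (j + deg K2)})"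
    unfolding cells_set_eq
    by (subst cover, intro SUP_cong refl) (auto simp: closure_Times closure_SD)
  fix i j assume "i \<in> {2..<nspl K1}" "j \<in> {2..<nspl K2}"
  then have "connected (SB K1 i \<times> SB K2 j - closure U)"
    by (intro connected_overlap) auto
  then show "connected ({kn K1 i<..<kn K1 (i + 1 + deg K1)} \<times> {kn K2 j<..<kn K2 (j + 1 + deg K2)} - closure U)"
    by (simp add: SB_def)
qed

lemma cells_iff: "(i, j) \<in> cells \<longleftrightarrow> i \<in> {2..nspl K1} \<and> j \<in> {2..nspl K2} \<and> SD K1 i \<times> SD K2 j \<subseteq> U"
  using cells_set_eq unfolding cells_def cell_def by auto

lemma cell_eq: "(i, j) \<in> cells \<Longrightarrow> cell i j = closure (SD K1 i \<times> SD K2 j)"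
  using closure_SD by (simp add: cells_iff cell_def closure_Times)

lemma form_subset: "form0 K1 K2 V \<subseteq> form0 K1' K2' V" "form1 K1 K2 V \<subseteq> form1 K1' K2' V"
  "form2 K1 K2 V \<subseteq> form2 K1' K2' V"
  by (rule form_refine[OF coarse fine nested])+

text \<open>Both a fine basis function and a coarse one containing its support have integral one, and the
  coarse one is a combination of fine ones that are all connected with each other.\<close>

lemma form2_decompose:
  assumes "w \<in> form2 K1' K2' U"
  obtains a where "a \<in> form2 K1 K2 U" "w - a \<in> curls K1' K2' U"
proof -
  have fine_cell: "\<exists>a\<in>form2 K1 K2 U. cell_density K1' K2' k l - a \<in> curls K1' K2' U"
    if kl: "k \<in> {2..nspl K1'}" "l \<in> {2..nspl K2'}" "SD K1' k \<times> SD K2' l \<subseteq> U" for k l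
  proof -
    obtain i0 where i0: "i0 \<in> {2..nspl K1}" "SD K1' k \<subseteq> SD K1 i0"
      using SD_refine[OF coarse(1) fine(1) nested(1) kl(1)] by blast
    obtain j0 where j0: "j0 \<in> {2..nspl K2}" "SD K2' l \<subseteq> SD K2 j0"
      using SD_refine[OF coarse(2) fine(2) nested(2) kl(2)] by blast
    have lt: "kn K1' k < kn K1' (k + deg K1')" "kn K2' l < kn K2' (l + deg K2')"
      using kn_less[OF fine(1)] kn_less[OF fine(2)] kl by auto
    \<comment> \<open>The cell \<open>(i0, j0)\<close> has room for the fine support but may stick
      out of \<open>U\<close>. It is used to find a cell inside \<open>U\<close> that contains this
      support.\<close>
    obtain i j where ij: "(i, j) \<in> cells" "SD K1' k \<times> SD K2' l \<subseteq> cell i j"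
    proof (rule rectangle_in_cell[OF lt, of i0 j0])
      show "{kn K1' k<..<kn K1' (k + deg K1')} \<times> {kn K2' l<..<kn K2' (l + deg K2')} \<subseteq> closure U"
        using kl(3) closure_subset[of U] by (auto simp: SD_def)
    qed (use i0 j0 lt that in \<open>auto simp: SD_def greaterThanLessThan_subseteq_greaterThanLessThan\<close>)
    let ?R = "SD K1 i \<times> SD K2 j"
    have sub: "SD K1' k \<times> SD K2' l \<subseteq> ?R"
    proof -
      have "SD K1' k \<times> SD K2' l \<subseteq> interior (cell i j)"
        using ij(2) by (intro interior_maximal open_Times open_SD)
      then show ?thesis by (simp add: cell_def interior_Times SD_def)
    qed
    have range: "i \<in> {2..nspl K1}" "j \<in> {2..nspl K2}" and RU: "?R \<subseteq> U"
      using ij(1) by (auto simp: cells_iff)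
    let ?a = "cell_density K1 K2 i j"
    have "?a \<in> form2 K1 K2 ?R"
      unfolding form2_def cell_density_def
      by (rule span_base, rule image_eqI[of _ _ "(i, j)"]) (use range in auto)
    then have a: "?a \<in> form2 K1 K2 U" "?a \<in> form2 K1' K2' ?R"
      using form_mono(3)[OF RU] form_subset(3) by blast+
    then obtain c where c: "?a = density_form K1' K2' c"
      "\<And>s t. c s t \<noteq> 0 \<Longrightarrow> s \<in> {2..nspl K1'} \<and> t \<in> {2..nspl K2'} \<and> SD K1' s \<times> SD K2' t \<subseteq> ?R"
      unfolding form2_iff by blast
    have "(\<Sum>s=2..nspl K1'. \<Sum>t=2..nspl K2'. c s t) = 1"
      using density_integral[OF coarse range] density_form_integral(2)[OF fine, of c] c(1) by simp
    then have one: "(\<Sum>(s, t)\<in>{2..nspl K1'} \<times> {2..nspl K2'}. c s t) = 1"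
      by (simp add: sum.cartesian_product)
    \<comment> \<open>The coefficients \<open>c s t\<close> sum to 1, so the fine density may be
      distributed with these weights. What remains are differences of fine densities within the one
      coarse cell \<open>?R\<close>.\<close>
    have "cell_density K1' K2' k l - ?a
      = (\<Sum>(s, t)\<in>{2..nspl K1'} \<times> {2..nspl K2'}. c s t *\<^sub>R (cell_density K1' K2' k l - cell_density K1' K2' s t))"
    proof -
      have "(\<Sum>(s, t)\<in>{2..nspl K1'} \<times> {2..nspl K2'}. c s t *\<^sub>R (cell_density K1' K2' k l - cell_density K1' K2' s t))
        = (\<Sum>(s, t)\<in>{2..nspl K1'} \<times> {2..nspl K2'}. c s t) *\<^sub>R cell_density K1' K2' k l
          - (\<Sum>(s, t)\<in>{2..nspl K1'} \<times> {2..nspl K2'}. c s t *\<^sub>R cell_density K1' K2' s t)"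
        by (simp only: scaleR_diff_right sum_subtractf scaleR_sum_left case_prod_beta')
      then show ?thesis by (simp only: one scaleR_one c(1) density_form_sum)
    qed
    also have "\<dots> \<in> curls K1' K2' U"
    proof (rule subspace_sum[OF subspace_curls], clarify)
      fix s t assume st: "s \<in> {2..nspl K1'}" "t \<in> {2..nspl K2'}"
      show "c s t *\<^sub>R (cell_density K1' K2' k l - cell_density K1' K2' s t) \<in> curls K1' K2' U"
      proof (cases "c s t = 0")
        case True
        then show ?thesis using subspace_0[OF subspace_curls] by simp
      next
        case False
        then have "cell_density K1' K2' k l - cell_density K1' K2' s t \<in> curls K1' K2' U"
          using c(2)[OF False] sub RU kl(1,2)
          by (intro densities_in_rectangle[OF fine regular, where \<alpha> = "kn K1 i" and \<beta> = "kn K1 (i + deg K1)"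
                and \<gamma> = "kn K2 j" and \<delta> = "kn K2 (j + deg K2)"]) (auto simp: SD_def[of K1] SD_def[of K2])
        then show ?thesis by (rule subspace_scale[OF subspace_curls])
      qed
    qed
    finally show ?thesis using a(1) by blast
  qed
  have "\<exists>a\<in>form2 K1 K2 U. w - a \<in> curls K1' K2' U"
    using assms unfolding form2_def[of K1' K2']
  proof (induction rule: span_induct_alt)
    case base
    show ?case
      using subspace_0[OF subspace_curls, of K1' K2' U] subspace_0[OF subspace_form(3), of K1 K2 U]
      by (intro bexI[of _ 0]) (simp_all add: zero_fun_def)
  next
    case (step c h w)
    then obtain k l where "k \<in> {2..nspl K1'}" "l \<in> {2..nspl K2'}" "SD K1' k \<times> SD K2' l \<subseteq> U"
      "h = cell_density K1' K2' k l" by (auto simp: cell_density_def)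
    with fine_cell obtain a where a: "a \<in> form2 K1 K2 U" "h - a \<in> curls K1' K2' U" by blast
    from step obtain b where b: "b \<in> form2 K1 K2 U" "w - b \<in> curls K1' K2' U" by blast
    have "c *\<^sub>R a + b \<in> form2 K1 K2 U"
      using a b by (intro subspace_add subspace_scale subspace_form)
    moreover have "c *\<^sub>R (h - a) + (w - b) \<in> curls K1' K2' U"
      using a b by (intro subspace_add subspace_scale subspace_curls)
    then have "(c *\<^sub>R h + w) - (c *\<^sub>R a + b) \<in> curls K1' K2' U"
      by (simp only: scaleR_diff_right diff_add_eq add_diff_eq diff_diff_eq add.commute add.left_commute)
    ultimately show ?case by blast
  qed
  with that show ?thesis by blast
qed

end

section \<open>Components of the adjacency graph and injectivity in degree 2\<close>

context refinement
begin

definition component :: "nat \<times> nat \<Rightarrow> (nat \<times> nat) set" where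
  "component p = {q. (p, q) \<in> (adjacent UNIV)\<^sup>*}"

lemma component_sym: "q \<in> component p \<Longrightarrow> p \<in> component q"
  unfolding component_def using symD[OF sym_rtrancl[OF sym_adjacent]] by blast

lemma component_trans: "q \<in> component p \<Longrightarrow> r \<in> component q \<Longrightarrow> r \<in> component p"
  unfolding component_def by (simp add: rtrancl_trans)

text \<open>Hence closed cells of different components are disjoint, although the components are
  defined by neighbouring indices alone.\<close>

lemma component_meet:
  assumes "p \<in> cells" "q \<in> cells" "cell (fst p) (snd p) \<inter> cell (fst q) (snd q) \<noteq> {}"
  shows "q \<in> component p"
  using path_between[of "fst p" "snd p" "fst q" "snd q"] assms adjacent_mono[OF subset_UNIV]
  unfolding component_def by auto

lemma component_density_diff:
  assumes "q \<in> component p"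
  shows "cell_density K1 K2 (fst p) (snd p) - cell_density K1 K2 (fst q) (snd q) \<in> curls K1 K2 U"
  using assms unfolding component_def mem_Collect_eq
proof (induction rule: rtrancl_induct)
  case base
  show ?case using subspace_0[OF subspace_curls, of K1 K2 U] by (simp add: zero_fun_def)
next
  case (step q r)
  obtain i j k l where qr: "q = (i, j)" "r = (k, l)" by force
  from step(2) have cells: "(i, j) \<in> cells" "(k, l) \<in> cells"
    and adj: "j = l \<and> (k = i + 1 \<or> i = k + 1) \<or> i = k \<and> (l = j + 1 \<or> j = l + 1)"
    by (auto simp: adjacent_def qr)
  have "cell_density K1 K2 i j - cell_density K1 K2 k l \<in> curls K1 K2 U"
  proof -
    from adj consider "j = l" "k = i + 1" | "j = l" "i = k + 1" | "i = k" "l = j + 1" | "i = k" "j = l + 1" by blast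
    then show ?thesis
    proof cases
      case 1
      then show ?thesis using cells density_diff_in_curls1[OF coarse regular] by (auto simp: cells_iff)
    next
      case 2
      then show ?thesis
        using cells by (intro curls_minus_commute[of "cell_density K1 K2 k l"])
          (auto simp: cells_iff intro!: density_diff_in_curls1[OF coarse regular, simplified])
    next
      case 3
      then show ?thesis using cells density_diff_in_curls2[OF coarse regular] by (auto simp: cells_iff)
    next
      case 4
      then show ?thesis
        using cells by (intro curls_minus_commute[of "cell_density K1 K2 k l"])
          (auto simp: cells_iff intro!: density_diff_in_curls2[OF coarse regular, simplified])
    qed
  qed
  then show ?case
    unfolding qr fst_conv snd_conv by (rule curls_diff_trans[OF step.IH[unfolded qr fst_conv snd_conv]])
qed

text \<open>The closed cells of a component form a closed set, disjoint from the remaining closed cells. The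
  closed support of a fine basis field is connected, so it lies on one side, and the restriction of a
  curl to a component is again a curl.\<close>

lemma curl_restrict_component:
  assumes "w \<in> curls K1' K2' U"
  shows "(\<lambda>z. if \<exists>(i, j)\<in>cells \<inter> component p. z \<in> cell i j then w z else 0) \<in> curls K1' K2' U"
proof -
  let ?A = "\<Union>(i, j)\<in>cells \<inter> component p. cell i j" and ?B = "\<Union>(i, j)\<in>cells - component p. cell i j"
  define restrict where "restrict w = (\<lambda>z. if z \<in> ?A then w z else 0)" for w :: "real \<times> real \<Rightarrow> real"
  have closed: "closed ?A" "closed ?B"
    using finite_cells by (auto simp: cell_def intro!: closed_UN closed_Times)
  have union: "closure U = ?A \<union> ?B"
    by (subst M_eq) blast
  have disjoint: "?A \<inter> ?B = {}"
  proof (rule ccontr)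
    assume "?A \<inter> ?B \<noteq> {}"
    then obtain q r where qr: "q \<in> cells" "q \<in> component p" "r \<in> cells" "r \<notin> component p"
      "cell (fst q) (snd q) \<inter> cell (fst r) (snd r) \<noteq> {}"
      by fastforce
    then show False using component_meet component_trans by blast
  qed
  have side: "restrict w \<in> curls K1' K2' U"
    if v: "v \<in> form1 K1' K2' (S \<times> T)" "curl_rel v w" and ST: "connected S" "connected T" "S \<times> T \<subseteq> U"
    for v w S T
  proof -
    from curl_form[OF fine v(1)] linear_rel_unique[OF linear_rel_curl, OF v(2)]
    have w: "w \<in> form2 K1' K2' (S \<times> T)" by auto
    have conn: "connected (closure (S \<times> T))"
      using ST by (intro connected_imp_connected_closure connected_Times)
    have AB: "closure (S \<times> T) \<subseteq> ?A \<union> ?B"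
      using closure_mono[OF ST(3)] eq_refl[OF union] by (rule order_trans)
    have "?A \<inter> ?B \<inter> closure (S \<times> T) = {}"
      using disjoint by (simp only: Int_empty_left)
    then have "?A \<inter> closure (S \<times> T) = {} \<or> ?B \<inter> closure (S \<times> T) = {}"
      by (rule connected_closedD[OF conn _ AB closed])
    then show ?thesis
    proof
      assume "?A \<inter> closure (S \<times> T) = {}"
      then have "restrict w z = 0" for z
        using form_eq_0(3)[OF fine _ w, of z] unfolding restrict_def by auto
      then have "restrict w = 0" by (simp add: fun_eq_iff)
      then show ?thesis using subspace_0[OF subspace_curls] by simp
    next
      assume "?B \<inter> closure (S \<times> T) = {}"
      then have sub: "closure (S \<times> T) \<subseteq> ?A"
        using AB by blast
      have "restrict w = w"
      proof
        fix z show "restrict w z = w z"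
          using form_eq_0(3)[OF fine _ w, of z] sub unfolding restrict_def by auto
      qed
      then show ?thesis
        using v form_mono(2)[OF ST(3), of K1' K2'] unfolding curls_def by auto
    qed
  qed
  have linear: "restrict (c *\<^sub>R w + w') = c *\<^sub>R restrict w + restrict w'" for c w w'
    by (auto simp: restrict_def fun_eq_iff scaleR_fun_apply)
  have zero: "restrict 0 = 0"
    by (auto simp: restrict_def fun_eq_iff)
  from assms obtain v where v: "v \<in> form1 K1' K2' U" "curl_rel v w" by (auto simp: curls_def)
  \<comment> \<open>The curl is a relation, so the induction over the span constructs it along with
    the field; uniqueness then identifies it with the given \<open>w\<close>.\<close>
  have "\<exists>w. curl_rel v w \<and> restrict w \<in> curls K1' K2' U"
    using v(1) unfolding form1_def
  proof (induction rule: span_induct_alt)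
    case base
    show ?case
      using linear_rel_zero[OF linear_rel_curl] zero subspace_0[OF subspace_curls] by metis
  next
    case (step c h v)
    have "\<exists>w. curl_rel h w \<and> restrict w \<in> curls K1' K2' U"
    proof -
      obtain S T where h: "h \<in> form1 K1' K2' (S \<times> T)" and ST: "connected S" "connected T" "S \<times> T \<subseteq> U"
        using step.hyps(1)
      proof
        assume "h \<in> (\<lambda>(i, j). \<lambda>(x, y). (Ds K1' i x * Bs K2' j y, 0)) `
          {(i, j) \<in> {2..nspl K1'} \<times> {2..nspl K2' - 1}. SD K1' i \<times> SB K2' j \<subseteq> U}"
        then obtain i j where ij: "h = (\<lambda>(x, y). (Ds K1' i x * Bs K2' j y, 0))"
          "i \<in> {2..nspl K1'}" "j \<in> {2..nspl K2' - 1}" "SD K1' i \<times> SB K2' j \<subseteq> U" by auto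
        have "h \<in> form1 K1' K2' (SD K1' i \<times> SB K2' j)"
          unfolding form1_def ij(1) by (rule span_base, rule UnI1, rule image_eqI[of _ _ "(i, j)"]) (use ij in auto)
        then show thesis using ij(4) by (intro that) (auto simp: SD_def SB_def)
      next
        assume "h \<in> (\<lambda>(i, j). \<lambda>(x, y). (0, Bs K1' i x * Ds K2' j y)) `
          {(i, j) \<in> {2..nspl K1' - 1} \<times> {2..nspl K2'}. SB K1' i \<times> SD K2' j \<subseteq> U}"
        then obtain i j where ij: "h = (\<lambda>(x, y). (0, Bs K1' i x * Ds K2' j y))"
          "i \<in> {2..nspl K1' - 1}" "j \<in> {2..nspl K2'}" "SB K1' i \<times> SD K2' j \<subseteq> U" by auto
        have "h \<in> form1 K1' K2' (SB K1' i \<times> SD K2' j)"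
          unfolding form1_def ij(1) by (rule span_base, rule UnI2, rule image_eqI[of _ _ "(i, j)"]) (use ij in auto)
        then show thesis using ij(4) by (intro that) (auto simp: SD_def SB_def)
      qed
      obtain w where "curl_rel h w" using curl_form[OF fine h] by blast
      with side[OF h _ ST] show ?thesis by blast
    qed
    then obtain w where w: "curl_rel h w" "restrict w \<in> curls K1' K2' U" by blast
    from step.IH obtain w' where w': "curl_rel v w'" "restrict w' \<in> curls K1' K2' U" by blast
    have "curl_rel (c *\<^sub>R h + v) (c *\<^sub>R w + w')"
      by (rule linear_rel_add[OF linear_rel_curl, OF linear_rel_scale[OF linear_rel_curl, OF w(1)] w'(1)])
    moreover have "restrict (c *\<^sub>R w + w') \<in> curls K1' K2' U"
      unfolding linear using w w' by (intro subspace_add subspace_scale subspace_curls)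
    ultimately show ?case by blast
  qed
  then have "restrict w \<in> curls K1' K2' U"
    using linear_rel_unique[OF linear_rel_curl, OF v(2)] by blast
  then show ?thesis
    by (simp add: restrict_def case_prod_beta')
qed

text \<open>Injectivity in degree 2. Restricted to a component, \<open>a\<close> is still a fine
  curl, so the coefficients over each component sum to 0. Thus \<open>a\<close> is a combination of
  differences of densities from the same component, and these are coarse curls.\<close>

lemma coarse_curl:
  assumes a: "a \<in> form2 K1 K2 U" "a \<in> curls K1' K2' U"
  shows "a \<in> curls K1 K2 U"
proof -
  let ?D = "\<lambda>p. cell_density K1 K2 (fst p) (snd p)"
  from a(1) obtain c where ac: "a = density_form K1 K2 c" and c: "\<And>i j. c i j \<noteq> 0 \<Longrightarrow> (i, j) \<in> cells"
    unfolding form2_iff cells_iff by blast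
  let ?c = "\<lambda>p. c (fst p) (snd p)"
  have sub: "cells \<subseteq> {2..nspl K1} \<times> {2..nspl K2}" by (auto simp: cells_iff)
  have component_sum: "(\<Sum>q\<in>cells \<inter> component p. ?c q) = 0" for p
  proof -
    let ?r = "\<lambda>z. if \<exists>(i, j)\<in>cells \<inter> component p. z \<in> cell i j then a z else 0"
    let ?c' = "\<lambda>i j. if (i, j) \<in> component p then c i j else 0"
    \<comment> \<open>Cutting off the function amounts to cutting off coefficients: a density
      vanishes off its closed cell, and all cells through a common point belong to one
      component.\<close>
    have "?r = density_form K1 K2 ?c'"
    proof
      fix z :: "real \<times> real"
      obtain x y where z: "z = (x, y)" by force
      have vanish: "Ds K1 i x * Ds K2 j y = 0" if "(i, j) \<in> cells" "z \<notin> cell i j" for i j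
      proof -
        have "x \<notin> closure (SD K1 i) \<or> y \<notin> closure (SD K2 j)"
          using that cell_eq by (auto simp: closure_Times z)
        then show ?thesis
          using Ds_eq_0_closure[OF coarse(1), of i x] Ds_eq_0_closure[OF coarse(2), of j y] that
          by (auto simp: cells_iff)
      qed
      have "?c' i j * (Ds K1 i x * Ds K2 j y)
        = (if \<exists>(i, j)\<in>cells \<inter> component p. z \<in> cell i j then c i j * (Ds K1 i x * Ds K2 j y) else 0)" for i j
      proof (cases "c i j = 0 \<or> z \<notin> cell i j")
        case True
        then show ?thesis using c[of i j] vanish[of i j] by auto
      next
        case False
        then have "(i, j) \<in> cells" using c by auto
        have "(i, j) \<in> component p \<longleftrightarrow> (\<exists>(i, j)\<in>cells \<inter> component p. z \<in> cell i j)"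
        proof
          assume "\<exists>(i, j)\<in>cells \<inter> component p. z \<in> cell i j"
          then obtain k l where "(k, l) \<in> cells" "(k, l) \<in> component p" "z \<in> cell k l" by blast
          then have "(i, j) \<in> component (k, l)"
            using False \<open>(i, j) \<in> cells\<close> by (intro component_meet) auto
          with \<open>(k, l) \<in> component p\<close> show "(i, j) \<in> component p" by (rule component_trans)
        qed (use False \<open>(i, j) \<in> cells\<close> in blast)
        then show ?thesis by simp
      qed
      then show "?r z = density_form K1 K2 ?c' z"
        by (simp add: ac density_form_def z)
    qed
    then have "density_form K1 K2 ?c' \<in> curls K1' K2' U"
      using curl_restrict_component[OF a(2), of p] by simp
    then have "(\<Sum>i=2..nspl K1. \<Sum>j=2..nspl K2. ?c' i j) = 0"
      using curl_integral[OF fine] density_form_integral(2)[OF coarse, of ?c'] by simp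
    then have "(\<Sum>q\<in>{2..nspl K1} \<times> {2..nspl K2}. ?c' (fst q) (snd q)) = 0"
      by (simp add: sum.cartesian_product case_prod_beta')
    also have "(\<Sum>q\<in>{2..nspl K1} \<times> {2..nspl K2}. ?c' (fst q) (snd q)) = (\<Sum>q\<in>cells \<inter> component p. ?c q)"
      by (rule sum.mono_neutral_cong_right) (use sub c in auto)
    finally show ?thesis .
  qed
  \<comment> \<open>One member per component; the choice depends on the set only, so all indices of
    a component share it.\<close>
  define rep where "rep p = (SOME q. q \<in> component p)" for p
  have rep: "rep p \<in> component p" for p
  proof -
    have "p \<in> component p" by (simp add: component_def)
    then show ?thesis unfolding rep_def by (rule someI)
  qed
  have rep_eq: "rep q = rep p \<longleftrightarrow> q \<in> component p" for p q
  proof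
    assume "rep q = rep p"
    then show "q \<in> component p" using rep[of p] rep[of q] component_sym component_trans by metis
  next
    assume "q \<in> component p"
    then have "component q = component p" using component_sym component_trans by blast
    then show "rep q = rep p" by (simp add: rep_def)
  qed
  have "a = (\<Sum>p\<in>{2..nspl K1} \<times> {2..nspl K2}. ?c p *\<^sub>R ?D p)"
    unfolding ac density_form_sum by (simp add: case_prod_beta')
  also have "\<dots> = (\<Sum>p\<in>cells. ?c p *\<^sub>R ?D p)"
    by (rule sum.mono_neutral_right) (use sub c in auto)
  also have "\<dots> = (\<Sum>p\<in>cells. ?c p *\<^sub>R (?D p - ?D (rep p))) + (\<Sum>p\<in>cells. ?c p *\<^sub>R ?D (rep p))"
    by (simp only: scaleR_diff_right sum_subtractf diff_add_cancel)
  also have "(\<Sum>p\<in>cells. ?c p *\<^sub>R ?D (rep p)) = (\<Sum>r\<in>rep ` cells. \<Sum>p\<in>{p \<in> cells. rep p = r}. ?c p *\<^sub>R ?D (rep p))"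
    by (rule sum.group[symmetric]) (use finite_cells in auto)
  also have "\<dots> = 0"
  proof (rule sum.neutral, rule ballI)
    fix r assume "r \<in> rep ` cells"
    then obtain p where r: "r = rep p" by blast
    have "(\<Sum>q\<in>{q \<in> cells. rep q = rep p}. ?c q *\<^sub>R ?D (rep q)) = (\<Sum>q\<in>cells \<inter> component p. ?c q *\<^sub>R ?D (rep p))"
    proof (rule sum.cong)
      fix q assume "q \<in> cells \<inter> component p"
      then have "rep q = rep p" by (simp add: rep_eq)
      then show "?c q *\<^sub>R ?D (rep q) = ?c q *\<^sub>R ?D (rep p)" by (simp only:)
    qed (auto simp: rep_eq)
    also have "\<dots> = (\<Sum>q\<in>cells \<inter> component p. ?c q) *\<^sub>R ?D (rep p)"
      by (simp only: scaleR_sum_left)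
    finally show "(\<Sum>q\<in>{q \<in> cells. rep q = r}. ?c q *\<^sub>R ?D (rep q)) = 0"
      by (simp only: r component_sum scaleR_zero_left)
  qed
  finally have "a = (\<Sum>p\<in>cells. ?c p *\<^sub>R (?D p - ?D (rep p)))" by (simp only: add_0_right)
  also have "\<dots> \<in> curls K1 K2 U"
    using rep by (intro subspace_sum[OF subspace_curls] subspace_scale[OF subspace_curls] component_density_diff)
  finally show ?thesis .
qed

text \<open>The cells at the boundary of the unit square reach up to it, so a point close to the boundary and
  outside the subdomain can be joined to the complement of the unit square.\<close>

lemma potential_eq_0_near_boundary:
  assumes u: "u \<in> form0 K1' K2' Omega_hat" "grad_rel u v" "v \<in> form1 K1' K2' U"
    and z: "z \<in> SB K1 i \<times> SB K2 j" "z \<notin> closure U"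
    and ij: "i \<in> {1, nspl K1} \<and> j \<in> {1..nspl K2} \<or> i \<in> {1..nspl K1} \<and> j \<in> {1, nspl K2}"
  shows "u z = 0"
proof -
  obtain x y where xy: "z = (x, y)" by force
  have const: "u z1 = u z2" if "connected C" "C \<subseteq> - closure U" "z1 \<in> C" "z2 \<in> C" for z1 z2 C
    using grad_zero_constant[OF form0_continuous[OF fine u(1)] u(2) _ _ that] form_eq_0(2)[OF fine _ u(3)]
    by auto
  have out: "u (s, t) = 0" if "s < 0 \<or> 1 < s \<or> t < 0 \<or> 1 < t" for s t
  proof (rule form_eq_0(1)[OF fine _ u(1)])
    have "closure Omega_hat = {0..1} \<times> {0..1}" by (simp add: Omega_hat_def closure_Times)
    then show "(s, t) \<notin> closure Omega_hat" using that by auto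
  qed
  have left: "kn K t \<le> x" if "open_knot_vector K" "x \<in> SB K 1" "s \<le> x" "kn K t \<le> s" for K s t x
    using that kn_eq_0[OF that(1), of t] monoD[OF mono_kn[OF that(1)], of "1 + deg K + 1" t]
    by (cases "t \<le> deg K + 1") (auto simp: SB_def)
  \<comment> \<open>The first support ends at the knot \<open>deg K + 2\<close>, and no cell ends
    before it. A cell that meets the segment from \<open>z\<close> to the left therefore contains
    \<open>z\<close>; the other three sides are treated similarly.\<close>
  have left': "x \<le> kn K (t + deg K)" if "open_knot_vector K" "x \<in> SB K 1" "2 \<le> t" for K t x
    using that monoD[OF mono_kn[OF that(1)], of "1 + deg K + 1" "t + deg K"] by (auto simp: SB_def)
  have right: "x \<le> kn K (t + deg K)" if "open_knot_vector K" "x \<in> SB K (nspl K)" "x \<le> s" "s \<le> kn K (t + deg K)" for K s t x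
    using that kn_eq_1[OF that(1), of "t + deg K"] kn_bounds(2)[OF that(1), of "nspl K + deg K + 1"]
      monoD[OF mono_kn[OF that(1)], of "t + deg K" "nspl K"]
    by (cases "t + deg K \<le> nspl K") (auto simp: SB_def)
  have right': "kn K t \<le> x" if "open_knot_vector K" "x \<in> SB K (nspl K)" "t \<le> nspl K" for K t x
    using that monoD[OF mono_kn[OF that(1)], of t "nspl K"] by (auto simp: SB_def)
  have cell_iff: "(s, t) \<in> cell k l \<longleftrightarrow> kn K1 k \<le> s \<and> s \<le> kn K1 (k + deg K1) \<and> kn K2 l \<le> t \<and> t \<le> kn K2 (l + deg K2)" for s t k l
    by (auto simp: cell_def)
  have not_U: "(s, t) \<notin> closure U"
    if "\<And>k l. (k, l) \<in> cells \<Longrightarrow> (s, t) \<in> cell k l \<Longrightarrow> (x, y) \<in> cell k l" for s t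
  proof
    assume "(s, t) \<in> closure U"
    then obtain k l where "(k, l) \<in> cells" "(s, t) \<in> cell k l" by (subst (asm) M_eq) blast
    then have "(x, y) \<in> closure U" using that[of k l] by (subst M_eq) blast
    then show False using z xy by simp
  qed
  consider "i = 1" | "i = nspl K1" | "j = 1" | "j = nspl K2" using ij by auto
  then show ?thesis
  proof cases
    case 1
    \<comment> \<open>The segment ends at abscissa -1, outside the closed square, where the
      potential is 0.\<close>
    have "{- 1..x} \<times> {y} \<subseteq> - closure U"
    proof clarify
      fix s assume s: "s \<in> {- 1..x}" "(s, y) \<in> closure U"
      moreover have "(s, y) \<notin> closure U"
        using s(1) z 1 left[OF coarse(1), of x s] left'[OF coarse(1), of x]
        by (intro not_U) (auto simp: cell_iff cells_iff xy)
      ultimately show False by simp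
    qed
    then have "u z = u (- 1, y)"
      using SB_SD_bounds(1)[OF coarse(1), of i] z
      by (intro const[of "{- 1..x} \<times> {y}"] connected_Times) (auto simp: xy)
    then show ?thesis using out by simp
  next
    case 2
    have "{x..2} \<times> {y} \<subseteq> - closure U"
    proof clarify
      fix s assume s: "s \<in> {x..2}" "(s, y) \<in> closure U"
      moreover have "(s, y) \<notin> closure U"
        using s(1) z 2 right[OF coarse(1), of x s] right'[OF coarse(1), of x]
        by (intro not_U) (auto simp: cell_iff cells_iff xy)
      ultimately show False by simp
    qed
    then have "u z = u (2, y)"
      using SB_SD_bounds(1)[OF coarse(1), of i] z
      by (intro const[of "{x..2} \<times> {y}"] connected_Times) (auto simp: xy)
    then show ?thesis using out by simp
  next
    case 3
    have "{x} \<times> {- 1..y} \<subseteq> - closure U"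
    proof clarify
      fix s assume s: "s \<in> {- 1..y}" "(x, s) \<in> closure U"
      moreover have "(x, s) \<notin> closure U"
        using s(1) z 3 left[OF coarse(2), of y s] left'[OF coarse(2), of y]
        by (intro not_U) (auto simp: cell_iff cells_iff xy)
      ultimately show False by simp
    qed
    then have "u z = u (x, - 1)"
      using SB_SD_bounds(1)[OF coarse(2), of j] z
      by (intro const[of "{x} \<times> {- 1..y}"] connected_Times) (auto simp: xy)
    then show ?thesis using out by simp
  next
    case 4
    have "{x} \<times> {y..2} \<subseteq> - closure U"
    proof clarify
      fix s assume s: "s \<in> {y..2}" "(x, s) \<in> closure U"
      moreover have "(x, s) \<notin> closure U"
        using s(1) z 4 right[OF coarse(2), of y s] right'[OF coarse(2), of y]
        by (intro not_U) (auto simp: cell_iff cells_iff xy)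
      ultimately show False by simp
    qed
    then have "u z = u (x, 2)"
      using SB_SD_bounds(1)[OF coarse(2), of j] z
      by (intro const[of "{x} \<times> {y..2}"] connected_Times) (auto simp: xy)
    then show ?thesis using out by simp
  qed
qed

text \<open>A potential of a closed field is locally constant off the subdomain. As the overlaps are
  connected, its values there can serve as coefficients of coarse B-splines, and by the partition of
  unity the resulting coarse spline agrees with the potential off the subdomain.\<close>

lemma closed_form_decompose:
  assumes f: "f \<in> form1 K1' K2' U" "curl_rel f 0"
  obtains a g where "a \<in> form1 K1 K2 U" "curl_rel a 0" "g \<in> form0 K1' K2' U" "grad_rel g (f - a)"
proof -
  have "f \<in> form1 K1' K2' Omega_hat"
    using f(1) form_mono(2)[OF in_unit_square] by blast
  from closed_form_exact[OF fine this f(2)] obtain u where u: "u \<in> form0 K1' K2' Omega_hat" "grad_rel u f" by blast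
  \<comment> \<open>Supports inside the closure of \<open>U\<close> do not reach the points to be
    matched, so their coefficient is free and set to 0.\<close>
  define c where "c i j = (if i \<in> {2..nspl K1 - 1} \<and> j \<in> {2..nspl K2 - 1} \<and> \<not> SB K1 i \<times> SB K2 j \<subseteq> closure U
    then u (SOME z. z \<in> SB K1 i \<times> SB K2 j - closure U) else 0)" for i j
  \<comment> \<open>Boundary indices carry the coefficient 0, which agrees with the potential
    because it vanishes on their supports off the closure of \<open>U\<close>.\<close>
  have cu: "c i j = u z" if ij: "i \<in> {1..nspl K1}" "j \<in> {1..nspl K2}" and z: "z \<in> SB K1 i \<times> SB K2 j" "z \<notin> closure U" for i j z
  proof (cases "i \<in> {2..nspl K1 - 1} \<and> j \<in> {2..nspl K2 - 1}")
    case True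
    let ?C = "SB K1 i \<times> SB K2 j - closure U"
    have "(SOME z. z \<in> ?C) \<in> ?C" by (rule someI[of _ z]) (use z in auto)
    moreover have "z \<in> ?C" using z by simp
    moreover have "connected ?C" using connected_overlap True by blast
    ultimately have "u (SOME z. z \<in> ?C) = u z"
      using form_eq_0(2)[OF fine _ f(1)]
      by (intro grad_zero_constant[OF form0_continuous[OF fine u(1)] u(2), of "- closure U" ?C]) auto
    then show ?thesis using True z by (auto simp: c_def)
  next
    case False
    then have "c i j = 0" unfolding c_def by auto
    moreover have "i \<in> {1, nspl K1} \<or> j \<in> {1, nspl K2}" using False ij by auto
    then have "u z = 0"
      using potential_eq_0_near_boundary[OF u f(1) z] ij by blast
    ultimately show ?thesis by simp
  qed
  define h where "h = scalar_form K1 K2 c"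
  have h: "h \<in> form0 K1 K2 Omega_hat"
    unfolding form0_iff h_def using support_in_unit_square[OF coarse]
    by (intro exI[of _ c]) (auto simp: c_def split: if_splits)
  have agree: "h z = u z" if z: "z \<in> Omega_hat" "z \<notin> closure U" for z
  proof -
    obtain x y where xy: "z = (x, y)" by force
    have bounds: "0 < x" "x < 1" "0 < y" "y < 1" using z(1) by (auto simp: Omega_hat_def xy)
    have "h z = (\<Sum>i=1..nspl K1. \<Sum>j=1..nspl K2. u z * (Bs K1 i x * Bs K2 j y))"
      unfolding h_def scalar_form_def xy split_conv
    proof (intro sum.cong refl)
      fix i j assume ij: "i \<in> {1..nspl K1}" "j \<in> {1..nspl K2}"
      show "c i j * (Bs K1 i x * Bs K2 j y) = u (x, y) * (Bs K1 i x * Bs K2 j y)"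
      proof (cases "x \<in> SB K1 i \<and> y \<in> SB K2 j")
        case True
        then show ?thesis using cu[OF ij, of z] z(2) by (simp add: xy)
      next
        case False
        then have "Bs K1 i x = 0 \<or> Bs K2 j y = 0"
          using Bs_eq_0_notin_SB[OF coarse(1), of x i] Bs_eq_0_notin_SB[OF coarse(2), of y j] ij bounds by auto
        then show ?thesis by auto
      qed
    qed
    also have "\<dots> = u z * ((\<Sum>i=1..nspl K1. Bs K1 i x) * (\<Sum>j=1..nspl K2. Bs K2 j y))"
      by (simp only: sum_product) (simp only: sum_distrib_left)
    also have "\<dots> = u z"
      using bounds Bs_sum[OF coarse(1), of x] Bs_sum[OF coarse(2), of y] by (simp only: less_imp_le mult_1_right)
    finally show ?thesis .
  qed
  define a where "a = vector_form K1 K2 (\<lambda>i j. c i j - c (i - 1) j) (\<lambda>i j. c i j - c i (j - 1))"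
  have ha: "grad_rel h a"
    unfolding h_def a_def by (rule grad_scalar_form[OF coarse])
  \<comment> \<open>The support of a basis field lies in the supports of both neighbouring scalar
    functions. At a point of it off the closure of \<open>U\<close>, both coefficients would equal
    the potential and their difference would be 0.\<close>
  have "a \<in> form1 K1 K2 U"
    unfolding form1_iff a_def
  proof (intro exI conjI allI impI refl)
    fix i j assume ne: "c i j - c (i - 1) j \<noteq> 0"
    then have "c i j \<noteq> 0 \<or> c (i - 1) j \<noteq> 0" by auto
    then have ij: "i \<in> {2..nspl K1}" "j \<in> {2..nspl K2 - 1}" by (auto simp: c_def split: if_splits)
    show "i \<in> {2..nspl K1}" "j \<in> {2..nspl K2 - 1}" by fact+
    show "SD K1 i \<times> SB K2 j \<subseteq> U"
    proof (rule ccontr)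
      assume "\<not> SD K1 i \<times> SB K2 j \<subseteq> U"
      then obtain z where z: "z \<in> SD K1 i \<times> SB K2 j" "z \<notin> closure U"
        using open_subset_regular[OF open_Times[OF open_SD open_SB] regular] by blast
      then have "z \<in> SB K1 i \<times> SB K2 j" "z \<in> SB K1 (i - 1) \<times> SB K2 j"
        using SD_subset_SB[OF coarse(1), of i] ij by auto
      moreover have "i \<in> {1..nspl K1}" "i - 1 \<in> {1..nspl K1}" "j \<in> {1..nspl K2}" using ij by auto
      ultimately show False using ne cu[of i j z] cu[of "i - 1" j z] z(2) by simp
    qed
  next
    fix i j assume ne: "c i j - c i (j - 1) \<noteq> 0"
    then have "c i j \<noteq> 0 \<or> c i (j - 1) \<noteq> 0" by auto
    then have ij: "i \<in> {2..nspl K1 - 1}" "j \<in> {2..nspl K2}" by (auto simp: c_def split: if_splits)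
    show "i \<in> {2..nspl K1 - 1}" "j \<in> {2..nspl K2}" by fact+
    show "SB K1 i \<times> SD K2 j \<subseteq> U"
    proof (rule ccontr)
      assume "\<not> SB K1 i \<times> SD K2 j \<subseteq> U"
      then obtain z where z: "z \<in> SB K1 i \<times> SD K2 j" "z \<notin> closure U"
        using open_subset_regular[OF open_Times[OF open_SB open_SD] regular] by blast
      then have "z \<in> SB K1 i \<times> SB K2 j" "z \<in> SB K1 i \<times> SB K2 (j - 1)"
        using SD_subset_SB[OF coarse(2), of j] ij by auto
      moreover have "i \<in> {1..nspl K1}" "j \<in> {1..nspl K2}" "j - 1 \<in> {1..nspl K2}" using ij by auto
      ultimately show False using ne cu[of i j z] cu[of i "j - 1" z] z(2) by simp
    qed
  qed (rule refl)
  moreover have "curl_rel a 0"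
    by (rule curl_grad[OF coarse h ha])
  moreover have "u - h \<in> form0 K1' K2' U"
  proof (rule form0_vanishing[OF fine _ regular])
    show "u - h \<in> form0 K1' K2' Omega_hat"
      using u(1) h form_subset(1) by (intro subspace_diff[OF subspace_form(1)]) auto
    show "(u - h) z = 0" if "z \<in> Omega_hat - closure U" for z
      using that agree[of z] by simp
  qed
  moreover have "grad_rel (u - h) (f - a)"
    by (rule linear_rel_diff[OF linear_rel_grad, OF u(2) ha])
  ultimately show ?thesis by (rule that)
qed

end

section \<open>Hierarchical spaces\<close>

text \<open>Functions of earlier levels with support in \<open>\<Omega> l\<close> were removed when
  level \<open>l\<close> was added.\<close>

lemma hier_basis_level:
  assumes "\<beta> \<in> hier_basis B \<Omega> l" "supp \<beta> \<subseteq> V" "V \<subseteq> \<Omega> l"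
  shows "\<beta> \<in> B l"
  using assms by (cases l) auto

lemma hier_basis_contains:
  assumes "\<beta> \<in> B l" "supp \<beta> \<subseteq> \<Omega> l"
  shows "\<beta> \<in> hier_basis B \<Omega> l"
  using assms by (cases l) auto

lemma hier_space_contains:
  assumes "\<Omega> (Suc l) \<subseteq> \<Omega> l"
  shows "span (fst ` {\<beta> \<in> B l. supp \<beta> \<subseteq> \<Omega> (Suc l)}) \<subseteq> hier_space B \<Omega> l"
  unfolding hier_space_def using assms hier_basis_contains[of _ B l \<Omega>]
  by (intro span_mono image_mono subsetI) blast

text \<open>The functions removed in this step are of level \<open>l\<close> by
  \<open>hier_basis_level\<close> and supported in the new subdomain, so by \<open>nested\<close>
  they are combinations of the added ones.\<close>

lemma hier_space_Suc:
  assumes "\<Omega> (Suc l) \<subseteq> \<Omega> l"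
    and nested: "span (fst ` {\<beta> \<in> B l. supp \<beta> \<subseteq> \<Omega> (Suc l)}) \<subseteq> span (fst ` {\<beta> \<in> B (Suc l). supp \<beta> \<subseteq> \<Omega> (Suc l)})"
  shows "v \<in> hier_space B \<Omega> (Suc l) \<longleftrightarrow>
    (\<exists>c\<in>hier_space B \<Omega> l. \<exists>f\<in>span (fst ` {\<beta> \<in> B (Suc l). supp \<beta> \<subseteq> \<Omega> (Suc l)}). v = c + f)"
proof -
  let ?F = "fst ` {\<beta> \<in> B (Suc l). supp \<beta> \<subseteq> \<Omega> (Suc l)}"
  have "hier_space B \<Omega> (Suc l) = span (fst ` hier_basis B \<Omega> l \<union> ?F)"
    unfolding hier_space_def
  proof (rule subset_antisym)
    show "span (fst ` hier_basis B \<Omega> (Suc l)) \<subseteq> span (fst ` hier_basis B \<Omega> l \<union> ?F)"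
      by (intro span_mono) auto
    have F: "?F \<subseteq> fst ` hier_basis B \<Omega> (Suc l)" by auto
    have "fst \<beta> \<in> span (fst ` hier_basis B \<Omega> (Suc l))" if \<beta>: "\<beta> \<in> hier_basis B \<Omega> l" for \<beta>
    proof (cases "supp \<beta> \<subseteq> \<Omega> (Suc l)")
      case True
      then have "\<beta> \<in> B l" using hier_basis_level[OF \<beta> _ assms(1)] by blast
      then have "fst \<beta> \<in> span (fst ` {\<beta> \<in> B l. supp \<beta> \<subseteq> \<Omega> (Suc l)})"
        using True by (intro span_base imageI) auto
      then show ?thesis using nested span_mono[OF F] by blast
    next
      case False
      then show ?thesis using \<beta> by (intro span_base imageI) auto
    qed
    then have "fst ` hier_basis B \<Omega> l \<union> ?F \<subseteq> span (fst ` hier_basis B \<Omega> (Suc l))"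
      using F span_superset[of "fst ` hier_basis B \<Omega> (Suc l)"] by blast
    then show "span (fst ` hier_basis B \<Omega> l \<union> ?F) \<subseteq> span (fst ` hier_basis B \<Omega> (Suc l))"
      by (rule span_minimal) simp
  qed
  then have "v \<in> hier_space B \<Omega> (Suc l) \<longleftrightarrow> (\<exists>c f. c \<in> span (fst ` hier_basis B \<Omega> l) \<and> f \<in> span ?F \<and> v = c + f)"
    by (auto simp: span_Un)
  then show ?thesis by (auto simp: hier_space_def)
qed

lemma form_unit_square:
  assumes "open_knot_vector K1" "open_knot_vector K2"
  shows "form0 K1 K2 UNIV = form0 K1 K2 Omega_hat" "form1 K1 K2 UNIV = form1 K1 K2 Omega_hat"
    "form2 K1 K2 UNIV = form2 K1 K2 Omega_hat"
  unfolding form0_def form1_def form2_def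
  by (simp_all only: support_in_unit_square[OF assms] subset_UNIV)

lemma interior_closure_unit_square: "interior (closure Omega_hat) = Omega_hat"
  by (simp add: Omega_hat_def closure_Times interior_Times)

text \<open>On the unit square any two densities differ by a curl. As the coefficients sum to 0, one
  fixed density can be subtracted from all of them; the index \<open>(2, 2)\<close> always
  exists.\<close>

lemma integral_zero_imp_curl:
  assumes K: "open_knot_vector K1" "open_knot_vector K2" and w: "w \<in> form2 K1 K2 Omega_hat"
    and zero: "(LINT z:Omega_hat|lborel. w z) = 0"
  shows "w \<in> curls K1 K2 Omega_hat"
proof -
  let ?I = "{2..nspl K1} \<times> {2..nspl K2}" and ?D = "\<lambda>p. cell_density K1 K2 (fst p) (snd p)"
  from w obtain c where c: "w = density_form K1 K2 c" unfolding form2_iff by blast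
  let ?c = "\<lambda>p. c (fst p) (snd p)"
  have "(\<Sum>p\<in>?I. ?c p) = 0"
    using zero density_form_integral(2)[OF K, of c] by (simp add: c sum.cartesian_product case_prod_beta')
  then have "w = (\<Sum>p\<in>?I. ?c p *\<^sub>R ?D p) - (\<Sum>p\<in>?I. ?c p) *\<^sub>R ?D (2, 2)"
    by (simp only: scaleR_zero_left diff_zero c density_form_sum case_prod_beta')
  also have "\<dots> = (\<Sum>p\<in>?I. ?c p *\<^sub>R (?D p - ?D (2, 2)))"
    by (simp only: scaleR_sum_left scaleR_diff_right sum_subtractf)
  also have "\<dots> \<in> curls K1 K2 Omega_hat"
  proof (intro subspace_sum[OF subspace_curls] subspace_scale[OF subspace_curls])
    fix p assume "p \<in> ?I"
    moreover have "(2, 2) \<in> ?I"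
      using deg_less_nspl[OF K(1)] deg_pos[OF K(1)] deg_less_nspl[OF K(2)] deg_pos[OF K(2)] by auto
    ultimately show "?D p - ?D (2, 2) \<in> curls K1 K2 Omega_hat"
      using support_in_unit_square(4)[OF K]
      by (intro densities_in_rectangle[OF K interior_closure_unit_square, of _ _ _ _ 0 1 0 1])
        (auto simp: Omega_hat_def)
  qed
  finally show ?thesis .
qed

section \<open>Induction over the levels\<close>

context
  fixes N :: nat and K1 K2 :: "nat \<Rightarrow> knot_vector" and \<Omega> :: "nat \<Rightarrow> (real \<times> real) set"
  assumes levels: "nested_spline_levels N K1 K2"
    and subdomains: "nested_subdomains N K1 K2 \<Omega>"
    and union_of_supports:
      "\<And>l. l < N \<Longrightarrow> \<exists>S \<subseteq> basis2 (K1 l) (K2 l). closure (\<Omega> (Suc l)) = closure (\<Union>\<beta>\<in>S. supp \<beta>)"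
    and overlaps:
      "\<And>l T. l < N \<Longrightarrow> T \<in> supp ` basis0 (K1 l) (K2 l) \<Longrightarrow> connected (T \<inter> (\<Omega> 0 - closure (\<Omega> (Suc l))))"
begin

lemma level_knots: "l \<le> N \<Longrightarrow> open_knot_vector (K1 l)" "l \<le> N \<Longrightarrow> open_knot_vector (K2 l)"
  using levels by (auto simp: nested_spline_levels_def)

lemma level_domain: "l \<le> N \<Longrightarrow> interior (closure (\<Omega> l)) = \<Omega> l" "l \<le> N \<Longrightarrow> \<Omega> (Suc l) \<subseteq> \<Omega> l"
  using subdomains by (auto simp: nested_subdomains_def)

lemma level_domain_unit: "l \<le> N \<Longrightarrow> \<Omega> l \<subseteq> Omega_hat"
proof (induction l)
  case 0
  then show ?case using subdomains by (simp add: nested_subdomains_def)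
next
  case (Suc l)
  then show ?case using level_domain(2)[of l] by auto
qed

lemma level_refinement:
  assumes l: "l < N"
  shows "refinement (K1 l) (K2 l) (K1 (Suc l)) (K2 (Suc l)) (\<Omega> (Suc l))"
proof
  have lN: "l \<le> N" "Suc l \<le> N" using l by auto
  show coarse: "open_knot_vector (K1 l)" "open_knot_vector (K2 l)"
    and "open_knot_vector (K1 (Suc l))" "open_knot_vector (K2 (Suc l))"
    using level_knots lN by auto
  have "tensor_space (spline_space (K1 l)) (spline_space (K2 l)) \<subseteq>
      tensor_space (spline_space (K1 (Suc l))) (spline_space (K2 (Suc l)))"
    using levels l by (simp add: nested_spline_levels_def)
  then show "spline_space (K1 l) \<subseteq> spline_space (K1 (Suc l))" "spline_space (K2 l) \<subseteq> spline_space (K2 (Suc l))"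
    by (rule nested_spline_spaces[OF coarse])+
  show regular: "interior (closure (\<Omega> (Suc l))) = \<Omega> (Suc l)"
    by (rule level_domain(1)[OF lN(2)])
  show "\<Omega> (Suc l) \<subseteq> Omega_hat"
    by (rule level_domain_unit[OF lN(2)])
  have basis2: "basis2 (K1 l) (K2 l) = (\<lambda>(i, j). (\<lambda>(x, y). Ds (K1 l) i x * Ds (K2 l) j y, SD (K1 l) i \<times> SD (K2 l) j)) `
      ({2..nspl (K1 l)} \<times> {2..nspl (K2 l)})"
    unfolding basis2_def D_all_eq[OF coarse(1)] D_all_eq[OF coarse(2)] by (rule image_pairs_eq)
  let ?I = "{(i, j) \<in> {2..nspl (K1 l)} \<times> {2..nspl (K2 l)}. SD (K1 l) i \<times> SD (K2 l) j \<subseteq> \<Omega> (Suc l)}"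
  show "closure (\<Omega> (Suc l)) = (\<Union>(i, j)\<in>?I. closure (SD (K1 l) i \<times> SD (K2 l) j))"
  proof (rule subset_antisym)
    obtain S where S: "S \<subseteq> basis2 (K1 l) (K2 l)" "closure (\<Omega> (Suc l)) = closure (\<Union>\<beta>\<in>S. supp \<beta>)"
      using union_of_supports[OF l] by blast
    \<comment> \<open>A support from \<open>S\<close> lies in the interior of the closure of the
      subdomain, which is the subdomain itself, so it is one of the cells in
      \<open>?I\<close>.\<close>
    have "supp \<beta> \<subseteq> (\<Union>(i, j)\<in>?I. closure (SD (K1 l) i \<times> SD (K2 l) j))" if "\<beta> \<in> S" for \<beta>
    proof -
      from that S(1) basis2 obtain i j where ij: "i \<in> {2..nspl (K1 l)}" "j \<in> {2..nspl (K2 l)}"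
        "supp \<beta> = SD (K1 l) i \<times> SD (K2 l) j" by auto
      have "supp \<beta> \<subseteq> (\<Union>\<beta>\<in>S. supp \<beta>)" using that by blast
      also have "\<dots> \<subseteq> closure (\<Omega> (Suc l))" unfolding S(2) by (rule closure_subset)
      finally have "supp \<beta> \<subseteq> closure (\<Omega> (Suc l))" .
      then have "SD (K1 l) i \<times> SD (K2 l) j \<subseteq> interior (closure (\<Omega> (Suc l)))"
        unfolding ij(3) by (intro interior_maximal open_Times open_SD)
      then have "(i, j) \<in> ?I" using ij regular by auto
      then show ?thesis unfolding ij(3) using closure_subset[of "SD (K1 l) i \<times> SD (K2 l) j"] by blast
    qed
    moreover have "closed (\<Union>(i, j)\<in>?I. closure (SD (K1 l) i \<times> SD (K2 l) j))"
    proof (rule closed_UN)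
      show "finite ?I" by (rule finite_subset[of _ "{2..nspl (K1 l)} \<times> {2..nspl (K2 l)}"]) auto
    qed auto
    ultimately show "closure (\<Omega> (Suc l)) \<subseteq> (\<Union>(i, j)\<in>?I. closure (SD (K1 l) i \<times> SD (K2 l) j))"
      unfolding S(2) by (intro closure_minimal) blast+
    show "(\<Union>(i, j)\<in>?I. closure (SD (K1 l) i \<times> SD (K2 l) j)) \<subseteq> closure (\<Omega> (Suc l))"
      by (auto intro: closure_mono[THEN subsetD])
  qed
  fix i j assume ij: "i \<in> {2..nspl (K1 l) - 1}" "j \<in> {2..nspl (K2 l) - 1}"
  have "basis0 (K1 l) (K2 l) = (\<lambda>(i, j). (\<lambda>(x, y). Bs (K1 l) i x * Bs (K2 l) j y, SB (K1 l) i \<times> SB (K2 l) j)) `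
      ({2..nspl (K1 l) - 1} \<times> {2..nspl (K2 l) - 1})"
    unfolding basis0_def B_ring_eq[OF coarse(1)] B_ring_eq[OF coarse(2)] by (rule image_pairs_eq)
  moreover have "(i, j) \<in> {2..nspl (K1 l) - 1} \<times> {2..nspl (K2 l) - 1}" using ij by blast
  ultimately have "((\<lambda>(x, y). Bs (K1 l) i x * Bs (K2 l) j y), SB (K1 l) i \<times> SB (K2 l) j) \<in> basis0 (K1 l) (K2 l)"
    by (simp only:) (rule image_eqI[of _ _ "(i, j)"], simp_all)
  from imageI[OF this, of snd] have "SB (K1 l) i \<times> SB (K2 l) j \<in> supp ` basis0 (K1 l) (K2 l)"
    by (simp only: snd_conv)
  from overlaps[OF l this]
  have "connected (SB (K1 l) i \<times> SB (K2 l) j \<inter> (\<Omega> 0 - closure (\<Omega> (Suc l))))" .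
  moreover have "SB (K1 l) i \<times> SB (K2 l) j \<subseteq> \<Omega> 0"
    using support_in_unit_square(1)[OF coarse] subdomains by (simp add: nested_subdomains_def)
  then have "SB (K1 l) i \<times> SB (K2 l) j \<inter> (\<Omega> 0 - closure (\<Omega> (Suc l))) = SB (K1 l) i \<times> SB (K2 l) j - closure (\<Omega> (Suc l))"
    by blast
  ultimately show "connected (SB (K1 l) i \<times> SB (K2 l) j - closure (\<Omega> (Suc l)))" by (simp only:)
qed

abbreviation W0 where "W0 \<equiv> hier_space (\<lambda>l. basis0 (K1 l) (K2 l)) \<Omega>"
abbreviation W1 where "W1 \<equiv> hier_space (\<lambda>l. basis1 (K1 l) (K2 l)) \<Omega>"
abbreviation W2 where "W2 \<equiv> hier_space (\<lambda>l. basis2 (K1 l) (K2 l)) \<Omega>"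
abbreviation V0 where "V0 l \<equiv> form0 (K1 l) (K2 l)"
abbreviation V1 where "V1 l \<equiv> form1 (K1 l) (K2 l)"
abbreviation V2 where "V2 l \<equiv> form2 (K1 l) (K2 l)"

lemma W_base: "W0 0 = V0 0 Omega_hat" "W1 0 = V1 0 Omega_hat" "W2 0 = V2 0 Omega_hat"
proof -
  note K = level_knots[OF le0]
  show "W0 0 = V0 0 Omega_hat" "W1 0 = V1 0 Omega_hat" "W2 0 = V2 0 Omega_hat"
    using span_basis[OF K, of UNIV] by (simp_all add: hier_space_def form_unit_square[OF K])
qed

lemma W_Suc:
  assumes "l < N"
  shows "v0 \<in> W0 (Suc l) \<longleftrightarrow> (\<exists>c\<in>W0 l. \<exists>f\<in>V0 (Suc l) (\<Omega> (Suc l)). v0 = c + f)"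
    "v1 \<in> W1 (Suc l) \<longleftrightarrow> (\<exists>c\<in>W1 l. \<exists>f\<in>V1 (Suc l) (\<Omega> (Suc l)). v1 = c + f)"
    "v2 \<in> W2 (Suc l) \<longleftrightarrow> (\<exists>c\<in>W2 l. \<exists>f\<in>V2 (Suc l) (\<Omega> (Suc l)). v2 = c + f)"
proof -
  interpret refinement "K1 l" "K2 l" "K1 (Suc l)" "K2 (Suc l)" "\<Omega> (Suc l)"
    by (rule level_refinement[OF assms])
  have sub: "\<Omega> (Suc l) \<subseteq> \<Omega> l" using level_domain(2) assms by auto
  show "v0 \<in> W0 (Suc l) \<longleftrightarrow> (\<exists>c\<in>W0 l. \<exists>f\<in>V0 (Suc l) (\<Omega> (Suc l)). v0 = c + f)"
    by (rule hier_space_Suc[OF sub, of "\<lambda>l. basis0 (K1 l) (K2 l)",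
          unfolded span_basis[OF coarse] span_basis[OF fine], OF form_subset(1)])
  show "v1 \<in> W1 (Suc l) \<longleftrightarrow> (\<exists>c\<in>W1 l. \<exists>f\<in>V1 (Suc l) (\<Omega> (Suc l)). v1 = c + f)"
    by (rule hier_space_Suc[OF sub, of "\<lambda>l. basis1 (K1 l) (K2 l)",
          unfolded span_basis[OF coarse] span_basis[OF fine], OF form_subset(2)])
  show "v2 \<in> W2 (Suc l) \<longleftrightarrow> (\<exists>c\<in>W2 l. \<exists>f\<in>V2 (Suc l) (\<Omega> (Suc l)). v2 = c + f)"
    by (rule hier_space_Suc[OF sub, of "\<lambda>l. basis2 (K1 l) (K2 l)",
          unfolded span_basis[OF coarse] span_basis[OF fine], OF form_subset(3)])
qed

lemma V_subset_W:
  assumes "l < N"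
  shows "V1 l (\<Omega> (Suc l)) \<subseteq> W1 l" "V2 l (\<Omega> (Suc l)) \<subseteq> W2 l"
proof -
  have "l \<le> N" using assms by simp
  note K = level_knots[OF this] and sub = level_domain(2)[OF this]
  show "V1 l (\<Omega> (Suc l)) \<subseteq> W1 l" "V2 l (\<Omega> (Suc l)) \<subseteq> W2 l"
    using hier_space_contains[of \<Omega> l, OF sub, of "\<lambda>l. basis1 (K1 l) (K2 l)"]
      hier_space_contains[of \<Omega> l, OF sub, of "\<lambda>l. basis2 (K1 l) (K2 l)"]
    by (simp_all add: span_basis[OF K])
qed

lemma subspace_W: "subspace (W0 l)" "subspace (W1 l)" "subspace (W2 l)"
  by (simp_all add: hier_space_def)

text \<open>Hierarchical functions are thus forms of a single level, from which they inherit
  coefficients, integrability and one-sided continuity.\<close>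

lemma W_subset_V:
  assumes "l \<le> N"
  shows "W0 l \<subseteq> V0 l Omega_hat \<and> W1 l \<subseteq> V1 l Omega_hat \<and> W2 l \<subseteq> V2 l Omega_hat"
  using assms
proof (induction l)
  case 0
  then show ?case by (simp add: W_base)
next
  case (Suc l)
  then have l: "l < N" by simp
  interpret refinement "K1 l" "K2 l" "K1 (Suc l)" "K2 (Suc l)" "\<Omega> (Suc l)"
    by (rule level_refinement[OF l])
  have "W0 l \<subseteq> V0 (Suc l) Omega_hat" "W1 l \<subseteq> V1 (Suc l) Omega_hat" "W2 l \<subseteq> V2 (Suc l) Omega_hat"
    using Suc form_subset[of Omega_hat] by auto
  then show ?case
    using form_mono[OF in_unit_square, of "K1 (Suc l)" "K2 (Suc l)"]
    by (auto simp: W_Suc[OF l] intro!: subspace_add subspace_form)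
qed

lemma W_maps:
  assumes "l \<le> N"
  shows "(\<forall>u\<in>W0 l. \<exists>v\<in>W1 l. grad_rel u v) \<and> (\<forall>v\<in>W1 l. \<exists>w\<in>W2 l. curl_rel v w)"
  using assms
proof (induction l)
  case 0
  note K = level_knots[OF le0]
  show ?case using grad_form[OF K] curl_form[OF K] by (auto simp: W_base)
next
  case (Suc l)
  then have l: "l < N" by simp
  note K = level_knots[OF Suc.prems]
  have "\<exists>v\<in>W1 (Suc l). grad_rel u v" if u: "u \<in> W0 (Suc l)" for u
  proof -
    from u obtain c f where cf: "c \<in> W0 l" "f \<in> V0 (Suc l) (\<Omega> (Suc l))" "u = c + f"
      unfolding W_Suc[OF l] by blast
    from cf(1) Suc obtain c' where c': "c' \<in> W1 l" "grad_rel c c'" by auto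
    from grad_form[OF K cf(2)] obtain f' where f': "f' \<in> V1 (Suc l) (\<Omega> (Suc l))" "grad_rel f f'" by blast
    have "grad_rel u (c' + f')"
      unfolding cf(3) by (rule linear_rel_add[OF linear_rel_grad, OF c'(2) f'(2)])
    then show ?thesis using c'(1) f'(1) W_Suc(2)[OF l] by blast
  qed
  moreover have "\<exists>w\<in>W2 (Suc l). curl_rel v w" if v: "v \<in> W1 (Suc l)" for v
  proof -
    from v obtain c f where cf: "c \<in> W1 l" "f \<in> V1 (Suc l) (\<Omega> (Suc l))" "v = c + f"
      unfolding W_Suc[OF l] by blast
    from cf(1) Suc obtain c' where c': "c' \<in> W2 l" "curl_rel c c'" by auto
    from curl_form[OF K cf(2)] obtain f' where f': "f' \<in> V2 (Suc l) (\<Omega> (Suc l))" "curl_rel f f'" by blast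
    have "curl_rel v (c' + f')"
      unfolding cf(3) by (rule linear_rel_add[OF linear_rel_curl, OF c'(2) f'(2)])
    then show ?thesis using c'(1) f'(1) W_Suc(3)[OF l] by blast
  qed
  ultimately show ?case by blast
qed

text \<open>This takes the place of linear independence of the hierarchical basis. Off the newest
  subdomain the added part is 0, so the coarse part vanishes there too and is of level
  \<open>l\<close> by induction, with that subdomain in the role of \<open>V\<close>. The sum is
  then a form of one level, to which \<open>form2_vanishing\<close> applies.\<close>

lemma W2_vanishing:
  assumes "l \<le> N" "w \<in> W2 l" "interior (closure V) = V" "V \<subseteq> \<Omega> l"
    and "\<And>z. z \<in> Omega_hat - closure V \<Longrightarrow> w z = 0"
  shows "w \<in> V2 l V"
  using assms
proof (induction l arbitrary: w V)
  case 0
  then show ?case using form2_vanishing[OF level_knots[OF le0]] by (simp add: W_base)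
next
  case (Suc l)
  then have l: "l < N" by simp
  interpret refinement "K1 l" "K2 l" "K1 (Suc l)" "K2 (Suc l)" "\<Omega> (Suc l)"
    by (rule level_refinement[OF l])
  from Suc.prems(2) obtain c f where cf: "c \<in> W2 l" "f \<in> V2 (Suc l) (\<Omega> (Suc l))" "w = c + f"
    unfolding W_Suc[OF l] by blast
  have "c z = 0" if "z \<in> Omega_hat - closure (\<Omega> (Suc l))" for z
  proof -
    have "w z = 0" using that closure_mono[OF Suc.prems(4)] by (intro Suc.prems(5)) blast
    moreover have "f z = 0" using that by (intro form_eq_0(3)[OF fine _ cf(2)]) simp
    ultimately show ?thesis using cf(3) by simp
  qed
  then have "c \<in> V2 l (\<Omega> (Suc l))"
    using l level_domain(2)[of l] by (intro Suc.IH cf regular) auto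
  then have "w \<in> V2 (Suc l) (\<Omega> (Suc l))"
    unfolding cf(3) using form_subset(3) cf(2) by (intro subspace_add subspace_form) auto
  then show ?case
    using Suc.prems(5) by (rule form2_vanishing[OF fine _ Suc.prems(3)])
qed

lemma W2_integrable:
  assumes "l \<le> N" "w \<in> W2 l"
  shows "set_integrable lborel Omega_hat w"
proof -
  have "w \<in> V2 l Omega_hat" using W_subset_V[OF assms(1)] assms(2) by blast
  then show ?thesis
    using density_form_integral(1)[OF level_knots[OF assms(1)]] by (auto simp: form2_iff)
qed

lemma W_exact:
  assumes "l \<le> N"
  shows "(\<forall>v\<in>W1 l. curl_rel v 0 \<longrightarrow> (\<exists>u\<in>W0 l. grad_rel u v)) \<and>
    (\<forall>w\<in>W2 l. (LINT z:Omega_hat|lborel. w z) = 0 \<longrightarrow> (\<exists>v\<in>W1 l. curl_rel v w))"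
  using assms
proof (induction l)
  case 0
  note K = level_knots[OF le0]
  show ?case
    using closed_form_exact[OF K] integral_zero_imp_curl[OF K] unfolding W_base curls_def by blast
next
  case (Suc l)
  then have l: "l < N" by simp
  interpret refinement "K1 l" "K2 l" "K1 (Suc l)" "K2 (Suc l)" "\<Omega> (Suc l)"
    by (rule level_refinement[OF l])
  note IH = Suc.IH[OF less_imp_le[OF l]]
  have "\<exists>u\<in>W0 (Suc l). grad_rel u v" if v: "v \<in> W1 (Suc l)" "curl_rel v 0" for v
  proof -
    from v(1) obtain c f where cf: "c \<in> W1 l" "f \<in> V1 (Suc l) (\<Omega> (Suc l))" "v = c + f"
      unfolding W_Suc[OF l] by blast
    from W_maps[of l] l cf(1) obtain a where a: "a \<in> W2 l" "curl_rel c a" by auto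
    from curl_form[OF fine cf(2)] obtain b where b: "b \<in> V2 (Suc l) (\<Omega> (Suc l))" "curl_rel f b" by blast
    have "a + b = 0"
      using linear_rel_unique[OF linear_rel_curl, OF v(2)[unfolded cf(3)]] linear_rel_add[OF linear_rel_curl, OF a(2) b(2)]
      by metis
    then have ab: "a = - b" by (simp only: add_eq_0_iff2)
    have "a \<in> V2 l (\<Omega> (Suc l))"
    proof (rule W2_vanishing[OF _ a(1) regular])
      show "a z = 0" if "z \<in> Omega_hat - closure (\<Omega> (Suc l))" for z
        using form_eq_0(3)[OF fine _ b(1), of z] that unfolding ab by simp
    qed (use l level_domain(2)[of l] in auto)
    moreover have "a \<in> curls (K1 (Suc l)) (K2 (Suc l)) (\<Omega> (Suc l))"
      unfolding ab using subspace_neg[OF subspace_curls] b(2) cf(2) unfolding curls_def by blast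
    ultimately have "a \<in> curls (K1 l) (K2 l) (\<Omega> (Suc l))" by (rule coarse_curl)
    then obtain g where g: "g \<in> V1 l (\<Omega> (Suc l))" "curl_rel g a" by (auto simp: curls_def)
    have "c - g \<in> W1 l"
      using cf(1) g(1) V_subset_W(1)[OF l] by (intro subspace_diff[OF subspace_W(2)]) auto
    moreover have "curl_rel (c - g) 0"
      using linear_rel_diff[OF linear_rel_curl, OF a(2) g(2)] by (simp only: diff_self)
    ultimately obtain u1 where u1: "u1 \<in> W0 l" "grad_rel u1 (c - g)" using IH by blast
    have "f + g \<in> V1 (Suc l) (\<Omega> (Suc l))"
      using cf(2) g(1) form_subset(2) by (intro subspace_add[OF subspace_form(2)]) auto
    moreover have "curl_rel (f + g) 0"
      using linear_rel_add[OF linear_rel_curl, OF b(2) g(2)] by (simp only: ab right_minus)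
    ultimately obtain d h where dh: "d \<in> V1 l (\<Omega> (Suc l))" "curl_rel d 0"
      "h \<in> V0 (Suc l) (\<Omega> (Suc l))" "grad_rel h (f + g - d)"
      by (rule closed_form_decompose)
    then obtain u2 where u2: "u2 \<in> W0 l" "grad_rel u2 d" using IH V_subset_W(1)[OF l] by blast
    \<comment> \<open>The potentials belong to the closed coarse rest \<open>c - g\<close>, to the
      closed field \<open>d\<close> supported in the new subdomain, and to the remainder, which is
      exact among the fine forms.\<close>
    have "grad_rel (u1 + u2 + h) (c - g + d + (f + g - d))"
      by (rule linear_rel_add[OF linear_rel_grad, OF linear_rel_add[OF linear_rel_grad, OF u1(2) u2(2)] dh(4)])
    moreover have "c - g + d + (f + g - d) = v"
      by (simp add: cf(3) algebra_simps)
    moreover have "u1 + u2 + h \<in> W0 (Suc l)"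
      unfolding W_Suc[OF l] using u1(1) u2(1) dh(3) subspace_add[OF subspace_W(1)] by blast
    ultimately show ?thesis by metis
  qed
  moreover have "\<exists>v\<in>W1 (Suc l). curl_rel v w" if w: "w \<in> W2 (Suc l)" "(LINT z:Omega_hat|lborel. w z) = 0" for w
  proof -
    from w(1) obtain c f where cf: "c \<in> W2 l" "f \<in> V2 (Suc l) (\<Omega> (Suc l))" "w = c + f"
      unfolding W_Suc[OF l] by blast
    from cf(2) obtain a where a: "a \<in> V2 l (\<Omega> (Suc l))" "f - a \<in> curls (K1 (Suc l)) (K2 (Suc l)) (\<Omega> (Suc l))"
      by (rule form2_decompose)
    then obtain g where g: "g \<in> V1 (Suc l) (\<Omega> (Suc l))" "curl_rel g (f - a)" by (auto simp: curls_def)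
    have ca: "c + a \<in> W2 l"
      using cf(1) a(1) V_subset_W(2)[OF l] by (intro subspace_add[OF subspace_W(3)]) auto
    have "(LINT z:Omega_hat|lborel. (c + a) z) = 0"
    proof -
      have w_eq: "w = (c + a) + (f - a)" by (simp add: cf(3))
      have "0 \<in> W1 l" by (rule subspace_0[OF subspace_W(2)])
      then have "g \<in> W1 (Suc l)" unfolding W_Suc(2)[OF l] using g(1) add_0_left[of g, symmetric] by blast
      then obtain g' where "g' \<in> W2 (Suc l)" "curl_rel g g'" using W_maps[OF Suc.prems] by blast
      then have "f - a \<in> W2 (Suc l)" using linear_rel_unique[OF linear_rel_curl, OF g(2)] by blast
      then have "set_integrable lborel Omega_hat (f - a)" by (rule W2_integrable[OF Suc.prems])
      moreover have "set_integrable lborel Omega_hat (c + a)"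
        using ca l by (intro W2_integrable[of l]) auto
      ultimately have "(LINT z:Omega_hat|lborel. (c + a) z + (f - a) z)
          = (LINT z:Omega_hat|lborel. (c + a) z) + (LINT z:Omega_hat|lborel. (f - a) z)"
        by (intro set_integral_add(2))
      moreover have "(LINT z:Omega_hat|lborel. (f - a) z) = 0"
        by (rule curl_integral[OF fine a(2)])
      moreover have "(LINT z:Omega_hat|lborel. (c + a) z + (f - a) z) = 0"
        using w(2) unfolding w_eq by simp
      ultimately show ?thesis by simp
    qed
    with ca IH obtain v where v: "v \<in> W1 l" "curl_rel v (c + a)" by blast
    have "curl_rel (v + g) ((c + a) + (f - a))"
      by (rule linear_rel_add[OF linear_rel_curl, OF v(2) g(2)])
    moreover have "(c + a) + (f - a) = w" by (simp add: cf(3))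
    moreover have "v + g \<in> W1 (Suc l)"
      unfolding W_Suc[OF l] using v(1) g(1) by blast
    ultimately show ?thesis by metis
  qed
  ultimately show ?case by blast
qed

lemma W2_unit_integral:
  assumes "l \<le> N"
  shows "\<exists>w\<in>W2 l. (LINT z:Omega_hat|lborel. w z) = 1"
  using assms
proof (induction l)
  case 0
  note K = level_knots[OF le0]
  have two: "2 \<in> {2..nspl (K1 0)}" "2 \<in> {2..nspl (K2 0)}"
    using deg_less_nspl[OF K(1)] deg_pos[OF K(1)] deg_less_nspl[OF K(2)] deg_pos[OF K(2)] by auto
  have "cell_density (K1 0) (K2 0) 2 2 \<in> form2 (K1 0) (K2 0) Omega_hat"
    unfolding form2_def cell_density_def
    by (rule span_base, rule image_eqI[of _ _ "(2, 2)"]) (use two support_in_unit_square(4)[OF K] in auto)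
  then show ?case
    using density_integral[OF K two] by (auto simp: W_base)
next
  case (Suc l)
  then obtain w where w: "w \<in> W2 l" "(LINT z:Omega_hat|lborel. w z) = 1" by auto
  have "l < N" using Suc.prems by simp
  moreover have "w = w + 0" by (simp only: add_0_right)
  ultimately have "w \<in> W2 (Suc l)"
    using w(1) subspace_0[OF subspace_form(3)] W_Suc(3) by blast
  with w(2) show ?case by blast
qed

text \<open>Passes from derivatives at every point to the relations almost everywhere. A field in
  \<open>W1 l\<close> that is a gradient almost everywhere agrees almost everywhere with the
  gradient from \<open>W_maps\<close>, hence everywhere by one-sided continuity; likewise for the
  curl.\<close>

lemma hier_exact:
  assumes l: "l \<le> N"
  shows "exact_complex (W0 l) (W1 l) (W2 l)"
  unfolding exact_complex_def
proof (intro conjI ballI allI impI)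
  note K = level_knots[OF l]
  note V = W_subset_V[OF l, THEN conjunct1] W_subset_V[OF l, THEN conjunct2, THEN conjunct1]
    W_subset_V[OF l, THEN conjunct2, THEN conjunct2]
  have out1: "v z = 0" if "v \<in> W1 l" "z \<notin> {0..<1} \<times> {0..<1}" for v z
  proof -
    have "v \<in> V1 l Omega_hat" using that(1) V by blast
    then obtain a b where v: "v = vector_form (K1 l) (K2 l) a b" unfolding form1_iff by blast
    show ?thesis
      using that(2) spline_eq_0_unit[OF K(1), of "fst z"] spline_eq_0_unit[OF K(2), of "snd z"]
      by (cases z) (auto simp: v vector_form_def zero_prod_def)
  qed
  have out2: "w z = 0" if "w \<in> W2 l" "z \<notin> {0..<1} \<times> {0..<1}" for w z
  proof -
    have "w \<in> V2 l Omega_hat" using that(1) V by blast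
    then obtain c where w: "w = density_form (K1 l) (K2 l) c" unfolding form2_iff by blast
    show ?thesis
      using that(2) spline_eq_0_unit[OF K(1), of "fst z"] spline_eq_0_unit[OF K(2), of "snd z"]
      by (cases z) (auto simp: w density_form_def)
  qed
  have eq1: "v = v'" if "v \<in> W1 l" "v' \<in> W1 l" "AE z in lborel. z \<in> Omega_hat \<longrightarrow> v z = v' z" for v v'
  proof (rule ae_eq_imp_eq[OF _ _ that(3)])
    show "right_continuous v" "right_continuous v'"
      using that V(2) right_continuous_forms(1)[OF K] by blast+
    show "v z = v' z" if "z \<notin> {0..<1} \<times> {0..<1}" for z
      by (simp only: out1[OF \<open>v \<in> W1 l\<close> that] out1[OF \<open>v' \<in> W1 l\<close> that])
  qed
  have eq2: "w = w'" if "w \<in> W2 l" "w' \<in> W2 l" "AE z in lborel. z \<in> Omega_hat \<longrightarrow> w z = w' z" for w w'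
  proof (rule ae_eq_imp_eq[OF _ _ that(3)])
    show "right_continuous w" "right_continuous w'"
      using that V(3) right_continuous_forms(2)[OF K] by blast+
    show "w z = w' z" if "z \<notin> {0..<1} \<times> {0..<1}" for z
      by (simp only: out2[OF \<open>w \<in> W2 l\<close> that] out2[OF \<open>w' \<in> W2 l\<close> that])
  qed
  have grad: "grad_rel u v" if "u \<in> W0 l" "v \<in> W1 l" "is_grad u v" for u v
  proof -
    from W_maps[OF l] that(1) obtain v' where v': "v' \<in> W1 l" "grad_rel u v'" by blast
    have "v = v'"
      by (rule eq1[OF that(2) v'(1) is_grad_unique_ae[OF that(3) grad_rel_imp_is_grad[OF v'(2)]]])
    with v' show ?thesis by simp
  qed
  have curl: "curl_rel v w" if "v \<in> W1 l" "w \<in> W2 l" "is_curl v w" for v w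
  proof -
    from W_maps[OF l] that(1) obtain w' where w': "w' \<in> W2 l" "curl_rel v w'" by blast
    have "w = w'"
      by (rule eq2[OF that(2) w'(1) is_curl_unique_ae[OF that(3) curl_rel_imp_is_curl[OF w'(2)]]])
    with w' show ?thesis by simp
  qed
  have zero: "(\<lambda>_. 0) = (0 :: real \<times> real \<Rightarrow> real)" "(\<lambda>_. 0) = (0 :: real \<times> real \<Rightarrow> real \<times> real)"
    by (simp_all add: zero_fun_def)
  have zeroW: "(0 :: real \<times> real \<Rightarrow> real \<times> real) \<in> W1 l" "(0 :: real \<times> real \<Rightarrow> real) \<in> W2 l"
    by (intro subspace_0 subspace_W)+
  show "\<exists>v\<in>W1 l. is_grad u v" if "u \<in> W0 l" for u
    using W_maps[OF l] that grad_rel_imp_is_grad by blast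
  show "\<exists>w\<in>W2 l. is_curl v w" if "v \<in> W1 l" for v
    using W_maps[OF l] that curl_rel_imp_is_curl by blast
  show "ae_zero u" if u: "u \<in> W0 l" "is_grad u (\<lambda>_. 0)" for u
  proof -
    have uV: "u \<in> V0 l Omega_hat" using u(1) V(1) by blast
    have "grad_rel u 0" using grad[OF u(1) zeroW(1)] u(2) by (simp only: zero)
    \<comment> \<open>The point \<open>(2, 2)\<close> lies outside the closed unit square, where
      \<open>u\<close> is 0.\<close>
    then have "u z = u (2, 2)" for z
      by (intro grad_zero_constant[OF form0_continuous[OF K uV], of 0 UNIV UNIV]) auto
    moreover have "u (2, 2) = 0"
      by (intro form_eq_0(1)[OF K _ uV]) (simp add: Omega_hat_def closure_Times)
    ultimately show ?thesis by (simp add: ae_zero_def)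
  qed
  show "is_curl v (\<lambda>_. 0) \<longleftrightarrow> (\<exists>u\<in>W0 l. is_grad u v)" if v: "v \<in> W1 l" for v
  proof
    assume "is_curl v (\<lambda>_. 0)"
    then have "curl_rel v 0" using curl[OF v zeroW(2)] by (simp only: zero)
    then show "\<exists>u\<in>W0 l. is_grad u v" using W_exact[OF l] v grad_rel_imp_is_grad by blast
  next
    assume "\<exists>u\<in>W0 l. is_grad u v"
    then obtain u where u: "u \<in> W0 l" "is_grad u v" by blast
    then have "curl_rel v 0" using curl_grad[OF K _ grad[OF u(1) v u(2)]] V(1) by blast
    then show "is_curl v (\<lambda>_. 0)" unfolding zero by (rule curl_rel_imp_is_curl)
  qed
  show "(LINT z:Omega_hat|lborel. w z) = 0 \<longleftrightarrow> (\<exists>v\<in>W1 l. is_curl v w)" if w: "w \<in> W2 l" for w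
  proof
    assume "(LINT z:Omega_hat|lborel. w z) = 0"
    then show "\<exists>v\<in>W1 l. is_curl v w" using W_exact[OF l] w curl_rel_imp_is_curl by blast
  next
    assume "\<exists>v\<in>W1 l. is_curl v w"
    then obtain v where "v \<in> W1 l" "curl_rel v w" using curl w by blast
    then have "w \<in> curls (K1 l) (K2 l) Omega_hat" using V(2) by (auto simp: curls_def)
    then show "(LINT z:Omega_hat|lborel. w z) = 0" by (rule curl_integral[OF K])
  qed
  show "\<exists>w\<in>W2 l. (LINT z:Omega_hat|lborel. w z) = c" for c
  proof -
    obtain w where w: "w \<in> W2 l" "(LINT z:Omega_hat|lborel. w z) = 1"
      using W2_unit_integral[OF l] by blast
    have "(LINT z:Omega_hat|lborel. (c *\<^sub>R w) z) = c"
      using w(2) by (simp add: scaleR_fun_apply)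
    then show ?thesis using subspace_scale[OF subspace_W(3) w(1)] by blast
  qed
qed

end

theorem theorem5p6:
  fixes N :: nat
    and K1 K2 :: "nat \<Rightarrow> knot_vector"
    and \<Omega> :: "nat \<Rightarrow> (real \<times> real) set"
  defines "\<B>0 \<equiv> \<lambda>l. basis0 (K1 l) (K2 l)"
    and "\<B>1 \<equiv> \<lambda>l. basis1 (K1 l) (K2 l)"
    and "\<B>2 \<equiv> \<lambda>l. basis2 (K1 l) (K2 l)"
  assumes levels: "nested_spline_levels N K1 K2"
    and subdomains: "nested_subdomains N K1 K2 \<Omega>"
    and union_of_supports:
      "\<And>l. l < N \<Longrightarrow> \<exists>S \<subseteq> \<B>2 l. closure (\<Omega> (Suc l)) = closure (\<Union>\<beta>\<in>S. supp \<beta>)"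
    and overlaps:
      "\<And>l T. l < N \<Longrightarrow> T \<in> supp ` \<B>0 l \<union> supp ` \<B>1 l \<union> supp ` \<B>2 l \<Longrightarrow>
         connected (T \<inter> (\<Omega> 0 - closure (\<Omega> (Suc l)))) \<and>
         simply_connected (T \<inter> (\<Omega> 0 - closure (\<Omega> (Suc l))))"
    and "l \<le> N"
  shows "exact_complex (hier_space \<B>0 \<Omega> l) (hier_space \<B>1 \<Omega> l) (hier_space \<B>2 \<Omega> l)"
  unfolding \<B>0_def \<B>1_def \<B>2_def
proof (rule hier_exact[OF levels subdomains _ _ \<open>l \<le> N\<close>])
  show "\<exists>S \<subseteq> basis2 (K1 l) (K2 l). closure (\<Omega> (Suc l)) = closure (\<Union>\<beta>\<in>S. supp \<beta>)" if "l < N" for l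
    using union_of_supports[OF that] by (simp add: \<B>2_def)
  show "connected (T \<inter> (\<Omega> 0 - closure (\<Omega> (Suc l))))"
    if "l < N" "T \<in> supp ` basis0 (K1 l) (K2 l)" for l T
    using overlaps[OF that(1), of T] that(2) by (simp add: \<B>0_def)
qed

end
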